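(* Let $1\le p,q\le\infty$, $m>1/p$, $A>0$, and let $\|\cdot\|_{B^m_{p,q}}$ be the sequence-space Besov norm with these parameters (see context). Let $(e_i)_{i\ge1}$ be i.i.d. symmetric random variables with mean zero and variance one, and suppose that $E|e_1|^L<\infty$ for some $L$ such that $$L>\frac{6}{2m/(2m+1)}\quad\text{if } p\ge 2,$$ and $$L>\frac{6\,(m+1/2-1/p)(2m+1)}{(m+1/2-1/p)(2m+1)-m}\quad\text{if } 1\le p\le 2 .$$ For $n=2^h$, $h\in\mathbb N$, let $W_n$ be the discrete wavelet transform described in the context, and for $\theta\in\mathbb R^n$ let $w=\theta+z$ with $z=W_n(e_1/\sqrt n,\dots,e_n/\sqrt n)$ be the vector of noisy wavelet coefficients. Write $E$ for expectation under the law of the $e_i$ above, and $E_\Phi$ for expectation in the same model but with the $e_i$ replaced by i.i.d. standard normal random variables. Then $$\liminf_{n\to\infty}\ \frac{\displaystyle\inf_{\lambda\in(0,\infty)^n}\ \sup_{\theta:\ \|\theta\|_{B^m_{p,q}}\le A}\ E_\Phi\sum_{j,k}\bigl(T^S_{\lambda_{j,k}}(w_{j,k})-\theta_{j,k}\bigr)^2}{\displaystyle\inf_{\tilde\lambda\in(0,\infty)^n}\ \sup_{\theta:\ \|\theta\|_{B^m_{p,q}}\le A}\ E\sum_{j,k}\bigl(T^S_{\tilde\lambda_{j,k}}(w_{j,k})-\theta_{j,k}\bigr)^2}\ \ge\ 1,$$ where the sums run over all $n$ coefficients (including the coarse-scale ones), the suprema are over $\theta\in\mathbb R^n$, and the limit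 is along $n=2^h$, $h\to\infty$.
   Context: Model. For $n=2^h$, $h\in\mathbb N$, the data are $X_i=f_i+e_i/\sqrt n$, $i=1,\dots,n$, where $f=(f_i)\in\mathbb R^n$ is an unknown signal and $(e_i)$ is noise. Discrete wavelet transform. Fix an orthonormal wavelet basis adapted to an interval, generated by a compactly supported scaling function $\phi$ and a compactly supported wavelet $\psi$, with $\psi$ Hölder continuous of some index $\beta>0$, and a fixed coarsest level $j_0$ (independent of $n$). Let $V_j$, of dimension $2^j$, denote the corresponding multiresolution spaces, with orthonormal basis $(\phi_{j,k})_{k=1,\dots,2^j}$, and let $(\psi_{j,k})_{k=1,\dots,2^j}$ be the orthonormal basis of the orthogonal complement of $V_j$ in $V_{j+1}$. The map $W_n:\mathbb R^n\to\mathbb R^n$ is the orthogonal linear map that takes the vector $(x_k)_{k=1,\dots,n}$, viewed as the coefficients of $\sum_k x_k\phi_{h,k}\in V_h$, to the coefficients of the same element in the orthonormal basis $\{\phi_{j_0,k}:k=1,\dots,2^{j_0}\}\cup\{\psi_{j,k}: j_0\le j\le h-1,\ k=1,\dots,2^j\}$ of $V_h$. It is computed by iterating the (finite-length) scaling identities. Vectors in the range are written $\theta=((\theta_k)_{k=1,\dots,2^{j_0}},(\theta_{j,k})_{j_0\le j\le h-1,\,1\le k\le 2^j})$. With $\theta=W_n(f)$ and $z=W_n(e/\sqrt n)$, the noisy coefficients are $w=W_n(X)=\theta+z$, i.e. $w_k=\theta_k+z_k$ and $w_{j,k}=\theta_{j,k}+z_{j,k}$. As $W_n$ is a bijection, ranging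 over signals is the same as ranging over $\theta\in\mathbb R^n$. Besov sequence norm. With $s:=m+1/2-1/p$, $$\|\theta\|_{B^m_{p,q}}:=\Bigl(\sum_k|\theta_k|^p\Bigr)^{1/p}+\Bigl(\sum_{j\ge j_0}\Bigl(2^{js}\Bigl(\sum_k|\theta_{j,k}|^p\Bigr)^{1/p}\Bigr)^q\Bigr)^{1/q},$$ with the usual modification (suprema) when $p$ or $q$ is infinite. Soft thresholding. For $\lambda>0$, $T^S_\lambda(x)=(|x|-\lambda)^+\operatorname{sgn}(x)$, $x\in\mathbb R$. A random variable $e$ is symmetric if $e$ and $-e$ have the same law. *)

theory Defs
  imports "HOL-Probability.Probability"
begin

section \<open>Square-integrable functions on a subset of the line\<close>

definition L2_on :: "real set \<Rightarrow> (real \<Rightarrow> real) \<Rightarrow> bool" where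
  "L2_on D f \<longleftrightarrow> f \<in> borel_measurable (lebesgue_on D) \<and> integrable (lebesgue_on D) (\<lambda>x. (f x)\<^sup>2)"

definition L2_inner :: "real set \<Rightarrow> (real \<Rightarrow> real) \<Rightarrow> (real \<Rightarrow> real) \<Rightarrow> real" where
  "L2_inner D f g = (\<integral>x. f x * g x \<partial>lebesgue_on D)"

definition L2_orthonormal :: "real set \<Rightarrow> 'i set \<Rightarrow> ('i \<Rightarrow> real \<Rightarrow> real) \<Rightarrow> bool" where
  "L2_orthonormal D I u \<longleftrightarrow>
     (\<forall>i\<in>I. L2_on D (u i)) \<and>
     (\<forall>i\<in>I. \<forall>i'\<in>I. L2_inner D (u i) (u i') = (if i = i' then 1 else 0))"

definition L2_total :: "real set \<Rightarrow> 'i set \<Rightarrow> ('i \<Rightarrow> real \<Rightarrow> real) \<Rightarrow> bool" where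
  "L2_total D I u \<longleftrightarrow>
     (\<forall>f. L2_on D f \<longrightarrow> (\<forall>\<epsilon>>0. \<exists>F c. finite F \<and> F \<subseteq> I \<and>
        (\<integral>x. (f x - (\<Sum>i\<in>F. c i * u i x))\<^sup>2 \<partial>lebesgue_on D) < \<epsilon>))"

definition L2_orthonormal_basis :: "real set \<Rightarrow> 'i set \<Rightarrow> ('i \<Rightarrow> real \<Rightarrow> real) \<Rightarrow> bool" where
  "L2_orthonormal_basis D I u \<longleftrightarrow> L2_orthonormal D I u \<and> L2_total D I u"

text \<open>Linear span of a finite family, as a set of functions closed under equality almost
  everywhere on \<open>D\<close>.\<close>

definition L2_span :: "real set \<Rightarrow> 'i set \<Rightarrow> ('i \<Rightarrow> real \<Rightarrow> real) \<Rightarrow> (real \<Rightarrow> real) set" where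
  "L2_span D I u = {f. \<exists>c. AE x in lebesgue_on D. f x = (\<Sum>i\<in>I. c i * u i x)}"


section \<open>Wavelets on the line\<close>

definition dilate :: "(real \<Rightarrow> real) \<Rightarrow> int \<Rightarrow> int \<Rightarrow> real \<Rightarrow> real" where
  "dilate f j k x = sqrt (2 powi j) * f (2 powi j * x - of_int k)"

definition compactly_supported :: "(real \<Rightarrow> real) \<Rightarrow> bool" where
  "compactly_supported f \<longleftrightarrow> (\<exists>K. \<forall>x. \<bar>x\<bar> > K \<longrightarrow> f x = 0)"

text \<open>Restricting to indices at most one loses nothing here: a compactly supported function which
  is smoother than that is in particular Lipschitz.\<close>

definition hoelder_continuous :: "(real \<Rightarrow> real) \<Rightarrow> bool" where
  "hoelder_continuous f \<longleftrightarrow>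
     (\<exists>\<beta> C. 0 < \<beta> \<and> \<beta> \<le> 1 \<and> (\<forall>x y. \<bar>f x - f y\<bar> \<le> C * \<bar>x - y\<bar> powr \<beta>))"

text \<open>The spaces \<open>V\<^sub>j\<close> generated by \<open>\<phi>\<close> form a multiresolution analysis of \<open>L\<^sup>2(\<real>)\<close>: they are nested
  by the scaling identity for \<open>\<phi>\<close>; their union is dense, since every \<open>\<psi>\<^sub>j\<^sub>,\<^sub>k\<close> lies in some \<open>V\<^sub>J\<close>;
  their intersection is trivial, since it is orthogonal to every \<open>\<psi>\<^sub>j\<^sub>,\<^sub>k\<close>.\<close>

definition orthonormal_wavelet :: "(real \<Rightarrow> real) \<Rightarrow> (real \<Rightarrow> real) \<Rightarrow> bool" where
  "orthonormal_wavelet \<phi> \<psi> \<longleftrightarrow>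
     (\<exists>S c. finite S \<and> (\<forall>x. \<phi> x = (\<Sum>l\<in>S. c l * dilate \<phi> 1 l x))) \<and>
     (\<exists>S c. finite S \<and> (\<forall>x. \<psi> x = (\<Sum>l\<in>S. c l * dilate \<phi> 1 l x))) \<and>
     L2_orthonormal UNIV UNIV (dilate \<phi> 0) \<and>
     (\<forall>k l. L2_inner UNIV (dilate \<phi> 0 k) (dilate \<psi> 0 l) = 0) \<and>
     L2_orthonormal_basis UNIV UNIV (\<lambda>(j, k). dilate \<psi> j k)"


section \<open>Wavelets adapted to the unit interval\<close>

text \<open>The function with index \<open>k \<in> {1..2\<^sup>j}\<close> at level \<open>j\<close> is the dilated translate of \<open>g\<close>, except for
  the first and last \<open>N\<close> indices. These give edge functions: \<open>2\<^sup>j\<^sup>/\<^sup>2\<close> times a function of \<open>2\<^sup>j x\<close> near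
  the left endpoint plus a function of \<open>2\<^sup>j (x - 1)\<close> near the right endpoint, both independent of
  \<open>j\<close> and finite linear combinations of restricted translates of \<open>\<phi>\<close> (for \<open>d = 0\<close>) or of
  \<open>\<phi> (2 \<cdot>)\<close> (for \<open>d = 1\<close>). The edge functions are labelled \<open>r = 1, \<dots>, N\<close> on the left and
  \<open>r = 1 - N, \<dots>, 0\<close> on the right. The boundary-corrected bases of Cohen, Daubechies and
  Vial have only one of the two parts in each edge function; periodised bases have both.\<close>

definition interval_adapted ::
  "(real \<Rightarrow> real) \<Rightarrow> (real \<Rightarrow> real) \<Rightarrow> nat \<Rightarrow> nat \<Rightarrow> (nat \<Rightarrow> nat \<Rightarrow> real \<Rightarrow> real) \<Rightarrow> bool" where
  "interval_adapted \<phi> g d j0 u \<longleftrightarrow>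
     (\<exists>(N::nat) (s::int) S (a :: int \<Rightarrow> int \<Rightarrow> real) (b :: int \<Rightarrow> int \<Rightarrow> real).
        finite S \<and> 2 * N \<le> 2 ^ j0 \<and>
        (\<forall>j\<ge>j0. \<forall>k\<in>{1..2 ^ j}. \<forall>x\<in>{0..1}.
           u j k x =
             (if N < k \<and> k \<le> 2 ^ j - N then dilate g (int j) (int k + s) x
              else let r = (if k \<le> N then int k else int k - 2 ^ j) in
                \<Sum>l\<in>S. a r l * dilate \<phi> (int (j + d)) l x
                     + b r l * dilate \<phi> (int (j + d)) (2 ^ (j + d) + l) x)))"

text \<open>Coefficient indices: \<open>Scaling k\<close> belongs to \<open>\<phi>\<^sub>j\<^sub>0\<^sub>,\<^sub>k\<close> and \<open>Detail j k\<close> to \<open>\<psi>\<^sub>j\<^sub>,\<^sub>k\<close>.\<close>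

datatype wav_index = Scaling nat | Detail nat nat

definition wav_indices :: "nat \<Rightarrow> nat \<Rightarrow> wav_index set" where
  "wav_indices j0 h =
     {Scaling k | k. k \<in> {1..2 ^ j0}} \<union> {Detail j k | j k. j0 \<le> j \<and> j < h \<and> k \<in> {1..2 ^ j}}"

definition wav_fun ::
  "nat \<Rightarrow> (nat \<Rightarrow> nat \<Rightarrow> real \<Rightarrow> real) \<Rightarrow> (nat \<Rightarrow> nat \<Rightarrow> real \<Rightarrow> real) \<Rightarrow> wav_index \<Rightarrow> real \<Rightarrow> real" where
  "wav_fun j0 \<Phi> \<Psi> i = (case i of Scaling k \<Rightarrow> \<Phi> j0 k | Detail j k \<Rightarrow> \<Psi> j k)"

definition mr_space :: "(nat \<Rightarrow> nat \<Rightarrow> real \<Rightarrow> real) \<Rightarrow> nat \<Rightarrow> (real \<Rightarrow> real) set" where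
  "mr_space \<Phi> j = L2_span {0..1} {1..2 ^ j} (\<Phi> j)"

definition interval_wavelet_basis ::
  "(real \<Rightarrow> real) \<Rightarrow> (real \<Rightarrow> real) \<Rightarrow> nat \<Rightarrow>
   (nat \<Rightarrow> nat \<Rightarrow> real \<Rightarrow> real) \<Rightarrow> (nat \<Rightarrow> nat \<Rightarrow> real \<Rightarrow> real) \<Rightarrow> bool" where
  "interval_wavelet_basis \<phi> \<psi> j0 \<Phi> \<Psi> \<longleftrightarrow>
     compactly_supported \<phi> \<and> compactly_supported \<psi> \<and> hoelder_continuous \<psi> \<and>
     orthonormal_wavelet \<phi> \<psi> \<and>
     interval_adapted \<phi> \<phi> 0 j0 \<Phi> \<and> interval_adapted \<phi> \<psi> 1 j0 \<Psi> \<and>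
     (\<forall>j\<ge>j0. L2_orthonormal {0..1} {1..2 ^ j} (\<Phi> j)) \<and>
     (\<forall>j\<ge>j0. L2_orthonormal {0..1} {1..2 ^ j} (\<Psi> j)) \<and>
     (\<forall>j\<ge>j0. mr_space \<Phi> j \<subseteq> mr_space \<Phi> (Suc j)) \<and>
     (\<forall>j\<ge>j0. L2_span {0..1} {1..2 ^ j} (\<Psi> j) =
        {f \<in> mr_space \<Phi> (Suc j). \<forall>g\<in>mr_space \<Phi> j. L2_inner {0..1} f g = 0}) \<and>
     L2_orthonormal_basis {0..1} (\<Union>h. wav_indices j0 h) (wav_fun j0 \<Phi> \<Psi>)"


section \<open>Discrete wavelet transform\<close>

text \<open>The transform \<open>W\<^sub>n\<close> for \<open>n = 2\<^sup>h\<close>; meaningful for \<open>h \<ge> j\<^sub>0\<close>. Vectors in \<open>\<real>\<^sup>n\<close> have coordinates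
  \<open>1, \<dots>, 2\<^sup>h\<close> in the domain and \<open>wav_indices j0 h\<close> in the range.\<close>

definition dwt ::
  "nat \<Rightarrow> (nat \<Rightarrow> nat \<Rightarrow> real \<Rightarrow> real) \<Rightarrow> (nat \<Rightarrow> nat \<Rightarrow> real \<Rightarrow> real) \<Rightarrow> nat \<Rightarrow>
   (nat \<Rightarrow> real) \<Rightarrow> wav_index \<Rightarrow> real" where
  "dwt j0 \<Phi> \<Psi> h x =
     (THE \<theta>. \<theta> \<in> wav_indices j0 h \<rightarrow>\<^sub>E UNIV \<and>
        (AE t in lebesgue_on {0..1}.
           (\<Sum>k\<in>{1..2 ^ h}. x k * \<Phi> h k t) =
           (\<Sum>i\<in>wav_indices j0 h. \<theta> i * wav_fun j0 \<Phi> \<Psi> i t)))"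


section \<open>Besov sequence norm\<close>

text \<open>The element \<open>0\<close> is inserted so that the norm of the empty vector is zero (needed for
  \<open>h = j\<^sub>0\<close>).\<close>

definition lp_norm :: "ereal \<Rightarrow> 'i set \<Rightarrow> ('i \<Rightarrow> real) \<Rightarrow> real" where
  "lp_norm p I x =
     (if p = \<infinity> then Max (insert 0 ((\<lambda>i. \<bar>x i\<bar>) ` I))
      else (\<Sum>i\<in>I. \<bar>x i\<bar> powr real_of_ereal p) powr (1 / real_of_ereal p))"

definition besov_norm ::
  "real \<Rightarrow> ereal \<Rightarrow> ereal \<Rightarrow> nat \<Rightarrow> nat \<Rightarrow> (wav_index \<Rightarrow> real) \<Rightarrow> real" where
  "besov_norm m p q j0 h \<theta> =
     (let s = m + 1 / 2 - real_of_ereal (1 / p) in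
        lp_norm p {1..2 ^ j0} (\<lambda>k. \<theta> (Scaling k)) +
        lp_norm q {j0..<h} (\<lambda>j. 2 powr (real j * s) * lp_norm p {1..2 ^ j} (\<lambda>k. \<theta> (Detail j k))))"


section \<open>Minimax risk of soft thresholding\<close>

definition soft_threshold :: "real \<Rightarrow> real \<Rightarrow> real" where
  "soft_threshold l x = max (\<bar>x\<bar> - l) 0 * sgn x"

text \<open>Risk at \<open>\<theta>\<close> with threshold vector \<open>l\<close> under noise \<open>e\<close>; the summand is
  \<open>(T\<^sup>S\<^sub>l (w) - \<theta>)\<^sup>2\<close> with \<open>w = \<theta> + z\<close>.\<close>

definition soft_risk ::
  "'a measure \<Rightarrow> (nat \<Rightarrow> 'a \<Rightarrow> real) \<Rightarrow>
   nat \<Rightarrow> (nat \<Rightarrow> nat \<Rightarrow> real \<Rightarrow> real) \<Rightarrow> (nat \<Rightarrow> nat \<Rightarrow> real \<Rightarrow> real) \<Rightarrow> nat \<Rightarrow>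
   (wav_index \<Rightarrow> real) \<Rightarrow> (wav_index \<Rightarrow> real) \<Rightarrow> ennreal" where
  "soft_risk M e j0 \<Phi> \<Psi> h l \<theta> =
     (\<integral>\<^sup>+\<omega>. (let z = dwt j0 \<Phi> \<Psi> h (\<lambda>i. e i \<omega> / sqrt (2 ^ h)) in
        ennreal (\<Sum>i\<in>wav_indices j0 h. (soft_threshold (l i) (\<theta> i + z i) - \<theta> i)\<^sup>2)) \<partial>M)"

definition minimax_soft_risk ::
  "'a measure \<Rightarrow> (nat \<Rightarrow> 'a \<Rightarrow> real) \<Rightarrow>
   nat \<Rightarrow> (nat \<Rightarrow> nat \<Rightarrow> real \<Rightarrow> real) \<Rightarrow> (nat \<Rightarrow> nat \<Rightarrow> real \<Rightarrow> real) \<Rightarrow>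
   real \<Rightarrow> ereal \<Rightarrow> ereal \<Rightarrow> real \<Rightarrow> nat \<Rightarrow> ennreal" where
  "minimax_soft_risk M e j0 \<Phi> \<Psi> m p q A h =
     (INF l \<in> wav_indices j0 h \<rightarrow>\<^sub>E {0<..}.
        SUP \<theta> \<in> {\<theta> \<in> wav_indices j0 h \<rightarrow>\<^sub>E UNIV. besov_norm m p q j0 h \<theta> \<le> A}.
          soft_risk M e j0 \<Phi> \<Psi> h l \<theta>)"

end

theory Submission
  imports Defs "HOL-Real_Asymp.Real_Asymp"
begin

text \<open>
  After rescaling by \<open>\<surd>n\<close>, both minimax risks are sums of one-dimensional risks of weighted sums
  \<open>S = \<Sum> a\<^sub>k e\<^sub>k\<close>, the weights forming a row of the orthogonal transform. Expanding the square, the risk of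
  a soft threshold is an affine expression in the hinge functions \<open>E (S - u)\<^sub>+\<close> and \<open>E (S - u)\<^sub>+\<^sup>2\<close>. By Stein's
  method, and because symmetric noise has vanishing third moments, \<open>E (S - u)\<^sub>+\<^sup>2\<close> differs from its Gaussian
  value by at most a constant times \<open>\<Sum> a\<^sub>k\<^sup>4\<close>, uniformly in \<open>u\<close>; convexity in \<open>u\<close> turns this into a bound for
  \<open>E (S - u)\<^sub>+\<close>. Hence the risk under the noise is at most \<open>1 + O(\<tau>)\<close> times the Gaussian risk plus
  \<open>O(\<tau>\<^sup>-\<^sup>2 \<Sum> a\<^sub>k\<^sup>4)\<close>, uniformly in the threshold and the signal.

  For a coefficient at level \<open>j\<close>, \<open>\<Sum> a\<^sub>k\<^sup>4 = O(2\<^sup>j / n)\<close>, except for the boundedly many edge wavelets, where the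
  trivial bound 1 suffices. Thresholds below level \<open>J \<approx> b log\<^sub>2 n\<close> are kept and all coefficients from level \<open>J\<close>
  on are killed; for a suitable \<open>b\<close> the total additive error is of smaller order than
  \<open>n\<^bsup>- 2 m / (2 m + 1)\<^esup>\<close>, a lower bound for the Gaussian minimax risk.
\<close>

section \<open>Stein's equation for squared hinge functions\<close>

text \<open>Only an upper bound for the risk under the given noise is required, so the thresholds
  may be modified to suit that noise. The test function is the squared hinge because its Stein
  solution has a Lipschitz second derivative, which is what an expansion to fourth order consumes;
  the solution for the plain hinge is one derivative rougher. The price is that
  \<open>hinge1\<close> is compared only up to the square root of the error \<Delta> of
  \<open>hinge2\<close>. It enters the risk with the factor t, so this alone gives no bound uniform
  in the signal. Weighted AM-GM moves t \<surd>\<Delta> partly into a fraction \<tau> of the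
  Gaussian risk and partly into \<Delta> / \<tau>; with \<tau> = 1 / h, where n = 2^h, the loss is
  logarithmic in n. Close to the finest level the normal approximation is too poor, but there the
  Besov ball makes zero a good estimate. The two requirements on the cut-off n^b are compatible
  exactly when m < \<sigma> (m + 1), where \<sigma> = min m (m + 1/2 - 1/p) is the decay exponent of
  the l^2 norms of the levels.\<close>

definition normal_tail :: "real \<Rightarrow> real" where
  "normal_tail x = 1 - cdf std_normal_distribution x"

lemma std_normal_density_deriv:
  "(std_normal_density has_real_derivative - x * std_normal_density x) (at x)"
proof -
  have "((\<lambda>x. c * exp (- x\<^sup>2 / 2)) has_real_derivative - x * (c * exp (- x\<^sup>2 / 2))) (at x)" for c
    by (auto intro!: derivative_eq_intros)
  then show ?thesis
    unfolding std_normal_density_def[abs_def] .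
qed

text \<open>The continuous density has an antiderivative \<open>F\<close>. By the fundamental
  theorem \<open>F\<close> and the distribution function have equal increments, so the tail is a
  constant minus \<open>F\<close>.\<close>

lemma normal_tail_deriv [derivative_intros]:
  "(normal_tail has_real_derivative - std_normal_density x) (at x)"
proof -
  interpret D: real_distribution std_normal_distribution
    by (rule real_dist_normal_dist)
  have cont: "continuous_on S std_normal_density" for S
    by (rule DERIV_continuous_on[where D = "\<lambda>x. - x * std_normal_density x"])
      (rule DERIV_subset[OF std_normal_density_deriv], simp)
  have "\<exists>F. \<forall>x. -\<infinity> < x \<longrightarrow> x < (\<infinity>::ereal) \<longrightarrow> (F has_vector_derivative std_normal_density x) (at x)"
    by (rule einterval_antiderivative) (use cont[of UNIV] in \<open>auto simp: continuous_on_eq_continuous_at\<close>)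
  then obtain F where F: "\<And>x. (F has_real_derivative std_normal_density x) (at x)"
    by (auto simp: has_real_derivative_iff_has_vector_derivative)
  have inc: "cdf std_normal_distribution b - cdf std_normal_distribution a = F b - F a"
    if "a < b" for a b
  proof -
    have bi: "has_bochner_integral lborel
        (\<lambda>x. std_normal_density x * indicator {a..b} x) (F b - F a)"
      using has_bochner_integral_FTC_Icc_real[of a b F std_normal_density] F that
      by (auto intro: DERIV_isCont std_normal_density_deriv)
    have "cdf std_normal_distribution b - cdf std_normal_distribution a
        = measure std_normal_distribution {a<..b}"
      using that by (rule D.cdf_diff_eq)
    also have "\<dots> = (\<integral>x. indicator {a<..b} x \<partial>std_normal_distribution)"
      by simp
    also have "\<dots> = (\<integral>x. std_normal_density x * indicator {a<..b} x \<partial>lborel)"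
      by (subst integral_density) (auto simp: normal_density_nonneg)
    also have "\<dots> = (\<integral>x. std_normal_density x * indicator {a..b} x \<partial>lborel)"
    proof (rule integral_cong_AE)
      show "AE x in lborel. std_normal_density x * indicator {a<..b} x
          = std_normal_density x * indicator {a..b} x"
        using AE_lborel_singleton[of a] by eventually_elim (auto simp: indicator_def)
    qed auto
    also have "\<dots> = F b - F a"
      using bi by (rule has_bochner_integral_integral_eq)
    finally show ?thesis .
  qed
  have eq: "normal_tail y = 1 - cdf std_normal_distribution 0 + F 0 - F y" for y
    using inc[of 0 y] inc[of y 0] unfolding normal_tail_def
    by (cases y "0::real" rule: linorder_cases) auto
  have "((\<lambda>y. 1 - cdf std_normal_distribution 0 + F 0 - F y) has_real_derivative
      - std_normal_density x) (at x)"
    by (auto intro!: derivative_eq_intros F)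
  then show ?thesis
    unfolding eq[abs_def] .
qed

lemmas normal_deriv_intros = DERIV_chain2[OF normal_tail_deriv] DERIV_chain2[OF std_normal_density_deriv]

lemma normal_tail_at_top: "(normal_tail \<longlongrightarrow> 0) at_top"
proof -
  interpret D: real_distribution std_normal_distribution
    by (rule real_dist_normal_dist)
  show ?thesis
    unfolding normal_tail_def[abs_def] using D.cdf_lim_at_top_prob by (auto intro!: tendsto_eq_intros)
qed

text \<open>The sum of the two tails has derivative zero because the density is even; its constant
  value is found in the limit at infinity.\<close>

lemma normal_tail_minus: "normal_tail (- x) = 1 - normal_tail x"
proof -
  interpret D: real_distribution std_normal_distribution
    by (rule real_dist_normal_dist)
  define K where "K x = normal_tail x + normal_tail (- x)" for x
  have "(K has_real_derivative 0) (at x)" for x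
    unfolding K_def[abs_def]
    by (auto intro!: derivative_eq_intros normal_deriv_intros simp: std_normal_density_def)
  then have const: "K x = K y" for x y
    by (intro DERIV_isconst_all) auto
  have "(normal_tail \<longlongrightarrow> 1) at_bot"
    unfolding normal_tail_def[abs_def] using D.cdf_lim_at_bot by (auto intro!: tendsto_eq_intros)
  then have "((\<lambda>x. normal_tail (- x)) \<longlongrightarrow> 1) at_top"
    by (rule filterlim_compose) (rule filterlim_uminus_at_bot_at_top)
  then have "(K \<longlongrightarrow> 0 + 1) at_top"
    unfolding K_def[abs_def] by (intro tendsto_add normal_tail_at_top)
  then have "((\<lambda>_::real. K x) \<longlongrightarrow> 0 + 1) at_top"
    by (rule Lim_transform_eventually) (auto intro: always_eventually const)
  then show ?thesis
    by (simp add: K_def tendsto_const_iff)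
qed

text \<open>Think of \<open>- F a\<close> as the integral of \<open>f\<close> over the half-line
  from \<open>a\<close>. The sign of a tail moment then follows from an explicit antiderivative
  vanishing at infinity, without integration.\<close>

lemma nonpos_of_increasing_to_0:
  fixes F :: "real \<Rightarrow> real"
  assumes "\<And>x. a \<le> x \<Longrightarrow> (F has_real_derivative f x) (at x)" "\<And>x. a \<le> x \<Longrightarrow> 0 \<le> f x"
    and "(F \<longlongrightarrow> 0) at_top"
  shows "F a \<le> 0"
proof (rule tendsto_lowerbound[OF assms(3)])
  show "\<forall>\<^sub>F x in at_top. F a \<le> F x"
    using eventually_ge_at_top[of a]
  proof eventually_elim
    case (elim x)
    show ?case
      by (rule DERIV_nonneg_imp_nondecreasing[OF elim]) (use assms in blast)
  qed
qed simp

section \<open>Mills ratio and its derivatives\<close>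

definition mills :: "real \<Rightarrow> real" where
  "mills x = normal_tail x / std_normal_density x"

lemma normal_density_times_mills: "std_normal_density x * mills x = normal_tail x"
  unfolding mills_def using normal_density_pos[of 1 0 x] by simp

text \<open>The numbered functions are the successive derivatives of \<open>mills\<close>, reduced
  by the differential equation y' = x y - 1 to the form P y + Q with polynomials P and Q.\<close>

definition mills1 :: "real \<Rightarrow> real" where
  "mills1 x = x * mills x - 1"

definition mills2 :: "real \<Rightarrow> real" where
  "mills2 x = (1 + x\<^sup>2) * mills x - x"

definition mills3 :: "real \<Rightarrow> real" where
  "mills3 x = (x ^ 3 + 3 * x) * mills x - (x\<^sup>2 + 2)"

definition mills4 :: "real \<Rightarrow> real" where
  "mills4 x = (x ^ 4 + 6 * x\<^sup>2 + 3) * mills x - (x ^ 3 + 5 * x)"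

lemma mills_deriv: "(mills has_real_derivative mills1 x) (at x)"
  unfolding mills_def[abs_def] mills1_def
  using normal_density_pos[of 1 0 x]
  by (auto intro!: derivative_eq_intros normal_deriv_intros std_normal_density_deriv normal_tail_deriv
        simp: field_simps power2_eq_square)

lemma mills1_deriv: "(mills1 has_real_derivative mills2 x) (at x)"
  unfolding mills1_def[abs_def] mills2_def
  by (auto intro!: derivative_eq_intros mills_deriv simp: mills1_def power2_eq_square algebra_simps)

lemma mills2_deriv: "(mills2 has_real_derivative mills3 x) (at x)"
  unfolding mills2_def[abs_def] mills3_def
  by (auto intro!: derivative_eq_intros mills_deriv
        simp: mills1_def power2_eq_square power3_eq_cube algebra_simps)

lemma mills3_deriv: "(mills3 has_real_derivative mills4 x) (at x)"
  unfolding mills3_def[abs_def] mills4_def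
  by (auto intro!: derivative_eq_intros mills_deriv
        simp: mills1_def power2_eq_square power3_eq_cube power4_eq_xxxx algebra_simps)

text \<open>Up to sign, the derivatives of the Mills ratio are the Gaussian moments
  \<open>E (G - u)\<^sub>+\<^sup>k\<close> divided by the density at \<open>u\<close>; this gives their signs.\<close>

lemma mills1_nonpos: "mills1 u \<le> 0"
proof -
  let ?F = "\<lambda>t. - std_normal_density t + u * normal_tail t"
  have "?F u \<le> 0"
  proof (rule nonpos_of_increasing_to_0[where F = ?F and a = u and f = "\<lambda>t. (t - u) * std_normal_density t"])
    have "((\<lambda>t. - std_normal_density t) \<longlongrightarrow> 0) at_top"
      unfolding std_normal_density_def[abs_def] by real_asymp
    from tendsto_add[OF this tendsto_mult_right[OF normal_tail_at_top, of u]]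
    show "(?F \<longlongrightarrow> 0) at_top" by (simp add: mult.commute)
  qed (auto intro!: derivative_eq_intros normal_deriv_intros mult_right_mono simp: algebra_simps)
  also have "?F u = std_normal_density u * mills1 u"
    unfolding mills1_def normal_density_times_mills[symmetric] by (simp add: algebra_simps)
  finally show ?thesis
    using normal_density_pos[of 1 0 u] by (simp add: mult_le_0_iff)
qed

lemma normal_hinge_antideriv:
  fixes u :: real
  defines "F \<equiv> \<lambda>t. - ((1 + u\<^sup>2) * normal_tail t + (t - 2 * u) * std_normal_density t)"
  shows "(F has_real_derivative (t - u)\<^sup>2 * std_normal_density t) (at t)"
    and "(F \<longlongrightarrow> 0) at_top"
proof -
  show "(F has_real_derivative (t - u)\<^sup>2 * std_normal_density t) (at t)"
    unfolding F_def
    by (auto intro!: derivative_eq_intros normal_deriv_intros simp: algebra_simps power2_eq_square)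
  have "((\<lambda>t. (t - 2 * u) * std_normal_density t) \<longlongrightarrow> 0) at_top"
    unfolding std_normal_density_def[abs_def] by real_asymp
  from tendsto_minus[OF tendsto_add[OF tendsto_mult_left[OF normal_tail_at_top, of "1 + u\<^sup>2"] this]]
  show "(F \<longlongrightarrow> 0) at_top"
    unfolding F_def by simp
qed

text \<open>Closed form of E (G - u)_+^2 for a standard normal G;
  \<open>normal_hinge_integral\<close> identifies it with the integral.\<close>

definition normal_hinge :: "real \<Rightarrow> real" where
  "normal_hinge u = (1 + u\<^sup>2) * normal_tail u - u * std_normal_density u"

lemma normal_hinge_eq: "normal_hinge u = std_normal_density u * mills2 u"
  unfolding normal_hinge_def mills2_def normal_density_times_mills[symmetric]
  by (simp add: algebra_simps)

lemma normal_hinge_nonneg: "0 \<le> normal_hinge u"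
proof -
  have "- ((1 + u\<^sup>2) * normal_tail u + (u - 2 * u) * std_normal_density u) \<le> 0"
    by (rule nonpos_of_increasing_to_0[OF normal_hinge_antideriv(1) _ normal_hinge_antideriv(2)])
      (auto intro!: normal_density_nonneg)
  then show ?thesis
    unfolding normal_hinge_def by (simp add: algebra_simps)
qed

lemma mills2_nonneg: "0 \<le> mills2 u"
  using normal_hinge_nonneg[of u] normal_density_pos[of 1 0 u]
  by (simp add: normal_hinge_eq zero_le_mult_iff)

text \<open>The positive and negative parts of G - u share out E (G - u)^2 = 1 + u^2, and G is
  symmetric.\<close>

lemma normal_hinge_minus: "normal_hinge (- u) = 1 + u\<^sup>2 - normal_hinge u"
  unfolding normal_hinge_def normal_tail_minus by (simp add: std_normal_density_def algebra_simps)

lemma mills3_nonpos: "mills3 u \<le> 0"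
proof -
  \<comment> \<open>Antiderivative of the expanded cube, term by term: against the density, t^3
    integrates to - (t^2 + 2) times the density, t^2 to - t times the density minus the tail, t to
    minus the density, and 1 to minus the tail.\<close>
  let ?F = "\<lambda>t. (- (t\<^sup>2 + 2) + 3 * u * t - 3 * u\<^sup>2) * std_normal_density t
    + (3 * u + u ^ 3) * normal_tail t"
  have "?F u \<le> 0"
  proof (rule nonpos_of_increasing_to_0[where F = ?F and a = u and f = "\<lambda>t. (t - u) ^ 3 * std_normal_density t"])
    have "((\<lambda>t. (- (t\<^sup>2 + 2) + 3 * u * t - 3 * u\<^sup>2) * std_normal_density t) \<longlongrightarrow> 0) at_top"
      unfolding std_normal_density_def[abs_def] by real_asymp
    from tendsto_add[OF this tendsto_mult_left[OF normal_tail_at_top, of "3 * u + u ^ 3"]]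
    show "(?F \<longlongrightarrow> 0) at_top" by simp
    fix t
    show "(?F has_real_derivative (t - u) ^ 3 * std_normal_density t) (at t)"
      by (auto intro!: derivative_eq_intros normal_deriv_intros
          simp: algebra_simps power2_eq_square power3_eq_cube)
  qed (auto intro!: normal_density_nonneg)
  also have "?F u = std_normal_density u * mills3 u"
    unfolding mills3_def normal_density_times_mills[symmetric]
    by (simp add: algebra_simps power2_eq_square)
  finally show ?thesis
    using normal_density_pos[of 1 0 u] by (simp add: mult_le_0_iff)
qed

lemma mills4_nonneg: "0 \<le> mills4 u"
proof -
  let ?F = "\<lambda>t. (- (t ^ 3 + 3 * t) + 4 * u * (t\<^sup>2 + 2) - 6 * u\<^sup>2 * t + 4 * u ^ 3) * std_normal_density t
    - (u ^ 4 + 6 * u\<^sup>2 + 3) * normal_tail t"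
  have "?F u \<le> 0"
  proof (rule nonpos_of_increasing_to_0[where F = ?F and a = u and f = "\<lambda>t. (t - u) ^ 4 * std_normal_density t"])
    have "((\<lambda>t. (- (t ^ 3 + 3 * t) + 4 * u * (t\<^sup>2 + 2) - 6 * u\<^sup>2 * t + 4 * u ^ 3)
        * std_normal_density t) \<longlongrightarrow> 0) at_top"
      unfolding std_normal_density_def[abs_def] by real_asymp
    from tendsto_diff[OF this tendsto_mult_left[OF normal_tail_at_top, of "u ^ 4 + 6 * u\<^sup>2 + 3"]]
    show "(?F \<longlongrightarrow> 0) at_top" by simp
    fix t
    show "(?F has_real_derivative (t - u) ^ 4 * std_normal_density t) (at t)"
      by (auto intro!: derivative_eq_intros normal_deriv_intros
          simp: algebra_simps power2_eq_square power3_eq_cube power4_eq_xxxx)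
  qed (auto intro!: normal_density_nonneg)
  also have "?F u = - (std_normal_density u * mills4 u)"
    unfolding mills4_def normal_density_times_mills[symmetric]
    by (simp add: algebra_simps power2_eq_square power3_eq_cube power4_eq_xxxx)
  finally show ?thesis
    using normal_density_pos[of 1 0 u] by (simp add: zero_le_mult_iff)
qed

lemma mills1_mono: "x \<le> y \<Longrightarrow> mills1 x \<le> mills1 y"
  by (rule DERIV_nonneg_imp_nondecreasing) (use mills1_deriv mills2_nonneg in blast)+

lemma mills2_antimono: "x \<le> y \<Longrightarrow> mills2 y \<le> mills2 x"
  by (rule DERIV_nonpos_imp_nonincreasing) (use mills2_deriv mills3_nonpos in blast)+

lemma mills3_mono: "x \<le> y \<Longrightarrow> mills3 x \<le> mills3 y"
  by (rule DERIV_nonneg_imp_nondecreasing) (use mills3_deriv mills4_nonneg in blast)+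

text \<open>For functions given by different formulas on the two sides of \<open>u\<close>. Away
  from \<open>u\<close> the derivative is local; at \<open>u\<close> equal values and equal slopes
  make the one-sided limits agree.\<close>

lemma has_derivative_glue:
  fixes f g :: "real \<Rightarrow> real"
  assumes f: "\<And>x. (f has_real_derivative f' x) (at x)" and g: "\<And>x. (g has_real_derivative g' x) (at x)"
    and "f u = g u" "f' u = g' u"
  shows "((\<lambda>x. if x \<le> u then f x else g x) has_real_derivative (if x \<le> u then f' x else g' x)) (at x)"
proof (cases x u rule: linorder_cases)
  case less
  have "((\<lambda>x. if x \<le> u then f x else g x) has_real_derivative f' x) (at x)"
    by (rule DERIV_cong_ev[THEN iffD2, OF refl _ refl f])
      (use less in \<open>auto intro!: eventually_mono[OF eventually_nhds_in_open[of "{..<u}"]]\<close>)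
  with less show ?thesis by simp
next
  case greater
  have "((\<lambda>x. if x \<le> u then f x else g x) has_real_derivative g' x) (at x)"
    by (rule DERIV_cong_ev[THEN iffD2, OF refl _ refl g])
      (use greater in \<open>auto intro!: eventually_mono[OF eventually_nhds_in_open[of "{u<..}"]]\<close>)
  with greater show ?thesis by simp
next
  case equal
  have "((\<lambda>x. if x \<le> u then f x else g x) has_real_derivative f' u) (at u within {..u})"
    by (rule has_field_derivative_transform_within[OF DERIV_subset[OF f], where d = 1]) auto
  moreover have "((\<lambda>x. if x \<le> u then f x else g x) has_real_derivative g' u) (at u within {u..})"
    by (rule has_field_derivative_transform_within[OF DERIV_subset[OF g], where d = 1]) (auto simp: assms)
  ultimately have "((\<lambda>x. if x \<le> u then f x else g x) has_real_derivative f' u) (at u within ({..u} \<union> {u..}))"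
    unfolding assms(4) has_field_derivative_iff by (rule Lim_Un)
  moreover have "{..u} \<union> {u..} = (UNIV :: real set)" by auto
  ultimately show ?thesis using equal by simp
qed

text \<open>The solution of Stein's equation for the test function \<open>(x - u)\<^sub>+\<^sup>2\<close> is explicit. Its third
  derivative has a single jump, of height 2, between the numbers \<open>normal_hinge u * mills3 (- u) \<le> 0\<close>
  and \<open>- normal_hinge (- u) * mills3 u \<ge> 0\<close>; together with monotonicity on both sides of \<open>u\<close> this
  bounds it by 2.\<close>

lemma stein_solution_hinge:
  fixes u :: real
  obtains f f1 f2 :: "real \<Rightarrow> real" and B where
    "\<And>x. (f has_real_derivative f1 x) (at x)" "\<And>x. (f1 has_real_derivative f2 x) (at x)"
    "\<And>x y. \<bar>f2 x - f2 y\<bar> \<le> 2 * \<bar>x - y\<bar>"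
    "\<And>x. \<bar>f1 x\<bar> \<le> B" "\<And>x. \<bar>f2 x\<bar> \<le> B"
    "\<And>x. f1 x - x * f x = (max (x - u) 0)\<^sup>2 - normal_hinge u"
proof -
  let ?H = "normal_hinge"
  \<comment> \<open>On each half-line the solutions differ by multiples of exp (x^2 / 2), and only
    one of them avoids that growth. On the left it is a multiple of \<open>mills (- x)\<close>; on
    the right a linear function solves the equation up to a constant, which a multiple of
    \<open>mills x\<close> corrects.\<close>
  define fl where "fl x = - ?H u * mills (- x)" for x
  define fr where "fr x = - x + 2 * u - ?H (- u) * mills x" for x
  define fl1 where "fl1 x = ?H u * mills1 (- x)" for x
  define fr1 where "fr1 x = - 1 - ?H (- u) * mills1 x" for x
  define fl2 where "fl2 x = - ?H u * mills2 (- x)" for x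
  define fr2 where "fr2 x = - ?H (- u) * mills2 x" for x
  define fl3 where "fl3 x = ?H u * mills3 (- x)" for x
  define fr3 where "fr3 x = - ?H (- u) * mills3 x" for x
  have dl: "(fl has_real_derivative fl1 x) (at x)" "(fl1 has_real_derivative fl2 x) (at x)"
    "(fl2 has_real_derivative fl3 x) (at x)" for x
    unfolding fl_def[abs_def] fl1_def[abs_def] fl2_def[abs_def] fl3_def
    by (auto intro!: derivative_eq_intros DERIV_chain2[OF mills_deriv] DERIV_chain2[OF mills1_deriv]
      DERIV_chain2[OF mills2_deriv])
  have dr: "(fr has_real_derivative fr1 x) (at x)" "(fr1 has_real_derivative fr2 x) (at x)"
    "(fr2 has_real_derivative fr3 x) (at x)" for x
    unfolding fr_def[abs_def] fr1_def[abs_def] fr2_def[abs_def] fr3_def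
    by (auto intro!: derivative_eq_intros mills_deriv mills1_deriv mills2_deriv)
  define \<rho> where "\<rho> = std_normal_density u"
  define c where "c = normal_tail u"
  have \<rho>: "\<rho> > 0" unfolding \<rho>_def by (simp add: normal_density_pos)
  have m: "mills u = c / \<rho>" "mills (- u) = (1 - c) / \<rho>"
    unfolding mills_def c_def \<rho>_def normal_tail_minus by (auto simp: std_normal_density_def)
  have H: "?H u = (1 + u\<^sup>2) * c - u * \<rho>" "?H (- u) = (1 + u\<^sup>2) * (1 - c) + u * \<rho>"
    unfolding normal_hinge_def normal_tail_minus c_def \<rho>_def by (auto simp: std_normal_density_def)
  have e0: "fl u = fr u"
    unfolding fl_def fr_def m H using \<rho> by (simp add: field_simps)
  have e1: "fl1 u = fr1 u"
    unfolding fl1_def fr1_def m H mills1_def using \<rho> by (simp add: field_simps power2_eq_square)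
  have e2: "fl2 u = fr2 u"
    unfolding fl2_def fr2_def m H mills2_def using \<rho> by (simp add: field_simps)
  \<comment> \<open>Differentiating the equation twice shows that the third derivative jumps by as
    much as the second derivative of the test function, namely by 2.\<close>
  have e3: "fr3 u = fl3 u + 2"
    unfolding fl3_def fr3_def m H mills3_def using \<rho> by (simp add: field_simps) algebra
  note Hn = normal_hinge_nonneg[of u] normal_hinge_nonneg[of "- u"]
  have b3l: "\<bar>fl3 x\<bar> \<le> 2" if "x \<le> u" for x
  proof -
    have "fl3 u \<le> fl3 x" "fl3 x \<le> 0"
      unfolding fl3_def using that Hn by (auto intro!: mult_left_mono mills3_mono mult_nonneg_nonpos mills3_nonpos)
    moreover have "fr3 u \<ge> 0"
      unfolding fr3_def using Hn by (auto intro!: mult_nonneg_nonpos mills3_nonpos)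
    ultimately show ?thesis using e3 by linarith
  qed
  have b3r: "\<bar>fr3 x\<bar> \<le> 2" if "u \<le> x" for x
  proof -
    have "fr3 x \<le> fr3 u" "0 \<le> fr3 x"
      unfolding fr3_def using that Hn by (auto intro!: mult_left_mono mills3_mono mult_nonneg_nonpos mills3_nonpos)
    moreover have "fl3 u \<le> 0"
      unfolding fl3_def using Hn by (auto intro!: mult_nonneg_nonpos mills3_nonpos)
    ultimately show ?thesis using e3 by linarith
  qed
  define f where "f x = (if x \<le> u then fl x else fr x)" for x
  define f1 where "f1 x = (if x \<le> u then fl1 x else fr1 x)" for x
  define f2 where "f2 x = (if x \<le> u then fl2 x else fr2 x)" for x
  have lipl: "\<bar>fl2 x - fl2 y\<bar> \<le> 2 * \<bar>x - y\<bar>" if "x \<le> u" "y \<le> u" for x y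
    using field_differentiable_bound[of "{..u}" fl2 fl3 2 x y] that b3l
    by (auto intro: DERIV_subset[OF dl(3)])
  have lipr: "\<bar>fr2 x - fr2 y\<bar> \<le> 2 * \<bar>x - y\<bar>" if "u \<le> x" "u \<le> y" for x y
    using field_differentiable_bound[of "{u..}" fr2 fr3 2 x y] that b3r
    by (auto intro: DERIV_subset[OF dr(3)])
  have lip: "\<bar>f2 x - f2 y\<bar> \<le> 2 * \<bar>x - y\<bar>" if "x \<le> y" for x y
    using lipl[of x y] lipr[of x y] lipl[of x u] lipr[of u y] that e2 unfolding f2_def
    by (auto split: if_splits)
  \<comment> \<open>On each side of \<open>u\<close> the functions are monotone, so their extremes
    occur at \<open>u\<close> or at infinity; the summand 1 covers the lower bound -1 of
    \<open>fr1\<close>.\<close>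
  define B where "B = max (\<bar>fl1 u\<bar> + 1) \<bar>fl2 u\<bar>"
  have fl1b: "- \<bar>fl1 u\<bar> \<le> fl1 x \<and> fl1 x \<le> 0" if "x \<le> u" for x
  proof -
    have "fl1 u \<le> fl1 x" "fl1 x \<le> 0"
      unfolding fl1_def using that Hn by (auto intro!: mult_left_mono mills1_mono mult_nonneg_nonpos mills1_nonpos)
    then show ?thesis by linarith
  qed
  have fr1b: "- 1 \<le> fr1 x \<and> fr1 x \<le> \<bar>fl1 u\<bar>" if "u \<le> x" for x
  proof -
    have "fr1 x \<le> fr1 u" "- 1 \<le> fr1 x"
      unfolding fr1_def using that Hn by (auto intro!: mult_left_mono mills1_mono mult_nonneg_nonpos mills1_nonpos)
    then show ?thesis using e1 by linarith
  qed
  have fl2b: "\<bar>fl2 x\<bar> \<le> \<bar>fl2 u\<bar>" if "x \<le> u" for x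
  proof -
    have "fl2 u \<le> fl2 x" "fl2 x \<le> 0"
      unfolding fl2_def using that Hn by (auto intro!: mult_left_mono mills2_antimono mult_nonneg_nonneg mills2_nonneg)
    then show ?thesis by linarith
  qed
  have fr2b: "\<bar>fr2 x\<bar> \<le> \<bar>fl2 u\<bar>" if "u \<le> x" for x
  proof -
    have "fr2 u \<le> fr2 x" "fr2 x \<le> 0"
      unfolding fr2_def using that Hn by (auto intro!: mult_left_mono mills2_antimono mult_nonneg_nonneg mills2_nonneg)
    then show ?thesis using e2 by linarith
  qed
  show thesis
  proof (rule that)
    show "(f has_real_derivative f1 x) (at x)" for x
      unfolding f_def[abs_def] f1_def by (rule has_derivative_glue[OF dl(1) dr(1) e0 e1])
    show "(f1 has_real_derivative f2 x) (at x)" for x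
      unfolding f1_def[abs_def] f2_def by (rule has_derivative_glue[OF dl(2) dr(2) e1 e2])
    show "\<bar>f2 x - f2 y\<bar> \<le> 2 * \<bar>x - y\<bar>" for x y
      using lip[of x y] lip[of y x] by (cases "x \<le> y") (auto simp: abs_minus_commute)
    show "\<bar>f1 x\<bar> \<le> B" for x
      using fl1b[of x] fr1b[of x] unfolding f1_def B_def by (auto simp: abs_le_iff)
    show "\<bar>f2 x\<bar> \<le> B" for x
      using fl2b[of x] fr2b[of x] unfolding f2_def B_def by auto
    show "f1 x - x * f x = (max (x - u) 0)\<^sup>2 - normal_hinge u" for x
      unfolding f_def f1_def fl_def fl1_def fr_def fr1_def mills1_def normal_hinge_minus
      by (auto simp: max_def algebra_simps power2_eq_square)
  qed
qed

lemma normal_hinge_integral: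
  "has_bochner_integral lborel (\<lambda>x. std_normal_density x * (max (x - u) 0)\<^sup>2) (normal_hinge u)"
proof (rule has_bochner_integral_nn_integral)
  have "(\<integral>\<^sup>+ x. ennreal ((x - u)\<^sup>2 * std_normal_density x) * indicator {u..} x \<partial>lborel)
      = 0 - - ((1 + u\<^sup>2) * normal_tail u + (u - 2 * u) * std_normal_density u)"
    by (rule nn_integral_FTC_atLeast[OF _ normal_hinge_antideriv(1) _ normal_hinge_antideriv(2)])
      (auto intro!: normal_density_nonneg)
  also have "(\<integral>\<^sup>+ x. ennreal ((x - u)\<^sup>2 * std_normal_density x) * indicator {u..} x \<partial>lborel)
      = (\<integral>\<^sup>+ x. ennreal (std_normal_density x * (max (x - u) 0)\<^sup>2) \<partial>lborel)"
    by (rule nn_integral_cong) (auto simp: indicator_def max_def mult.commute)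
  finally show "(\<integral>\<^sup>+ x. ennreal (std_normal_density x * (max (x - u) 0)\<^sup>2) \<partial>lborel)
      = ennreal (normal_hinge u)"
    by (simp add: normal_hinge_def algebra_simps)
qed (auto intro!: normal_hinge_nonneg mult_nonneg_nonneg normal_density_nonneg)

section \<open>Normal approximation of weighted sums\<close>

lemma (in prob_space) integrable_power_le_4:
  fixes X :: "'a \<Rightarrow> real"
  assumes [measurable]: "random_variable borel X" and "integrable M (\<lambda>\<omega>. X \<omega> ^ 4)" and "k \<le> 4"
  shows "integrable M (\<lambda>\<omega>. X \<omega> ^ k)"
proof (rule Bochner_Integration.integrable_bound)
  show "integrable M (\<lambda>\<omega>. 1 + X \<omega> ^ 4)" using assms by auto
  have "\<bar>x ^ k\<bar> \<le> 1 + x ^ 4" for x :: real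
  proof -
    have "\<bar>x\<bar> ^ k \<le> 1 + \<bar>x\<bar> ^ 4"
    proof (cases "\<bar>x\<bar> \<le> 1")
      case True
      then have "\<bar>x\<bar> ^ k \<le> 1" by (intro power_le_one) auto
      moreover have "0 \<le> \<bar>x\<bar> ^ 4" by (rule zero_le_power) simp
      ultimately show ?thesis by linarith
    next
      case False
      then have "\<bar>x\<bar> ^ k \<le> \<bar>x\<bar> ^ 4" using \<open>k \<le> 4\<close> by (intro power_increasing) auto
      then show ?thesis by linarith
    qed
    moreover have "\<bar>x\<bar> ^ 4 = x ^ 4" by simp
    ultimately show ?thesis unfolding power_abs by linarith
  qed
  then show "AE \<omega> in M. norm (X \<omega> ^ k) \<le> norm (1 + X \<omega> ^ 4)"
    unfolding real_norm_def by (auto intro: order_trans[OF _ abs_ge_self])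
qed simp

lemma integrable_mult_of_square_integrable:
  fixes X Y :: "'a \<Rightarrow> real"
  assumes [measurable]: "X \<in> borel_measurable M" "Y \<in> borel_measurable M"
    and "integrable M (\<lambda>\<omega>. (X \<omega>)\<^sup>2)" "integrable M (\<lambda>\<omega>. (Y \<omega>)\<^sup>2)"
  shows "integrable M (\<lambda>\<omega>. X \<omega> * Y \<omega>)"
proof (rule Bochner_Integration.integrable_bound)
  show "integrable M (\<lambda>\<omega>. (X \<omega>)\<^sup>2 + (Y \<omega>)\<^sup>2)" using assms by auto
  have "\<bar>x * y\<bar> \<le> x\<^sup>2 + y\<^sup>2" for x y :: real
  proof -
    have "0 \<le> \<bar>x\<bar> * \<bar>y\<bar>" by simp
    then show ?thesis
      using sum_squares_bound[of "\<bar>x\<bar>" "\<bar>y\<bar>", unfolded power2_abs] unfolding abs_mult by linarith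
  qed
  then show "AE \<omega> in M. norm (X \<omega> * Y \<omega>) \<le> norm ((X \<omega>)\<^sup>2 + (Y \<omega>)\<^sup>2)" by simp
qed simp

lemma square_integrable_add:
  fixes X Y :: "'a \<Rightarrow> real"
  assumes [measurable]: "X \<in> borel_measurable M" "Y \<in> borel_measurable M"
    and "integrable M (\<lambda>\<omega>. (X \<omega>)\<^sup>2)" "integrable M (\<lambda>\<omega>. (Y \<omega>)\<^sup>2)"
  shows "integrable M (\<lambda>\<omega>. (X \<omega> + Y \<omega>)\<^sup>2)"
  unfolding power2_sum
  using assms integrable_mult_of_square_integrable[OF assms] by (auto simp: mult.assoc)

lemma square_integrable_sum:
  fixes X :: "'i \<Rightarrow> 'a \<Rightarrow> real"
  assumes "finite I" "\<And>i. i \<in> I \<Longrightarrow> X i \<in> borel_measurable M"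
    "\<And>i. i \<in> I \<Longrightarrow> integrable M (\<lambda>\<omega>. (X i \<omega>)\<^sup>2)"
  shows "integrable M (\<lambda>\<omega>. (\<Sum>i\<in>I. a i * X i \<omega>)\<^sup>2)"
  using assms
proof (induction I rule: finite_induct)
  case (insert i I)
  have "integrable M (\<lambda>\<omega>. (a i * X i \<omega> + (\<Sum>i\<in>I. a i * X i \<omega>))\<^sup>2)"
    using insert by (intro square_integrable_add) (auto simp: power_mult_distrib)
  with insert.hyps show ?case by simp
qed simp

section \<open>Taylor remainders and Stein's identity\<close>

lemma taylor1_lipschitz_deriv:
  fixes f1 :: "real \<Rightarrow> real"
  assumes f1: "\<And>x. (f1 has_real_derivative f2 x) (at x)"
    and lip: "\<And>x y. \<bar>f2 x - f2 y\<bar> \<le> C * \<bar>x - y\<bar>"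
  shows "\<bar>f1 (y + t) - f1 y - t * f2 y\<bar> \<le> C * t\<^sup>2"
proof -
  have C: "0 \<le> C" using lip[of 1 0] by auto
  have "\<exists>z. \<bar>z\<bar> \<le> \<bar>t\<bar> \<and> f1 (y + t) - f1 y = t * f2 (y + z)"
  proof (cases t "0::real" rule: linorder_cases)
    case less
    then obtain z where "y + t < z" "z < y" "f1 y - f1 (y + t) = (y - (y + t)) * f2 z"
      using MVT2[of "y + t" y f1 f2] f1 by auto
    then show ?thesis by (intro exI[of _ "z - y"]) (auto simp: algebra_simps)
  next
    case greater
    then obtain z where "y < z" "z < y + t" "f1 (y + t) - f1 y = (y + t - y) * f2 z"
      using MVT2[of y "y + t" f1 f2] f1 by auto
    then show ?thesis by (intro exI[of _ "z - y"]) (auto simp: algebra_simps)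
  qed auto
  then obtain z where z: "\<bar>z\<bar> \<le> \<bar>t\<bar>" "f1 (y + t) - f1 y = t * f2 (y + z)" by blast
  have "\<bar>f1 (y + t) - f1 y - t * f2 y\<bar> = \<bar>t\<bar> * \<bar>f2 (y + z) - f2 y\<bar>"
    unfolding z(2) by (simp add: abs_mult[symmetric] algebra_simps)
  also have "\<dots> \<le> \<bar>t\<bar> * (C * \<bar>t\<bar>)"
    using lip[of "y + z" y] z(1) C by (intro mult_left_mono) (auto intro: order_trans mult_left_mono)
  also have "\<dots> = C * (\<bar>t\<bar> * \<bar>t\<bar>)" by (simp only: mult_ac)
  finally show ?thesis by (simp add: power2_eq_square)
qed

text \<open>The derivative of the remainder in the increment is the first-order remainder of
  \<open>taylor1_lipschitz_deriv\<close>, which is at most C t^2 on the ball of radius |t|.\<close>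

lemma taylor2_lipschitz_deriv:
  fixes f f1 :: "real \<Rightarrow> real"
  assumes f: "\<And>x. (f has_real_derivative f1 x) (at x)"
    and f1: "\<And>x. (f1 has_real_derivative f2 x) (at x)"
    and lip: "\<And>x y. \<bar>f2 x - f2 y\<bar> \<le> C * \<bar>x - y\<bar>"
  shows "\<bar>f (y + t) - f y - t * f1 y - t\<^sup>2 / 2 * f2 y\<bar> \<le> C * \<bar>t\<bar> ^ 3"
proof -
  have C: "0 \<le> C" using lip[of 1 0] by auto
  define r where "r s = f (y + s) - s * f1 y - s\<^sup>2 / 2 * f2 y" for s
  have dr: "(r has_real_derivative f1 (y + s) - f1 y - s * f2 y) (at s)" for s
    unfolding r_def[abs_def] by (auto intro!: derivative_eq_intros DERIV_chain2[OF f])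
  have "norm (r t - r 0) \<le> (C * t\<^sup>2) * norm (t - 0)"
  proof (rule field_differentiable_bound[where S = "cball 0 \<bar>t\<bar>"])
    show "(r has_real_derivative f1 (y + s) - f1 y - s * f2 y) (at s within cball 0 \<bar>t\<bar>)" for s
      by (rule DERIV_subset[OF dr]) simp
    fix s :: real assume "s \<in> cball 0 \<bar>t\<bar>"
    then have "s\<^sup>2 \<le> t\<^sup>2" by (simp add: abs_le_square_iff)
    then have "C * s\<^sup>2 \<le> C * t\<^sup>2" using C by (rule mult_left_mono)
    then show "norm (f1 (y + s) - f1 y - s * f2 y) \<le> C * t\<^sup>2"
      using taylor1_lipschitz_deriv[OF f1 lip, of y s] by simp
  qed auto
  also have "(C * t\<^sup>2) * norm (t - 0) = C * \<bar>t\<bar> ^ 3"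
    by (simp only: power2_abs[of t, symmetric] power3_eq_cube power2_eq_square diff_0_right real_norm_def mult_ac)
  finally show ?thesis by (simp add: r_def algebra_simps)
qed

text \<open>Replacing one summand at a time in Stein's identity. Since third moments vanish, the expansion
  cancels up to fourth order, without any smoothing of the test function.\<close>

lemma (in prob_space) stein_bound:
  fixes X :: "'i \<Rightarrow> 'a \<Rightarrow> real"
  assumes fin: "finite I" and indep: "indep_vars (\<lambda>_. borel) X I"
    and int4: "\<And>i. i \<in> I \<Longrightarrow> integrable M (\<lambda>\<omega>. X i \<omega> ^ 4)"
    and m1: "\<And>i. i \<in> I \<Longrightarrow> expectation (X i) = 0"
    and m2: "\<And>i. i \<in> I \<Longrightarrow> expectation (\<lambda>\<omega>. (X i \<omega>)\<^sup>2) = 1"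
    and m3: "\<And>i. i \<in> I \<Longrightarrow> expectation (\<lambda>\<omega>. X i \<omega> ^ 3) = 0"
    and m4: "\<And>i. i \<in> I \<Longrightarrow> expectation (\<lambda>\<omega>. X i \<omega> ^ 4) \<le> \<mu>"
    and norm: "(\<Sum>i\<in>I. (a i)\<^sup>2) = 1"
    and f: "\<And>x. (f has_real_derivative f1 x) (at x)"
    and f1: "\<And>x. (f1 has_real_derivative f2 x) (at x)"
    and lip: "\<And>x y. \<bar>f2 x - f2 y\<bar> \<le> C * \<bar>x - y\<bar>"
    and bnd: "\<And>x. \<bar>f1 x\<bar> \<le> B" "\<And>x. \<bar>f2 x\<bar> \<le> B"
  defines "S \<equiv> \<lambda>\<omega>. \<Sum>i\<in>I. a i * X i \<omega>"
  shows "integrable M (\<lambda>\<omega>. f1 (S \<omega>) - S \<omega> * f (S \<omega>))"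
    and "\<bar>expectation (\<lambda>\<omega>. f1 (S \<omega>) - S \<omega> * f (S \<omega>))\<bar> \<le> C * (1 + \<mu>) * (\<Sum>i\<in>I. a i ^ 4)"
proof -
  have C: "0 \<le> C" using lip[of 1 0] by auto
  have [measurable]: "X i \<in> borel_measurable M" if "i \<in> I" for i
    using indep that by (auto simp: indep_vars_def)
  have [measurable]: "f \<in> borel_measurable borel" "f1 \<in> borel_measurable borel"
    by (auto intro!: borel_measurable_continuous_onI continuous_at_imp_continuous_on DERIV_isCont f f1)
  have "continuous_on UNIV f2"
  proof (rule continuous_at_imp_continuous_on, rule ballI)
    fix x
    show "isCont f2 x"
      unfolding continuous_at_eps_delta
    proof (intro allI impI)
      fix e :: real assume "e > 0"
      show "\<exists>d>0. \<forall>x'. dist x' x < d \<longrightarrow> dist (f2 x') (f2 x) < e"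
      proof (intro exI[of _ "e / (C + 1)"] conjI allI impI)
        fix x' assume *: "dist x' x < e / (C + 1)"
        have "\<bar>f2 x' - f2 x\<bar> \<le> C * \<bar>x' - x\<bar>" by (rule lip)
        also have "\<dots> \<le> (C + 1) * \<bar>x' - x\<bar>" by (intro mult_right_mono) auto
        also have "\<dots> < e" using * C by (simp add: dist_real_def field_simps)
        finally show "dist (f2 x') (f2 x) < e" by (simp add: dist_real_def)
      qed (use \<open>e > 0\<close> C in auto)
    qed
  qed
  then have [measurable]: "f2 \<in> borel_measurable borel"
    by (rule borel_measurable_continuous_onI)
  have S_meas [measurable]: "S \<in> borel_measurable M"
    unfolding S_def by measurable
  have fb: "\<bar>f x\<bar> \<le> \<bar>f 0\<bar> + B * \<bar>x\<bar>" for x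
    using field_differentiable_bound[of UNIV f f1 B x 0] f bnd by auto
  have f_sq: "integrable M (\<lambda>\<omega>. (f (Z \<omega>))\<^sup>2)"
    if [measurable]: "Z \<in> borel_measurable M" and "integrable M (\<lambda>\<omega>. (Z \<omega>)\<^sup>2)" for Z
  proof (rule Bochner_Integration.integrable_bound)
    show "integrable M (\<lambda>\<omega>. 2 * \<bar>f 0\<bar>\<^sup>2 + 2 * (B\<^sup>2 * (Z \<omega>)\<^sup>2))" using that by auto
    have "(f x)\<^sup>2 \<le> 2 * \<bar>f 0\<bar>\<^sup>2 + 2 * (B\<^sup>2 * x\<^sup>2)" for x
    proof -
      have "\<bar>f x\<bar>\<^sup>2 \<le> (\<bar>f 0\<bar> + B * \<bar>x\<bar>)\<^sup>2" using fb by (intro power_mono) auto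
      also have "\<dots> \<le> 2 * \<bar>f 0\<bar>\<^sup>2 + 2 * (B * \<bar>x\<bar>)\<^sup>2"
        using sum_squares_bound[of "\<bar>f 0\<bar>" "B * \<bar>x\<bar>"] by (simp add: power2_sum)
      finally show ?thesis by (simp add: power_mult_distrib)
    qed
    then show "AE \<omega> in M. norm ((f (Z \<omega>))\<^sup>2) \<le> norm (2 * \<bar>f 0\<bar>\<^sup>2 + 2 * (B\<^sup>2 * (Z \<omega>)\<^sup>2))" by simp
  qed simp
  have X_pow: "integrable M (\<lambda>\<omega>. X i \<omega> ^ k)" if "i \<in> I" "k \<le> 4" for i k
    using integrable_power_le_4[OF _ int4] that by simp
  have X_int: "integrable M (X i)" if "i \<in> I" for i
    using X_pow[OF that, of 1] by simp
  have S_sq: "integrable M (\<lambda>\<omega>. (S \<omega>)\<^sup>2)"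
    unfolding S_def by (rule square_integrable_sum) (simp_all add: fin X_pow)
  have f1_int: "integrable M (\<lambda>\<omega>. f1 (Z \<omega>))" "integrable M (\<lambda>\<omega>. f2 (Z \<omega>))"
    if [measurable]: "Z \<in> borel_measurable M" for Z
    by (rule integrable_const_bound[where B = B]; simp add: bnd)+
  have step: "integrable M (\<lambda>\<omega>. (a i)\<^sup>2 * f1 (S \<omega>) - a i * (X i \<omega> * f (S \<omega>))) \<and>
    \<bar>expectation (\<lambda>\<omega>. (a i)\<^sup>2 * f1 (S \<omega>) - a i * (X i \<omega> * f (S \<omega>)))\<bar> \<le> C * (1 + \<mu>) * a i ^ 4"
    if i: "i \<in> I" for i
  proof -
    define Y where "Y \<omega> = (\<Sum>k\<in>I - {i}. a k * X k \<omega>)" for \<omega>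
    have [measurable]: "Y \<in> borel_measurable M"
      unfolding Y_def by (intro borel_measurable_sum borel_measurable_times) auto
    note [measurable] = \<open>\<And>i. i \<in> I \<Longrightarrow> X i \<in> borel_measurable M\<close>[OF i]
    have [measurable]: "X i \<in> borel_measurable M"
      using i by simp
    have SY: "S \<omega> = Y \<omega> + a i * X i \<omega>" for \<omega>
      unfolding S_def Y_def using fin i by (subst sum.remove[OF fin i]) simp
    have Y_sq: "integrable M (\<lambda>\<omega>. (Y \<omega>)\<^sup>2)"
      unfolding Y_def by (rule square_integrable_sum) (simp_all add: fin X_pow)
    have ind: "indep_var borel (X i) borel Y"
    proof -
      \<comment> \<open>The weights are absorbed into all variables except \<open>X i\<close>, so
        that \<open>indep_vars_sum\<close> yields independence of the unweighted \<open>X i\<close>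
        from the weighted rest.\<close>
      let ?Z = "\<lambda>k \<omega>. (if k = i then (\<lambda>x. x) else (\<lambda>x. a k * x)) (X k \<omega>)"
      have "indep_vars (\<lambda>_. borel) ?Z I"
        by (rule indep_vars_compose2[OF indep]) auto
      then have "indep_vars (\<lambda>_. borel) ?Z (insert i (I - {i}))"
        using i by (simp add: insert_absorb)
      from indep_vars_sum[OF _ _ this]
      have "indep_var borel (?Z i) borel (\<lambda>\<omega>. \<Sum>k\<in>I - {i}. ?Z k \<omega>)" using fin by auto
      moreover have "(\<lambda>\<omega>. \<Sum>k\<in>I - {i}. ?Z k \<omega>) = Y"
        unfolding Y_def by (intro ext sum.cong) auto
      ultimately show ?thesis by simp
    qed
    have prod: "integrable M (\<lambda>\<omega>. u (X i \<omega>) * v (Y \<omega>)) \<and>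
      expectation (\<lambda>\<omega>. u (X i \<omega>) * v (Y \<omega>)) = expectation (\<lambda>\<omega>. u (X i \<omega>)) * expectation (\<lambda>\<omega>. v (Y \<omega>))"
      if "u \<in> borel_measurable borel" "v \<in> borel_measurable borel"
        "integrable M (\<lambda>\<omega>. u (X i \<omega>))" "integrable M (\<lambda>\<omega>. v (Y \<omega>))" for u v :: "real \<Rightarrow> real"
      using indep_var_lebesgue_integral[OF indep_var_compose[OF ind that(1,2)]]
        indep_var_integrable[OF indep_var_compose[OF ind that(1,2)]] that(3,4) by (simp add: comp_def)
    have fY: "integrable M (\<lambda>\<omega>. f (Y \<omega>))"
      by (rule square_integrable_imp_integrable) (simp_all add: f_sq Y_sq)
    have p1: "integrable M (\<lambda>\<omega>. X i \<omega> * f (Y \<omega>))" "expectation (\<lambda>\<omega>. X i \<omega> * f (Y \<omega>)) = 0"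
      using prod[of "\<lambda>x. x" f] fY X_int[OF i] m1[OF i] by auto
    have p2: "integrable M (\<lambda>\<omega>. X i \<omega> * f2 (Y \<omega>))" "expectation (\<lambda>\<omega>. X i \<omega> * f2 (Y \<omega>)) = 0"
      using prod[of "\<lambda>x. x" f2] f1_int X_int[OF i] m1[OF i] by auto
    have p3: "integrable M (\<lambda>\<omega>. X i \<omega> ^ 3 * f2 (Y \<omega>))" "expectation (\<lambda>\<omega>. X i \<omega> ^ 3 * f2 (Y \<omega>)) = 0"
      using prod[of "\<lambda>x. x ^ 3" f2] f1_int X_pow[OF i, of 3] m3[OF i] by auto
    have p4: "integrable M (\<lambda>\<omega>. (1 - (X i \<omega>)\<^sup>2) * f1 (Y \<omega>))"
      "expectation (\<lambda>\<omega>. (1 - (X i \<omega>)\<^sup>2) * f1 (Y \<omega>)) = 0"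
      using prod[of "\<lambda>x. 1 - x\<^sup>2" f1] f1_int X_pow[OF i, of 2] m2[OF i] by (auto simp: prob_space)
    let ?A = "\<lambda>\<omega>. (a i)\<^sup>2 * f1 (S \<omega>) - a i * (X i \<omega> * f (S \<omega>))"
    \<comment> \<open>Taylor polynomial of \<open>?A\<close> around \<open>Y\<close>. Each term is a
      product of a function of \<open>Y\<close> with a centred function of \<open>X i\<close>:
      \<open>X i\<close>, its cube, or 1 minus its square. Only the two Taylor remainders survive in
      the expectation.\<close>
    let ?E = "\<lambda>\<omega>. - a i * (X i \<omega> * f (Y \<omega>)) + a i ^ 3 * (X i \<omega> * f2 (Y \<omega>))
        - a i ^ 3 / 2 * (X i \<omega> ^ 3 * f2 (Y \<omega>)) + (a i)\<^sup>2 * ((1 - (X i \<omega>)\<^sup>2) * f1 (Y \<omega>))"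
    have E: "integrable M ?E" "expectation ?E = 0"
      using p1 p2 p3 p4 by auto
    have A: "integrable M ?A"
    proof (intro Bochner_Integration.integrable_diff integrable_mult_right)
      show "integrable M (\<lambda>\<omega>. X i \<omega> * f (S \<omega>))"
        by (rule integrable_mult_of_square_integrable) (simp_all add: X_pow i f_sq S_sq)
    qed (rule f1_int, simp)
    have bound: "\<bar>?A \<omega> - ?E \<omega>\<bar> \<le> C * a i ^ 4 * ((X i \<omega>)\<^sup>2 + X i \<omega> ^ 4)" for \<omega>
    proof -
      let ?x = "X i \<omega>" and ?y = "Y \<omega>"
      define t where "t = a i * ?x"
      define R1 where "R1 = f1 (?y + t) - f1 ?y - t * f2 ?y"
      define R2 where "R2 = f (?y + t) - f ?y - t * f1 ?y - t\<^sup>2 / 2 * f2 ?y"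
      have "?A \<omega> - ?E \<omega> = (a i)\<^sup>2 * R1 - t * R2"
        unfolding SY R1_def R2_def t_def by (simp add: algebra_simps power2_eq_square power3_eq_cube)
      also have "\<bar>\<dots>\<bar> \<le> (a i)\<^sup>2 * \<bar>R1\<bar> + \<bar>t\<bar> * \<bar>R2\<bar>"
        using abs_triangle_ineq4[of "(a i)\<^sup>2 * R1" "t * R2"] by (simp add: abs_mult)
      also have "\<dots> \<le> (a i)\<^sup>2 * (C * t\<^sup>2) + \<bar>t\<bar> * (C * \<bar>t\<bar> ^ 3)"
        unfolding R1_def R2_def
        by (intro add_mono mult_left_mono taylor1_lipschitz_deriv[OF f1 lip]
            taylor2_lipschitz_deriv[OF f f1 lip]) auto
      also have "\<dots> = C * a i ^ 4 * (?x\<^sup>2 + ?x ^ 4)"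
      proof -
        have "\<bar>t\<bar> * (C * \<bar>t\<bar> ^ 3) = C * \<bar>t\<bar> ^ 4"
          by (simp only: power4_eq_xxxx power3_eq_cube mult_ac)
        moreover have "\<bar>t\<bar> ^ 4 = a i ^ 4 * ?x ^ 4"
          unfolding t_def power_mult_distrib[symmetric] by simp
        moreover have "(a i)\<^sup>2 * (C * t\<^sup>2) = C * (a i ^ 4 * ?x\<^sup>2)"
          unfolding t_def by (simp only: power_mult_distrib power4_eq_xxxx power2_eq_square mult_ac)
        ultimately show ?thesis
          by (simp only: distrib_left mult.assoc)
      qed
      finally show ?thesis .
    qed
    have i1: "integrable M (\<lambda>\<omega>. \<bar>?A \<omega> - ?E \<omega>\<bar>)"
      by (rule integrable_abs[OF Bochner_Integration.integrable_diff[OF A E(1)]])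
    have i2: "integrable M (\<lambda>\<omega>. C * a i ^ 4 * ((X i \<omega>)\<^sup>2 + X i \<omega> ^ 4))"
      by (intro integrable_mult_right Bochner_Integration.integrable_add X_pow[OF i]) simp_all
    have EA: "expectation ?A = expectation (\<lambda>\<omega>. ?A \<omega> - ?E \<omega>)"
      by (subst Bochner_Integration.integral_diff[OF A E(1)]) (simp only: E(2) diff_0_right)
    have "\<bar>expectation ?A\<bar> \<le> expectation (\<lambda>\<omega>. \<bar>?A \<omega> - ?E \<omega>\<bar>)"
      unfolding EA
      by (rule integral_abs_bound)
    also have "\<dots> \<le> expectation (\<lambda>\<omega>. C * a i ^ 4 * ((X i \<omega>)\<^sup>2 + X i \<omega> ^ 4))"
      by (rule integral_mono[OF i1 i2 bound])
    also have "\<dots> = C * a i ^ 4 * (1 + expectation (\<lambda>\<omega>. X i \<omega> ^ 4))"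
      using X_pow[OF i, of 2] X_pow[OF i, of 4] m2[OF i] by simp
    also have "\<dots> \<le> C * a i ^ 4 * (1 + \<mu>)"
      using m4[OF i] C by (intro mult_left_mono) auto
    also have "\<dots> = C * (1 + \<mu>) * a i ^ 4" by (simp only: mult_ac)
    finally show ?thesis by (rule conjI[OF A])
  qed
  have eq: "f1 (S \<omega>) - S \<omega> * f (S \<omega>) = (\<Sum>i\<in>I. (a i)\<^sup>2 * f1 (S \<omega>) - a i * (X i \<omega> * f (S \<omega>)))" for \<omega>
  proof -
    have "(\<Sum>i\<in>I. (a i)\<^sup>2 * f1 (S \<omega>)) = f1 (S \<omega>)"
      by (subst sum_distrib_right[symmetric]) (simp add: norm)
    moreover have "(\<Sum>i\<in>I. a i * (X i \<omega> * f (S \<omega>))) = S \<omega> * f (S \<omega>)"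
      by (simp only: mult.assoc[symmetric] sum_distrib_right[symmetric]) (simp only: S_def)
    ultimately show ?thesis
      by (subst sum_subtractf) simp
  qed
  show "integrable M (\<lambda>\<omega>. f1 (S \<omega>) - S \<omega> * f (S \<omega>))"
    unfolding eq using step by (intro Bochner_Integration.integrable_sum) auto
  have ES: "expectation (\<lambda>\<omega>. f1 (S \<omega>) - S \<omega> * f (S \<omega>))
      = (\<Sum>i\<in>I. expectation (\<lambda>\<omega>. (a i)\<^sup>2 * f1 (S \<omega>) - a i * (X i \<omega> * f (S \<omega>))))"
    unfolding eq using step by (intro Bochner_Integration.integral_sum) auto
  have "\<bar>expectation (\<lambda>\<omega>. f1 (S \<omega>) - S \<omega> * f (S \<omega>))\<bar> \<le> (\<Sum>i\<in>I. \<bar>expectation (\<lambda>\<omega>. (a i)\<^sup>2 * f1 (S \<omega>) - a i * (X i \<omega> * f (S \<omega>)))\<bar>)"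
    unfolding ES by (rule sum_abs)
  also have "\<dots> \<le> (\<Sum>i\<in>I. C * (1 + \<mu>) * a i ^ 4)"
    using step by (intro sum_mono) auto
  finally show "\<bar>expectation (\<lambda>\<omega>. f1 (S \<omega>) - S \<omega> * f (S \<omega>))\<bar> \<le> C * (1 + \<mu>) * (\<Sum>i\<in>I. a i ^ 4)"
    by (simp add: sum_distrib_left)
qed

text \<open>Stein's equation rewrites the difference as the expectation controlled by
  \<open>stein_bound\<close>; the factor 2 is the Lipschitz constant from
  \<open>stein_solution_hinge\<close>.\<close>

lemma (in prob_space) hinge_normal_approx:
  fixes X :: "'i \<Rightarrow> 'a \<Rightarrow> real"
  assumes "finite I" "indep_vars (\<lambda>_. borel) X I"
    and "\<And>i. i \<in> I \<Longrightarrow> integrable M (\<lambda>\<omega>. X i \<omega> ^ 4)"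
    and "\<And>i. i \<in> I \<Longrightarrow> expectation (X i) = 0"
    and "\<And>i. i \<in> I \<Longrightarrow> expectation (\<lambda>\<omega>. (X i \<omega>)\<^sup>2) = 1"
    and "\<And>i. i \<in> I \<Longrightarrow> expectation (\<lambda>\<omega>. X i \<omega> ^ 3) = 0"
    and "\<And>i. i \<in> I \<Longrightarrow> expectation (\<lambda>\<omega>. X i \<omega> ^ 4) \<le> \<mu>"
    and "(\<Sum>i\<in>I. (a i)\<^sup>2) = 1"
  shows "\<bar>expectation (\<lambda>\<omega>. (max ((\<Sum>i\<in>I. a i * X i \<omega>) - u) 0)\<^sup>2) - normal_hinge u\<bar>
    \<le> 2 * (1 + \<mu>) * (\<Sum>i\<in>I. a i ^ 4)"
proof (rule stein_solution_hinge[of u])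
  fix f f1 f2 :: "real \<Rightarrow> real" and B
  assume f: "\<And>x. (f has_real_derivative f1 x) (at x)"
    "\<And>x. (f1 has_real_derivative f2 x) (at x)" "\<And>x y. \<bar>f2 x - f2 y\<bar> \<le> 2 * \<bar>x - y\<bar>"
    "\<And>x. \<bar>f1 x\<bar> \<le> B" "\<And>x. \<bar>f2 x\<bar> \<le> B"
    and eq: "\<And>x. f1 x - x * f x = (max (x - u) 0)\<^sup>2 - normal_hinge u"
  note st = stein_bound[OF assms f, unfolded eq]
  have "integrable M (\<lambda>\<omega>. ((max ((\<Sum>i\<in>I. a i * X i \<omega>) - u) 0)\<^sup>2 - normal_hinge u) + normal_hinge u)"
    by (intro Bochner_Integration.integrable_add st(1)) auto
  then have "integrable M (\<lambda>\<omega>. (max ((\<Sum>i\<in>I. a i * X i \<omega>) - u) 0)\<^sup>2)"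
    by simp
  with st(2) show ?thesis by (simp add: prob_space)
qed

section \<open>Risk of a single soft threshold\<close>

definition thr_risk :: "'a measure \<Rightarrow> ('a \<Rightarrow> real) \<Rightarrow> real \<Rightarrow> real \<Rightarrow> real" where
  "thr_risk M S l t = (\<integral>\<omega>. (soft_threshold l (t + S \<omega>) - t)\<^sup>2 \<partial>M)"

abbreviation hinge1 :: "'a measure \<Rightarrow> ('a \<Rightarrow> real) \<Rightarrow> real \<Rightarrow> real" where
  "hinge1 M S u \<equiv> (\<integral>\<omega>. max (S \<omega> - u) 0 \<partial>M)"

abbreviation hinge2 :: "'a measure \<Rightarrow> ('a \<Rightarrow> real) \<Rightarrow> real \<Rightarrow> real" where
  "hinge2 M S u \<equiv> (\<integral>\<omega>. (max (S \<omega> - u) 0)\<^sup>2 \<partial>M)"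

lemma soft_threshold_measurable [measurable]: "soft_threshold l \<in> borel_measurable borel"
  unfolding soft_threshold_def[abs_def] by measurable

text \<open>The thresholded value is the first hinge minus the second. As \<open>l\<close> is
  positive, at most one of them is nonzero, so squaring produces no mixed term.\<close>

lemma soft_threshold_sq_error:
  assumes "0 < l"
  shows "(soft_threshold l (t + z) - t)\<^sup>2 = t\<^sup>2 - 2 * t * max (z - (l - t)) 0
    + 2 * t * max (- z - (l + t)) 0 + (max (z - (l - t)) 0)\<^sup>2 + (max (- z - (l + t)) 0)\<^sup>2"
proof -
  consider "l < t + z" | "t + z < - l" | "\<bar>t + z\<bar> \<le> l" by linarith
  then show ?thesis
  proof cases
    case 1
    then have e: "soft_threshold l (t + z) = t + z - l" "max (z - (l - t)) 0 = t + z - l"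
      "max (- z - (l + t)) 0 = 0"
      using assms by (auto simp: soft_threshold_def max_def sgn_if)
    show ?thesis unfolding e by (simp add: power2_eq_square algebra_simps)
  next
    case 2
    then have e: "soft_threshold l (t + z) = t + z + l" "max (z - (l - t)) 0 = 0"
      "max (- z - (l + t)) 0 = - (t + z + l)"
      using assms by (auto simp: soft_threshold_def max_def sgn_if)
    show ?thesis unfolding e by (simp add: power2_eq_square algebra_simps)
  next
    case 3
    then have "soft_threshold l (t + z) = 0" "max (z - (l - t)) 0 = 0" "max (- z - (l + t)) 0 = 0"
      using assms by (auto simp: soft_threshold_def max_def)
    then show ?thesis by simp
  qed
qed

lemma soft_threshold_minus: "soft_threshold l (- x) = - soft_threshold l x"
  by (simp add: soft_threshold_def sgn_minus)

lemma soft_threshold_scale: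
  assumes "0 < c"
  shows "soft_threshold (c * l) (c * x) = c * soft_threshold l x"
proof -
  have "max (\<bar>c * x\<bar> - c * l) 0 = c * max (\<bar>x\<bar> - l) 0"
    using assms by (simp add: abs_mult max_mult_distrib_left right_diff_distrib)
  then show ?thesis using assms by (simp add: soft_threshold_def sgn_mult)
qed

lemma soft_threshold_error_le:
  assumes "0 < l"
  shows "\<bar>soft_threshold l (t + z) - t\<bar> \<le> \<bar>z\<bar> + l"
  using assms by (auto simp: soft_threshold_def max_def sgn_if abs_if)

text \<open>Under noise at most \<open>- K\<close> the estimate is either at most 0, with error at
  least \<open>t\<close>, or equal to \<open>t + z - l\<close>, with error at least
  \<open>l + K\<close>.\<close>

lemma soft_threshold_error_ge:
  assumes "0 < l" "0 \<le> t" "0 \<le> K" "z \<le> - K"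
  shows "(min t (l + K))\<^sup>2 \<le> (soft_threshold l (t + z) - t)\<^sup>2"
proof -
  have "min t (l + K) \<le> t - soft_threshold l (t + z)"
    using assms by (auto simp: soft_threshold_def max_def min_def sgn_if abs_if)
  moreover have "0 \<le> min t (l + K)" using assms by auto
  ultimately have "(min t (l + K))\<^sup>2 \<le> (t - soft_threshold l (t + z))\<^sup>2"
    by (rule power_mono)
  then show ?thesis by (simp add: power2_commute)
qed

context prob_space
begin

lemma thr_risk_integrable:
  assumes [measurable]: "random_variable borel S" and "integrable M (\<lambda>\<omega>. (S \<omega>)\<^sup>2)" and "0 < l"
  shows "integrable M (\<lambda>\<omega>. (soft_threshold l (t + S \<omega>) - t)\<^sup>2)"
proof (rule Bochner_Integration.integrable_bound)
  show "integrable M (\<lambda>\<omega>. (\<bar>S \<omega>\<bar> + l)\<^sup>2)"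
    by (rule square_integrable_add) (use assms in auto)
  show "AE \<omega> in M. norm ((soft_threshold l (t + S \<omega>) - t)\<^sup>2) \<le> norm ((\<bar>S \<omega>\<bar> + l)\<^sup>2)"
  proof (rule AE_I2)
    fix \<omega>
    have "\<bar>soft_threshold l (t + S \<omega>) - t\<bar>\<^sup>2 \<le> (\<bar>S \<omega>\<bar> + l)\<^sup>2"
      by (intro power_mono soft_threshold_error_le assms) auto
    then show "norm ((soft_threshold l (t + S \<omega>) - t)\<^sup>2) \<le> norm ((\<bar>S \<omega>\<bar> + l)\<^sup>2)" by simp
  qed
qed simp

lemma hinge_integrable:
  fixes S :: "'a \<Rightarrow> real"
  assumes [measurable]: "random_variable borel S" and "integrable M (\<lambda>\<omega>. (S \<omega>)\<^sup>2)"
  shows "integrable M (\<lambda>\<omega>. max (S \<omega> - u) 0)" "integrable M (\<lambda>\<omega>. (max (S \<omega> - u) 0)\<^sup>2)"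
proof -
  show sq: "integrable M (\<lambda>\<omega>. (max (S \<omega> - u) 0)\<^sup>2)"
  proof (rule Bochner_Integration.integrable_bound)
    show "integrable M (\<lambda>\<omega>. (S \<omega> + (- u))\<^sup>2)"
      by (rule square_integrable_add) (use assms in auto)
  qed (auto simp: max_def)
  show "integrable M (\<lambda>\<omega>. max (S \<omega> - u) 0)"
    by (rule square_integrable_imp_integrable[OF _ sq]) simp
qed

text \<open>As a function of \<open>u\<close>, \<open>hinge2\<close> has derivative -2 times
  \<open>hinge1\<close>. The first inequality is its convexity; the second holds because
  \<open>hinge1\<close> grows by at most \<eta> when \<open>u\<close> decreases by \<eta>.\<close>

lemma hinge2_slope:
  assumes "random_variable borel S" and "integrable M (\<lambda>\<omega>. (S \<omega>)\<^sup>2)" and "0 \<le> \<eta>"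
  shows "2 * \<eta> * hinge1 M S u \<le> hinge2 M S (u - \<eta>) - hinge2 M S u"
    and "hinge2 M S (u - \<eta>) - hinge2 M S u \<le> 2 * \<eta> * (hinge1 M S u + \<eta>)"
proof -
  note I = hinge_integrable[OF assms(1,2)]
  have eq: "hinge2 M S (u - \<eta>) - hinge2 M S u
      = (\<integral>\<omega>. (max (S \<omega> - (u - \<eta>)) 0)\<^sup>2 - (max (S \<omega> - u) 0)\<^sup>2 \<partial>M)"
    by (rule Bochner_Integration.integral_diff[symmetric]; rule I)
  have "2 * \<eta> * hinge1 M S u = (\<integral>\<omega>. 2 * \<eta> * max (S \<omega> - u) 0 \<partial>M)"
    by simp
  also have "\<dots> \<le> (\<integral>\<omega>. (max (S \<omega> - (u - \<eta>)) 0)\<^sup>2 - (max (S \<omega> - u) 0)\<^sup>2 \<partial>M)"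
  proof (rule integral_mono)
    fix \<omega>
    show "2 * \<eta> * max (S \<omega> - u) 0 \<le> (max (S \<omega> - (u - \<eta>)) 0)\<^sup>2 - (max (S \<omega> - u) 0)\<^sup>2"
    proof -
      define x where "x = S \<omega> - u"
      have "2 * \<eta> * max x 0 \<le> (max (x + \<eta>) 0)\<^sup>2 - (max x 0)\<^sup>2"
      proof (cases "0 \<le> x")
        case True
        then have "max x 0 = x" "max (x + \<eta>) 0 = x + \<eta>" using \<open>0 \<le> \<eta>\<close> by auto
        then show ?thesis by (simp add: power2_eq_square algebra_simps)
      next
        case False
        then have "max x 0 = 0" by simp
        then show ?thesis by simp
      qed
      then show ?thesis by (simp add: x_def algebra_simps)
    qed
  qed (auto intro!: I)
  finally show "2 * \<eta> * hinge1 M S u \<le> hinge2 M S (u - \<eta>) - hinge2 M S u"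
    unfolding eq .
  have "(\<integral>\<omega>. (max (S \<omega> - (u - \<eta>)) 0)\<^sup>2 - (max (S \<omega> - u) 0)\<^sup>2 \<partial>M)
      \<le> (\<integral>\<omega>. 2 * \<eta> * (max (S \<omega> - u) 0 + \<eta>) \<partial>M)"
  proof (rule integral_mono)
    fix \<omega>
    define x where "x = S \<omega> - u"
    have "(max (x + \<eta>) 0)\<^sup>2 - (max x 0)\<^sup>2 \<le> 2 * \<eta> * (max x 0 + \<eta>)"
    proof (cases "0 \<le> x")
      case True
      then have "max x 0 = x" "max (x + \<eta>) 0 = x + \<eta>" using \<open>0 \<le> \<eta>\<close> by auto
      then show ?thesis by (simp add: power2_eq_square algebra_simps)
    next
      case False
      then have "(max (x + \<eta>) 0)\<^sup>2 \<le> \<eta>\<^sup>2" using \<open>0 \<le> \<eta>\<close> by (intro power_mono) auto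
      moreover have "\<eta>\<^sup>2 \<le> 2 * \<eta> * \<eta>" by (simp add: power2_eq_square)
      moreover have "max x 0 = 0" using False by simp
      ultimately show ?thesis by simp
    qed
    then show "(max (S \<omega> - (u - \<eta>)) 0)\<^sup>2 - (max (S \<omega> - u) 0)\<^sup>2 \<le> 2 * \<eta> * (max (S \<omega> - u) 0 + \<eta>)"
      by (simp add: x_def algebra_simps)
  qed (auto intro!: I)
  also have "\<dots> = 2 * \<eta> * (hinge1 M S u + \<eta>)"
    using I by (simp add: prob_space)
  finally show "hinge2 M S (u - \<eta>) - hinge2 M S u \<le> 2 * \<eta> * (hinge1 M S u + \<eta>)"
    unfolding eq .
qed

text \<open>Turns control of \<open>hinge2\<close> into decay of \<open>hinge1\<close> at large
  arguments. Pointwise, x = S - v satisfies v x \<le> (x + v / 2)^2.\<close>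

lemma hinge1_le_hinge2:
  assumes "random_variable borel S" and "integrable M (\<lambda>\<omega>. (S \<omega>)\<^sup>2)" and "0 < v"
  shows "v * hinge1 M S v \<le> hinge2 M S (v / 2)"
proof -
  note I = hinge_integrable[OF assms(1,2)]
  have "v * hinge1 M S v = (\<integral>\<omega>. v * max (S \<omega> - v) 0 \<partial>M)" by simp
  also have "\<dots> \<le> hinge2 M S (v / 2)"
  proof (rule integral_mono)
    fix \<omega>
    show "v * max (S \<omega> - v) 0 \<le> (max (S \<omega> - v / 2) 0)\<^sup>2"
    proof (cases "v < S \<omega>")
      case True
      have "v * (S \<omega> - v) \<le> (S \<omega> - v)\<^sup>2 + v * (S \<omega> - v) + (v / 2)\<^sup>2" by simp
      also have "\<dots> = (S \<omega> - v / 2)\<^sup>2" by (simp add: power2_eq_square field_simps)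
      finally show ?thesis using True \<open>0 < v\<close> by (simp add: max_def)
    qed auto
  qed (auto intro!: I)
  finally show ?thesis .
qed

text \<open>The positive part of x minus the positive part of -x is x. Far to the left,
  \<open>hinge1\<close> thus splits into a tail on the right and a linear part that is the same for
  every centred noise.\<close>

lemma hinge1_reflect:
  assumes "random_variable borel S" and "integrable M (\<lambda>\<omega>. (S \<omega>)\<^sup>2)" and "expectation S = 0"
  shows "hinge1 M S u = hinge1 M (\<lambda>\<omega>. - S \<omega>) (- u) - u"
proof -
  have I: "integrable M (\<lambda>\<omega>. max (- S \<omega> - - u) 0)"
    using assms by (intro hinge_integrable) auto
  have S: "integrable M (\<lambda>\<omega>. S \<omega> - u)"
    using square_integrable_imp_integrable[OF assms(1,2)] by simp
  have "hinge1 M S u - hinge1 M (\<lambda>\<omega>. - S \<omega>) (- u)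
      = (\<integral>\<omega>. max (S \<omega> - u) 0 - max (- S \<omega> - - u) 0 \<partial>M)"
    by (rule Bochner_Integration.integral_diff[symmetric, OF hinge_integrable(1)[OF assms(1,2)] I])
  also have "(\<lambda>\<omega>. max (S \<omega> - u) 0 - max (- S \<omega> - - u) 0) = (\<lambda>\<omega>. S \<omega> - u)"
    by (rule ext) (simp add: max_def)
  also have "(\<integral>\<omega>. S \<omega> - u \<partial>M) = - u"
    using square_integrable_imp_integrable[OF assms(1,2)] assms(3) by (simp add: prob_space)
  finally show ?thesis by simp
qed

lemma thr_risk_eq:
  assumes "random_variable borel S" and "integrable M (\<lambda>\<omega>. (S \<omega>)\<^sup>2)" and "0 < l"
  shows "thr_risk M S l t = t\<^sup>2 - 2 * t * hinge1 M S (l - t) + 2 * t * hinge1 M (\<lambda>\<omega>. - S \<omega>) (l + t)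
    + hinge2 M S (l - t) + hinge2 M (\<lambda>\<omega>. - S \<omega>) (l + t)"
proof -
  have "random_variable borel (\<lambda>\<omega>. - S \<omega>)" "integrable M (\<lambda>\<omega>. (- S \<omega>)\<^sup>2)"
    using assms by auto
  note I = hinge_integrable[OF assms(1,2)] hinge_integrable[OF this]
  show ?thesis
    unfolding thr_risk_def soft_threshold_sq_error[OF assms(3)]
    using I by (simp add: prob_space)
qed

end

text \<open>\<open>hinge1\<close> is recovered from difference quotients of \<open>hinge2\<close>
  with step \<eta>. The quotient itself errs by \<eta> and the comparison by \<Delta> / \<eta>; the
  choice \<eta> = \<surd>\<Delta> balances the two.\<close>

lemma hinge1_compare:
  assumes "prob_space M" "S \<in> borel_measurable M" "integrable M (\<lambda>\<omega>. (S \<omega>)\<^sup>2)"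
    and "prob_space N" "T \<in> borel_measurable N" "integrable N (\<lambda>\<omega>. (T \<omega>)\<^sup>2)"
    and "0 < \<Delta>" "\<And>u. \<bar>hinge2 M S u - hinge2 N T u\<bar> \<le> \<Delta>"
  shows "hinge1 M S u \<le> hinge1 N T u + 2 * sqrt \<Delta>"
proof -
  define \<eta> where "\<eta> = sqrt \<Delta>"
  have \<eta>: "0 < \<eta>" "\<eta> * \<eta> = \<Delta>" using assms(7) by (auto simp: \<eta>_def)
  have "2 * \<eta> * hinge1 M S u \<le> hinge2 M S (u - \<eta>) - hinge2 M S u"
    using prob_space.hinge2_slope(1)[OF assms(1-3)] \<eta> by simp
  also have "\<dots> \<le> hinge2 N T (u - \<eta>) - hinge2 N T u + 2 * \<Delta>"
    using assms(8)[of u] assms(8)[of "u - \<eta>"] by linarith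
  also have "\<dots> \<le> 2 * \<eta> * (hinge1 N T u + \<eta>) + 2 * \<Delta>"
    using prob_space.hinge2_slope(2)[OF assms(4-6)] \<eta> by simp
  also have "\<dots> = 2 * \<eta> * (hinge1 N T u + 2 * \<eta>)"
    using \<eta> by (simp add: algebra_simps)
  finally show ?thesis using \<eta> by (simp add: \<eta>_def)
qed

section \<open>Gaussian hinge functions and Gaussian risk\<close>

lemma std_normal_reflect:
  fixes f :: "real \<Rightarrow> real"
  assumes [measurable]: "f \<in> borel_measurable borel"
  shows "(\<integral>x. f (- x) \<partial>std_normal_distribution) = (\<integral>x. f x \<partial>std_normal_distribution)"
proof -
  have "(\<integral>x. f x \<partial>std_normal_distribution) = (\<integral>x. std_normal_density x * f x \<partial>lborel)"
    by (subst integral_density) (auto simp: normal_density_nonneg)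
  also have "\<dots> = (\<integral>x. std_normal_density (- x) * f (- x) \<partial>lborel)"
    using lborel_integral_real_affine[of "- 1" "\<lambda>x. std_normal_density x * f x" 0] by simp
  also have "\<dots> = (\<integral>x. f (- x) \<partial>std_normal_distribution)"
    by (subst integral_density) (auto simp: normal_density_nonneg std_normal_density_def)
  finally show ?thesis ..
qed

interpretation std_normal: real_distribution std_normal_distribution
  by (rule real_dist_normal_dist)

lemma std_normal_hinge2: "hinge2 std_normal_distribution (\<lambda>x. x) u = normal_hinge u"
  by (subst integral_density)
    (auto simp: normal_density_nonneg has_bochner_integral_integral_eq[OF normal_hinge_integral])

lemma std_normal_square_integrable: "integrable std_normal_distribution (\<lambda>x. x\<^sup>2)"
  using integrable_std_normal_moment[of 2] by (subst integrable_density) (auto simp: normal_density_nonneg)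

lemma std_normal_mean: "(\<integral>x. x \<partial>std_normal_distribution) = 0"
  using integral_std_normal_moment_odd[of 0] by (subst integral_density) (auto simp: normal_density_nonneg)

text \<open>Markov's inequality with the fourth moment 3 of the standard normal law: the squared
  hinge at v > 0 is at most x^4 / v^2.\<close>

lemma normal_hinge_le:
  assumes "0 < v"
  shows "normal_hinge v \<le> 3 / v\<^sup>2"
proof -
  have I: "integrable std_normal_distribution (\<lambda>x. x ^ 4)"
    using integrable_std_normal_moment[of 4] by (subst integrable_density) (auto simp: normal_density_nonneg)
  have m: "(\<integral>x. x ^ 4 \<partial>std_normal_distribution) = 3"
    using integral_std_normal_moment_even[of 2]
    by (subst integral_density) (auto simp: normal_density_nonneg fact_numeral)
  have "normal_hinge v = hinge2 std_normal_distribution (\<lambda>x. x) v"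
    by (simp add: std_normal_hinge2)
  also have "\<dots> \<le> (\<integral>x. x ^ 4 / v\<^sup>2 \<partial>std_normal_distribution)"
  proof (rule integral_mono)
    show "integrable std_normal_distribution (\<lambda>x. (max (x - v) 0)\<^sup>2)"
      by (rule std_normal.hinge_integrable) (auto simp: std_normal_square_integrable)
    show "integrable std_normal_distribution (\<lambda>x. x ^ 4 / v\<^sup>2)" using I by simp
    fix x :: real
    show "(max (x - v) 0)\<^sup>2 \<le> x ^ 4 / v\<^sup>2"
    proof (cases "v < x")
      case True
      have "(x - v)\<^sup>2 * v\<^sup>2 \<le> x\<^sup>2 * x\<^sup>2"
        using True assms by (intro mult_mono power_mono) auto
      then show ?thesis using True assms
        by (simp add: max_def field_simps power_add[symmetric])
    qed auto
  qed
  also have "\<dots> = 3 / v\<^sup>2" using m by simp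
  finally show ?thesis .
qed

abbreviation normal_risk :: "real \<Rightarrow> real \<Rightarrow> real" where
  "normal_risk \<equiv> thr_risk std_normal_distribution (\<lambda>x. x)"

lemma normal_risk_nonneg: "0 \<le> normal_risk l t"
  unfolding thr_risk_def by simp

lemma normal_risk_eq:
  assumes "0 < l"
  shows "normal_risk l t = t\<^sup>2 - 2 * t * hinge1 std_normal_distribution (\<lambda>x. x) (l - t)
    + 2 * t * hinge1 std_normal_distribution (\<lambda>x. x) (l + t) + normal_hinge (l - t) + normal_hinge (l + t)"
proof -
  have "hinge1 std_normal_distribution (\<lambda>x. - x) u = hinge1 std_normal_distribution (\<lambda>x. x) u"
    "hinge2 std_normal_distribution (\<lambda>x. - x) u = hinge2 std_normal_distribution (\<lambda>x. x) u" for u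
    using std_normal_reflect[of "\<lambda>x. max (x - u) 0"] std_normal_reflect[of "\<lambda>x. (max (x - u) 0)\<^sup>2"]
    by auto
  then show ?thesis
    using std_normal.thr_risk_eq[of "\<lambda>x. x" l t] std_normal_square_integrable assms
    by (simp add: std_normal_hinge2)
qed

lemma thr_risk_uminus: "thr_risk M S l (- t) = thr_risk M (\<lambda>\<omega>. - S \<omega>) l t"
proof -
  have "(soft_threshold l (- t + s) - - t)\<^sup>2 = (soft_threshold l (t + - s) - t)\<^sup>2" for s
    using soft_threshold_minus[of l "t - s"] by (simp add: power2_commute algebra_simps)
  then show ?thesis unfolding thr_risk_def by simp
qed

lemma normal_risk_uminus: "normal_risk l (- t) = normal_risk l t"
  unfolding thr_risk_uminus unfolding thr_risk_def
  using std_normal_reflect[of "\<lambda>x. (soft_threshold l (t + x) - t)\<^sup>2"] by simp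

lemma normal_risk_ge:
  assumes "0 < l" "0 \<le> t" "0 \<le> K"
  shows "measure std_normal_distribution {..- K} * (min t (l + K))\<^sup>2 \<le> normal_risk l t"
proof -
  have "measure std_normal_distribution {..- K} * (min t (l + K))\<^sup>2
      = (\<integral>x. (min t (l + K))\<^sup>2 * indicator {..- K} x \<partial>std_normal_distribution)"
    by simp
  also have "\<dots> \<le> normal_risk l t"
    unfolding thr_risk_def
  proof (rule integral_mono)
    show "integrable std_normal_distribution (\<lambda>x. (soft_threshold l (t + x) - t)\<^sup>2)"
      by (rule std_normal.thr_risk_integrable) (auto simp: std_normal_square_integrable assms)
    fix x
    show "(min t (l + K))\<^sup>2 * indicator {..- K} x \<le> (soft_threshold l (t + x) - t)\<^sup>2"
      using soft_threshold_error_ge[OF assms, of x] by (auto simp: indicator_def)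
    show "integrable std_normal_distribution (\<lambda>x. (min t (l + K))\<^sup>2 * indicator {..- K} x)"
      by (intro integrable_mult_right std_normal.integrable_const_bound[where B = 1]) auto
  qed
  finally show ?thesis .
qed

lemma std_normal_atMost_pos: "0 < measure std_normal_distribution {..x}"
proof -
  have "emeasure std_normal_distribution {..x} \<noteq> 0"
  proof
    assume "emeasure std_normal_distribution {..x} = 0"
    then have "AE y in lborel. y \<in> {..x} \<longrightarrow> std_normal_density y \<le> 0"
      by (subst (asm) emeasure_density) (auto simp: nn_integral_0_iff_AE ennreal_eq_0_iff
          indicator_def split: if_splits elim: eventually_mono)
    then have "AE y in lborel. y \<notin> {..x}"
      by eventually_elim (use normal_density_pos[of 1 0] in \<open>auto simp: not_le[symmetric]\<close>)
    then have "emeasure lborel {..x} = 0"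
      by (subst AE_iff_measurable[symmetric, of _ lborel "\<lambda>y. y \<notin> {..x}"]) auto
    moreover have "emeasure lborel {x - 1..x} \<le> emeasure lborel {..x}"
      by (rule emeasure_mono) auto
    ultimately show False by simp
  qed
  then show ?thesis
    by (simp add: std_normal.emeasure_eq_measure zero_less_measure_iff)
qed

text \<open>The 72 is 48 + 24, the coefficients of \<tau> contributed by the two
  \<open>hinge1\<close> terms for large signals in \<open>thr_risk_normal_approx_nonneg\<close>. The
  denominator is the lower bound for the Gaussian risk there, from noise at most -1.\<close>

definition risk_const :: real where
  "risk_const = 72 / measure std_normal_distribution {..-1}"

lemma risk_const_ge: "72 \<le> risk_const"
  unfolding risk_const_def using std_normal_atMost_pos[of "-1"] std_normal.prob_le_1[of "{..-1}"]
  by (simp add: field_simps)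

text \<open>For \<open>t \<le> 2 (l + 1)\<close> the Gaussian risk dominates a multiple of \<open>t\<^sup>2\<close>, which absorbs the error term linear
  in \<open>t\<close>. For larger \<open>t\<close> the hinge functions are evaluated far from the origin, where the Gaussian and
  non-Gaussian ones are both small, up to an explicit linear part.\<close>

lemma thr_risk_normal_approx_nonneg:
  assumes M: "prob_space M" and S: "S \<in> borel_measurable M" "integrable M (\<lambda>\<omega>. (S \<omega>)\<^sup>2)"
    and mean: "(\<integral>\<omega>. S \<omega> \<partial>M) = 0"
    and \<Delta>: "0 < \<Delta>" "\<And>u. \<bar>hinge2 M S u - normal_hinge u\<bar> \<le> \<Delta>"
      "\<And>u. \<bar>hinge2 M (\<lambda>\<omega>. - S \<omega>) u - normal_hinge u\<bar> \<le> \<Delta>"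
    and \<tau>: "0 < \<tau>" "\<tau> \<le> 1" and l: "0 < l" and t: "0 \<le> t"
  shows "thr_risk M S l t \<le> (1 + risk_const * \<tau>) * normal_risk l t + risk_const * \<Delta> / \<tau>\<^sup>2"
proof -
  interpret prob_space M by fact
  let ?G = "std_normal_distribution" and ?i = "\<lambda>x::real. x" and ?T = "\<lambda>\<omega>. - S \<omega>"
  have T: "?T \<in> borel_measurable M" "integrable M (\<lambda>\<omega>. (?T \<omega>)\<^sup>2)" using S by auto
  have G: "prob_space ?G" "?i \<in> borel_measurable ?G" "integrable ?G (\<lambda>x. (?i x)\<^sup>2)"
    by (auto simp: std_normal_square_integrable std_normal.prob_space_axioms)
  define p where "p = measure ?G {..-1}"
  have p: "0 < p" "p \<le> 1" unfolding p_def by (auto simp: std_normal_atMost_pos)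
  define R where "R = normal_risk l t"
  have R0: "0 \<le> R" unfolding R_def by (rule normal_risk_nonneg)
  have RL: "p * (min t (l + 1))\<^sup>2 \<le> R"
    using normal_risk_ge[of l t 1] l t by (simp add: p_def R_def)
  have kS: "\<bar>hinge1 M S u - hinge1 ?G ?i u\<bar> \<le> 2 * sqrt \<Delta>" for u
    using hinge1_compare[OF M S G \<Delta>(1), of u] hinge1_compare[OF G M S \<Delta>(1), of u] \<Delta>(2)
    by (auto simp: std_normal_hinge2 abs_minus_commute abs_le_iff)
  have kT: "\<bar>hinge1 M ?T u - hinge1 ?G ?i u\<bar> \<le> 2 * sqrt \<Delta>" for u
    using hinge1_compare[OF M T G \<Delta>(1), of u] hinge1_compare[OF G M T \<Delta>(1), of u] \<Delta>(3)
    by (auto simp: std_normal_hinge2 abs_minus_commute abs_le_iff)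
  have \<tau>2: "\<tau>\<^sup>2 \<le> \<tau>" "\<tau>\<^sup>2 \<le> 1" using \<tau> by (auto simp: power2_eq_square mult_le_one mult_left_le)
  have \<Delta>\<tau>: "\<Delta> \<le> \<Delta> / \<tau>\<^sup>2" "\<Delta> / \<tau> \<le> \<Delta> / \<tau>\<^sup>2"
    using \<tau> \<tau>2 \<Delta>(1) by (auto simp: field_simps power2_eq_square intro: order_trans)
  have D: "thr_risk M S l t - R \<le> 2 * t * \<bar>hinge1 M S (l - t) - hinge1 ?G ?i (l - t)\<bar>
      + 2 * t * \<bar>hinge1 M ?T (l + t) - hinge1 ?G ?i (l + t)\<bar> + 2 * \<Delta>"
  proof -
    have "thr_risk M S l t - R = - (2 * t * (hinge1 M S (l - t) - hinge1 ?G ?i (l - t)))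
      + 2 * t * (hinge1 M ?T (l + t) - hinge1 ?G ?i (l + t))
      + (hinge2 M S (l - t) - normal_hinge (l - t)) + (hinge2 M ?T (l + t) - normal_hinge (l + t))"
      unfolding R_def thr_risk_eq[OF S l] normal_risk_eq[OF l] by (simp add: algebra_simps)
    moreover have "- (2 * t * (hinge1 M S (l - t) - hinge1 ?G ?i (l - t)))
        \<le> 2 * t * \<bar>hinge1 M S (l - t) - hinge1 ?G ?i (l - t)\<bar>"
      unfolding mult_minus_right[symmetric] using t by (intro mult_left_mono) auto
    moreover have "2 * t * (hinge1 M ?T (l + t) - hinge1 ?G ?i (l + t))
        \<le> 2 * t * \<bar>hinge1 M ?T (l + t) - hinge1 ?G ?i (l + t)\<bar>"
      using t by (intro mult_left_mono) auto
    ultimately show ?thesis using \<Delta>(2)[of "l - t"] \<Delta>(3)[of "l + t"] by linarith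
  qed
  have goal: "thr_risk M S l t \<le> (1 + risk_const * \<tau>) * R + risk_const * \<Delta> / \<tau>\<^sup>2"
    if "thr_risk M S l t - R \<le> 72 / p * \<tau> * R + 18 * (\<Delta> / \<tau>\<^sup>2)"
  proof -
    have "18 * (\<Delta> / \<tau>\<^sup>2) \<le> risk_const * (\<Delta> / \<tau>\<^sup>2)"
      using risk_const_ge \<Delta>(1) by (intro mult_right_mono) auto
    then show ?thesis using that by (simp add: algebra_simps risk_const_def p_def)
  qed
  show ?thesis
  proof (cases "t \<le> 2 * (l + 1)")
    case True
    have "(t / 2)\<^sup>2 \<le> (min t (l + 1))\<^sup>2" using True t l by (intro power_mono) auto
    then have "p * (t / 2)\<^sup>2 \<le> R"
      using RL p by (meson mult_left_mono order_trans less_imp_le)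
    then have tR: "t\<^sup>2 \<le> 4 / p * R" using p by (simp add: field_simps)
    have "2 * t * \<bar>hinge1 M S (l - t) - hinge1 ?G ?i (l - t)\<bar>
        + 2 * t * \<bar>hinge1 M ?T (l + t) - hinge1 ?G ?i (l + t)\<bar>
      \<le> 2 * t * (2 * sqrt \<Delta>) + 2 * t * (2 * sqrt \<Delta>)"
      using t by (intro add_mono mult_left_mono kS kT) auto
    also have "\<dots> = 8 * t * sqrt \<Delta>" by simp
    \<comment> \<open>Weighted AM-GM: the linear error becomes a fraction \<tau> of t^2, hence of
      the Gaussian risk up to a constant, plus a term free of t.\<close>
    also have "\<dots> \<le> \<tau> * t\<^sup>2 + 16 * (\<Delta> / \<tau>)"
    proof -
      have "0 \<le> (\<tau> * t - 4 * sqrt \<Delta>)\<^sup>2 / \<tau>" using \<tau> by simp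
      also have "\<dots> = \<tau> * t\<^sup>2 - 8 * t * sqrt \<Delta> + 16 * (\<Delta> / \<tau>)"
        using \<tau> \<Delta>(1) by (simp add: power2_diff power_mult_distrib field_simps power2_eq_square)
      finally show ?thesis by linarith
    qed
    also have "\<dots> \<le> \<tau> * (72 / p * R) + 16 * (\<Delta> / \<tau>\<^sup>2)"
    proof (intro add_mono mult_left_mono)
      have "4 / p * R \<le> 72 / p * R" using p R0 by (intro mult_right_mono divide_right_mono) auto
      then show "t\<^sup>2 \<le> 72 / p * R" using tR by linarith
    qed (use \<tau> \<Delta>\<tau> in auto)
    finally have "thr_risk M S l t - R \<le> \<tau> * (72 / p * R) + 16 * (\<Delta> / \<tau>\<^sup>2) + 2 * \<Delta>"
      using D by linarith
    also have "\<dots> \<le> 72 / p * \<tau> * R + 18 * (\<Delta> / \<tau>\<^sup>2)"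
    proof -
      have "\<tau> * (72 / p * R) = 72 / p * \<tau> * R" by simp
      then show ?thesis using \<Delta>\<tau>(1) by linarith
    qed
    finally show ?thesis using goal by (simp add: R_def)
  next
    case False
    define v where "v = t - l"
    have v: "1 \<le> v" "t \<le> 2 * v" using False l by (auto simp: v_def)
    \<comment> \<open>For x^2 \<ge> 1 / \<tau> both values of \<open>hinge1\<close> are small by
      \<open>hinge1_le_hinge2\<close> and the decay of \<open>normal_hinge\<close>. For smaller x
      the square-root bound is used, and x^2 < 1 / \<tau> turns the AM-GM term x^2 \<Delta> / \<tau>
      into \<Delta> / \<tau>^2.\<close>
    have far: "x * \<bar>hinge1 M ?T x - hinge1 ?G ?i x\<bar> \<le> 12 * \<tau> + \<Delta> / \<tau>\<^sup>2" if x: "1 \<le> x" for x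
    proof (cases "1 / \<tau> \<le> x\<^sup>2")
      case True
      have N: "normal_hinge (x / 2) \<le> 12 * \<tau>"
      proof -
        have "normal_hinge (x / 2) \<le> 3 / (x / 2)\<^sup>2" using x by (intro normal_hinge_le) auto
        also have "\<dots> = 12 / x\<^sup>2" by (simp add: power_divide)
        also have "\<dots> \<le> 12 * \<tau>" using True \<tau> x by (simp add: field_simps)
        finally show ?thesis .
      qed
      have "x * hinge1 M ?T x \<le> hinge2 M ?T (x / 2)"
        using hinge1_le_hinge2[OF T, of x] x by simp
      also have "\<dots> \<le> 12 * \<tau> + \<Delta>" using N \<Delta>(3)[of "x / 2"] by linarith
      finally have 1: "x * hinge1 M ?T x \<le> 12 * \<tau> + \<Delta>" .
      have 2: "x * hinge1 ?G ?i x \<le> 12 * \<tau>"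
        using std_normal.hinge1_le_hinge2[OF G(2,3), of x] x N by (simp add: std_normal_hinge2)
      have "0 \<le> hinge1 M ?T x" "0 \<le> hinge1 ?G ?i x"
        by (auto intro!: Bochner_Integration.integral_nonneg)
      then have "0 \<le> x * hinge1 M ?T x" "0 \<le> x * hinge1 ?G ?i x"
        using x by auto
      then have "\<bar>x * hinge1 M ?T x - x * hinge1 ?G ?i x\<bar> \<le> 12 * \<tau> + \<Delta>"
        using 1 2 \<Delta>(1) by linarith
      moreover have "\<bar>x * hinge1 M ?T x - x * hinge1 ?G ?i x\<bar> = x * \<bar>hinge1 M ?T x - hinge1 ?G ?i x\<bar>"
        using x by (simp add: right_diff_distrib[symmetric] abs_mult)
      ultimately show ?thesis using \<Delta>\<tau> by linarith
    next
      case False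
      have "x * \<bar>hinge1 M ?T x - hinge1 ?G ?i x\<bar> \<le> x * (2 * sqrt \<Delta>)"
        using x kT by (intro mult_left_mono) auto
      also have "\<dots> \<le> \<tau> + x\<^sup>2 * \<Delta> / \<tau>"
      proof -
        have "0 \<le> (\<tau> - x * sqrt \<Delta>)\<^sup>2 / \<tau>" using \<tau> by simp
        also have "\<dots> = \<tau> - x * (2 * sqrt \<Delta>) + x\<^sup>2 * \<Delta> / \<tau>"
          using \<tau> \<Delta>(1) by (simp add: power2_diff power_mult_distrib field_simps power2_eq_square)
        finally show ?thesis by linarith
      qed
      also have "x\<^sup>2 * \<Delta> / \<tau> \<le> (1 / \<tau>) * \<Delta> / \<tau>"
        using False \<tau> \<Delta>(1) by (intro divide_right_mono mult_right_mono) auto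
      also have "(1 / \<tau>) * \<Delta> / \<tau> = \<Delta> / \<tau>\<^sup>2" by (simp add: power2_eq_square)
      finally show ?thesis using \<tau> by linarith
    qed
    \<comment> \<open>The point \<open>l - t\<close> lies far to the left; after reflection to
      \<open>v = t - l\<close> the linear parts of both laws cancel.\<close>
    have "\<bar>hinge1 M S (l - t) - hinge1 ?G ?i (l - t)\<bar> = \<bar>hinge1 M ?T v - hinge1 ?G ?i v\<bar>"
    proof -
      have "hinge1 ?G (\<lambda>x. - x) v = hinge1 ?G ?i v"
        using std_normal_reflect[of "\<lambda>x. max (x - v) 0"] by simp
      then show ?thesis
        using hinge1_reflect[OF S mean, of "l - t"]
          std_normal.hinge1_reflect[OF G(2,3) std_normal_mean, of "l - t"] by (simp add: v_def)
    qed
    then have "2 * t * \<bar>hinge1 M S (l - t) - hinge1 ?G ?i (l - t)\<bar>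
        \<le> 4 * (v * \<bar>hinge1 M ?T v - hinge1 ?G ?i v\<bar>)"
      using mult_right_mono[OF v(2), of "\<bar>hinge1 M ?T v - hinge1 ?G ?i v\<bar>"] by simp
    also have "\<dots> \<le> 4 * (12 * \<tau> + \<Delta> / \<tau>\<^sup>2)"
      using far[OF v(1)] by simp
    finally have a: "2 * t * \<bar>hinge1 M S (l - t) - hinge1 ?G ?i (l - t)\<bar> \<le> 4 * (12 * \<tau> + \<Delta> / \<tau>\<^sup>2)" .
    have "t * \<bar>hinge1 M ?T (l + t) - hinge1 ?G ?i (l + t)\<bar>
        \<le> (l + t) * \<bar>hinge1 M ?T (l + t) - hinge1 ?G ?i (l + t)\<bar>"
      using l by (intro mult_right_mono) auto
    also have "\<dots> \<le> 12 * \<tau> + \<Delta> / \<tau>\<^sup>2"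
      using False l t by (intro far) auto
    finally have b: "2 * t * \<bar>hinge1 M ?T (l + t) - hinge1 ?G ?i (l + t)\<bar> \<le> 2 * (12 * \<tau> + \<Delta> / \<tau>\<^sup>2)"
      by simp
    have "thr_risk M S l t - R \<le> 72 * \<tau> + 8 * (\<Delta> / \<tau>\<^sup>2)"
      using D a b \<Delta>\<tau> by simp
    moreover have "72 * \<tau> \<le> 72 / p * \<tau> * R"
    proof -
      have "1\<^sup>2 \<le> (min t (l + 1))\<^sup>2" using False l by (intro power_mono) auto
      then have "p * 1 \<le> p * (min t (l + 1))\<^sup>2" using p by (intro mult_left_mono) auto
      then have "p \<le> R" using RL by linarith
      then have "72 * \<tau> * p \<le> 72 * \<tau> * R" using \<tau> by (intro mult_left_mono) auto
      then show ?thesis using p by (simp add: field_simps)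
    qed
    moreover have "8 * (\<Delta> / \<tau>\<^sup>2) \<le> 18 * (\<Delta> / \<tau>\<^sup>2)"
      using \<Delta>(1) by (intro mult_right_mono) auto
    ultimately have "thr_risk M S l t - R \<le> 72 / p * \<tau> * R + 18 * (\<Delta> / \<tau>\<^sup>2)" by linarith
    then show ?thesis using goal by (simp add: R_def)
  qed
qed

text \<open>A negative signal under \<open>S\<close> has the risk of the positive signal
  \<open>- t\<close> under \<open>- S\<close>. The assumptions and the Gaussian risk are invariant
  under this change.\<close>

lemma thr_risk_normal_approx:
  assumes "prob_space M" "S \<in> borel_measurable M" "integrable M (\<lambda>\<omega>. (S \<omega>)\<^sup>2)"
    and "(\<integral>\<omega>. S \<omega> \<partial>M) = 0"
    and "0 < \<Delta>" "\<And>u. \<bar>hinge2 M S u - normal_hinge u\<bar> \<le> \<Delta>"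
      "\<And>u. \<bar>hinge2 M (\<lambda>\<omega>. - S \<omega>) u - normal_hinge u\<bar> \<le> \<Delta>"
    and "0 < \<tau>" "\<tau> \<le> 1" "0 < l"
  shows "thr_risk M S l t \<le> (1 + risk_const * \<tau>) * normal_risk l t + risk_const * \<Delta> / \<tau>\<^sup>2"
proof (cases "0 \<le> t")
  case True
  with assms show ?thesis by (intro thr_risk_normal_approx_nonneg) auto
next
  case False
  then have "thr_risk M (\<lambda>\<omega>. - S \<omega>) l (- t)
      \<le> (1 + risk_const * \<tau>) * normal_risk l (- t) + risk_const * \<Delta> / \<tau>\<^sup>2"
    using assms by (intro thr_risk_normal_approx_nonneg) auto
  from this[unfolded normal_risk_uminus, unfolded thr_risk_uminus] show ?thesis
    by simp
qed

text \<open>An infinite threshold is not admissible, so discarding a coefficient is imitated by a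
  finite one. \<open>Y n\<close> bounds the thresholded value for all |t| \<le> B simultaneously,
  and dominated convergence, with a majorant from the second moment, makes its contribution
  small.\<close>

lemma (in prob_space) thr_risk_large_threshold:
  fixes S :: "'a \<Rightarrow> real"
  assumes S [measurable]: "random_variable borel S" and sq: "integrable M (\<lambda>\<omega>. (S \<omega>)\<^sup>2)" and "0 < \<eta>"
  obtains l where "0 < l" "\<And>t. \<bar>t\<bar> \<le> B \<Longrightarrow> thr_risk M S l t \<le> t\<^sup>2 + \<eta>"
proof -
  define Y where "Y n \<omega> = max (\<bar>S \<omega>\<bar> + \<bar>B\<bar> - real n) 0" for n \<omega>
  have [measurable]: "random_variable borel (Y n)" for n
    unfolding Y_def by measurable
  have dom: "integrable M (\<lambda>\<omega>. 2 * \<bar>B\<bar> * (\<bar>S \<omega>\<bar> + \<bar>B\<bar>) + (\<bar>S \<omega>\<bar> + \<bar>B\<bar>)\<^sup>2)"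
  proof (intro Bochner_Integration.integrable_add integrable_mult_right)
    show "integrable M (\<lambda>\<omega>. \<bar>S \<omega>\<bar>)"
      by (rule integrable_abs[OF square_integrable_imp_integrable[OF S sq]])
    show "integrable M (\<lambda>\<omega>. (\<bar>S \<omega>\<bar> + \<bar>B\<bar>)\<^sup>2)"
      by (rule square_integrable_add) (use sq in auto)
  qed auto
  have bound: "norm (2 * \<bar>B\<bar> * Y n \<omega> + (Y n \<omega>)\<^sup>2) \<le> 2 * \<bar>B\<bar> * (\<bar>S \<omega>\<bar> + \<bar>B\<bar>) + (\<bar>S \<omega>\<bar> + \<bar>B\<bar>)\<^sup>2"
    for n \<omega>
  proof -
    have "0 \<le> Y n \<omega>" "Y n \<omega> \<le> \<bar>S \<omega>\<bar> + \<bar>B\<bar>" by (auto simp: Y_def)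
    then show ?thesis by (auto intro!: add_mono mult_left_mono power_mono)
  qed
  have "(\<lambda>n. \<integral>\<omega>. 2 * \<bar>B\<bar> * Y n \<omega> + (Y n \<omega>)\<^sup>2 \<partial>M) \<longlonglongrightarrow> (\<integral>\<omega>. 0 \<partial>M)"
  proof (rule integral_dominated_convergence[OF _ _ dom])
    show "AE \<omega> in M. (\<lambda>n. 2 * \<bar>B\<bar> * Y n \<omega> + (Y n \<omega>)\<^sup>2) \<longlonglongrightarrow> 0"
    proof (rule AE_I2)
      fix \<omega>
      have "\<forall>\<^sub>F n in sequentially. Y n \<omega> = 0"
        using eventually_ge_at_top[of "nat \<lceil>\<bar>S \<omega>\<bar> + \<bar>B\<bar>\<rceil>"]
        by eventually_elim (auto simp: Y_def max_def nat_le_iff ceiling_le_iff)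
      then show "(\<lambda>n. 2 * \<bar>B\<bar> * Y n \<omega> + (Y n \<omega>)\<^sup>2) \<longlonglongrightarrow> 0"
        by (intro tendsto_eventually) (auto elim: eventually_mono)
    qed
    show "AE \<omega> in M. norm (2 * \<bar>B\<bar> * Y n \<omega> + (Y n \<omega>)\<^sup>2)
        \<le> 2 * \<bar>B\<bar> * (\<bar>S \<omega>\<bar> + \<bar>B\<bar>) + (\<bar>S \<omega>\<bar> + \<bar>B\<bar>)\<^sup>2" for n
      using bound by simp
  qed auto
  then have "\<forall>\<^sub>F n in sequentially. (\<integral>\<omega>. 2 * \<bar>B\<bar> * Y n \<omega> + (Y n \<omega>)\<^sup>2 \<partial>M) < \<eta>"
    using \<open>0 < \<eta>\<close> by (auto intro: order_tendstoD)
  then have "\<forall>\<^sub>F n in sequentially. (\<integral>\<omega>. 2 * \<bar>B\<bar> * Y n \<omega> + (Y n \<omega>)\<^sup>2 \<partial>M) < \<eta> \<and> 0 < n"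
    using eventually_gt_at_top by (rule eventually_conj)
  then obtain n where n: "(\<integral>\<omega>. 2 * \<bar>B\<bar> * Y n \<omega> + (Y n \<omega>)\<^sup>2 \<partial>M) < \<eta>" "0 < n"
    by (auto simp: eventually_sequentially)
  have Yint: "integrable M (\<lambda>\<omega>. 2 * \<bar>B\<bar> * Y n \<omega> + (Y n \<omega>)\<^sup>2)"
  proof (rule Bochner_Integration.integrable_bound[OF dom])
    show "AE \<omega> in M. norm (2 * \<bar>B\<bar> * Y n \<omega> + (Y n \<omega>)\<^sup>2)
        \<le> norm (2 * \<bar>B\<bar> * (\<bar>S \<omega>\<bar> + \<bar>B\<bar>) + (\<bar>S \<omega>\<bar> + \<bar>B\<bar>)\<^sup>2)"
      by (rule AE_I2, rule order_trans[OF bound]) simp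
  qed simp
  show thesis
  proof (rule that[of "real n"])
    show "0 < real n" using n by simp
    fix t assume t: "\<bar>t\<bar> \<le> B"
    have "thr_risk M S (real n) t \<le> (\<integral>\<omega>. t\<^sup>2 + (2 * \<bar>B\<bar> * Y n \<omega> + (Y n \<omega>)\<^sup>2) \<partial>M)"
      unfolding thr_risk_def
    proof (rule integral_mono)
      show "integrable M (\<lambda>\<omega>. (soft_threshold (real n) (t + S \<omega>) - t)\<^sup>2)"
        using n by (intro thr_risk_integrable S sq) auto
      show "integrable M (\<lambda>\<omega>. t\<^sup>2 + (2 * \<bar>B\<bar> * Y n \<omega> + (Y n \<omega>)\<^sup>2))"
        using Yint by auto
      fix \<omega>
      define T where "T = soft_threshold (real n) (t + S \<omega>)"
      have T: "\<bar>T\<bar> \<le> Y n \<omega>"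
        using t by (auto simp: T_def soft_threshold_def Y_def abs_mult sgn_if max_def)
      have "(T - t)\<^sup>2 = t\<^sup>2 + (- 2 * t * T + T\<^sup>2)" by (simp add: power2_diff)
      also have "- 2 * t * T \<le> 2 * (\<bar>t\<bar> * \<bar>T\<bar>)"
        using abs_ge_minus_self[of "t * T"] unfolding abs_mult by linarith
      also have "\<bar>t\<bar> * \<bar>T\<bar> \<le> \<bar>B\<bar> * Y n \<omega>" using t T by (intro mult_mono) auto
      also have "T\<^sup>2 \<le> (Y n \<omega>)\<^sup>2" using T by (metis abs_le_square_iff abs_of_nonneg abs_ge_zero order_trans)
      finally show "(soft_threshold (real n) (t + S \<omega>) - t)\<^sup>2 \<le> t\<^sup>2 + (2 * \<bar>B\<bar> * Y n \<omega> + (Y n \<omega>)\<^sup>2)"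
        by (simp add: T_def mult_ac)
    qed
    also have "\<dots> = t\<^sup>2 + (\<integral>\<omega>. 2 * \<bar>B\<bar> * Y n \<omega> + (Y n \<omega>)\<^sup>2 \<partial>M)"
      using Yint by (subst Bochner_Integration.integral_add) (auto simp: prob_space)
    also have "\<dots> \<le> t\<^sup>2 + \<eta>" using n by simp
    finally show "thr_risk M S (real n) t \<le> t\<^sup>2 + \<eta>" .
  qed
qed

section \<open>Matrix of the discrete wavelet transform\<close>

lemma L2_on_mult_integrable:
  assumes "L2_on D f" "L2_on D g"
  shows "integrable (lebesgue_on D) (\<lambda>x. f x * g x)"
  using assms unfolding L2_on_def by (intro integrable_mult_of_square_integrable) auto

lemma L2_on_add: "L2_on D f \<Longrightarrow> L2_on D g \<Longrightarrow> L2_on D (\<lambda>x. f x + g x)"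
  using L2_on_mult_integrable[of D f g] unfolding L2_on_def power2_sum
  by (auto simp: mult.assoc)

lemma L2_on_cmult: "L2_on D f \<Longrightarrow> L2_on D (\<lambda>x. c * f x)"
  unfolding L2_on_def power_mult_distrib by auto

lemma L2_on_diff: "L2_on D f \<Longrightarrow> L2_on D g \<Longrightarrow> L2_on D (\<lambda>x. f x - g x)"
  using L2_on_add[of D f "\<lambda>x. (- 1) * g x"] L2_on_cmult[of D g "- 1"] by simp

lemma L2_on_sum:
  assumes "finite I" "\<And>i. i \<in> I \<Longrightarrow> L2_on D (u i)"
  shows "L2_on D (\<lambda>x. \<Sum>i\<in>I. c i * u i x)"
  using assms
proof (induction I rule: finite_induct)
  case empty
  then show ?case by (simp add: L2_on_def)
next
  case (insert i I)
  then have "L2_on D (\<lambda>x. c i * u i x + (\<Sum>i\<in>I. c i * u i x))"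
    by (intro L2_on_add L2_on_cmult) auto
  with insert.hyps show ?case by simp
qed

lemma L2_inner_commute: "L2_inner D f g = L2_inner D g f"
  by (simp add: L2_inner_def mult.commute)

lemma L2_inner_sum:
  assumes "finite I" "\<And>i. i \<in> I \<Longrightarrow> L2_on D (u i)" "L2_on D g"
  shows "L2_inner D (\<lambda>x. \<Sum>i\<in>I. c i * u i x) g = (\<Sum>i\<in>I. c i * L2_inner D (u i) g)"
proof -
  have "L2_inner D (\<lambda>x. \<Sum>i\<in>I. c i * u i x) g = (\<integral>x. (\<Sum>i\<in>I. c i * (u i x * g x)) \<partial>lebesgue_on D)"
    unfolding L2_inner_def by (simp add: sum_distrib_right mult.assoc)
  also have "\<dots> = (\<Sum>i\<in>I. \<integral>x. c i * (u i x * g x) \<partial>lebesgue_on D)"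
    using assms by (intro Bochner_Integration.integral_sum integrable_mult_right L2_on_mult_integrable)
  finally show ?thesis by (simp add: L2_inner_def)
qed

lemma L2_inner_diff:
  assumes "L2_on D f" "L2_on D f'" "L2_on D g"
  shows "L2_inner D (\<lambda>x. f x - f' x) g = L2_inner D f g - L2_inner D f' g"
  unfolding L2_inner_def left_diff_distrib
  by (intro Bochner_Integration.integral_diff L2_on_mult_integrable assms)

text \<open>Completeness of Lebesgue measure. It is used because members of \<open>L2_span\<close>
  are linear combinations only almost everywhere.\<close>

lemma lebesgue_on_measurable_AE:
  fixes f g :: "real \<Rightarrow> real"
  assumes D: "D \<in> sets lebesgue" and f: "f \<in> borel_measurable (lebesgue_on D)"
    and ae: "AE x in lebesgue_on D. f x = g x"
  shows "g \<in> borel_measurable (lebesgue_on D)"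
proof -
  have "(\<lambda>x. if x \<in> D then f x else 0) \<in> borel_measurable lebesgue"
    using f by (simp add: borel_measurable_if[OF D])
  moreover have "AE x in lebesgue. (if x \<in> D then f x else 0) = (if x \<in> D then g x else 0)"
    using ae D by (subst (asm) AE_restrict_space_iff) (auto elim: eventually_mono)
  ultimately have "(\<lambda>x. if x \<in> D then g x else 0) \<in> borel_measurable lebesgue"
    by (rule borel_measurable_AE)
  then show ?thesis by (simp add: borel_measurable_if[OF D])
qed

lemma L2_inner_cong_AE:
  assumes "D \<in> sets lebesgue" "L2_on D f" "L2_on D g" "AE x in lebesgue_on D. g x = g' x"
  shows "L2_inner D f g = L2_inner D f g'"
proof -
  have [measurable]: "g' \<in> borel_measurable (lebesgue_on D)"
    using assms by (intro lebesgue_on_measurable_AE[OF assms(1) _ assms(4)]) (auto simp: L2_on_def)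
  have [measurable]: "f \<in> borel_measurable (lebesgue_on D)" "g \<in> borel_measurable (lebesgue_on D)"
    using assms by (auto simp: L2_on_def)
  show ?thesis
    unfolding L2_inner_def
  proof (rule integral_cong_AE)
    show "AE x in lebesgue_on D. f x * g x = f x * g' x"
      using assms(4) by eventually_elim simp
  qed auto
qed

lemma orthonormal_coefficients:
  assumes D: "D \<in> sets lebesgue" and u: "L2_orthonormal D I u" and I: "finite I'" "I' \<subseteq> I" "i \<in> I'"
    and f: "AE x in lebesgue_on D. f x = (\<Sum>i\<in>I'. c i * u i x)"
  shows "c i = L2_inner D (u i) f"
proof -
  have L: "L2_on D (u k)" if "k \<in> I'" for k
    using u I that by (auto simp: L2_orthonormal_def)
  have s: "L2_on D (\<lambda>x. \<Sum>i\<in>I'. c i * u i x)"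
    using I by (intro L2_on_sum L) auto
  have "L2_inner D (u i) f = L2_inner D (u i) (\<lambda>x. \<Sum>i\<in>I'. c i * u i x)"
    by (rule L2_inner_cong_AE[OF D L[OF I(3)] s, symmetric]) (use f in \<open>auto elim: eventually_mono\<close>)
  also have "\<dots> = L2_inner D (\<lambda>x. \<Sum>i\<in>I'. c i * u i x) (u i)"
    by (rule L2_inner_commute)
  also have "\<dots> = (\<Sum>k\<in>I'. c k * L2_inner D (u k) (u i))"
    using I by (intro L2_inner_sum L) auto
  also have "\<dots> = (\<Sum>k\<in>I'. if k = i then c k else 0)"
    using u I by (intro sum.cong) (auto simp: L2_orthonormal_def subset_iff)
  also have "\<dots> = c i" using I by simp
  finally show ?thesis ..
qed

lemma L2_span_base: "finite I \<Longrightarrow> k \<in> I \<Longrightarrow> u k \<in> L2_span D I u"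
  unfolding L2_span_def
  by (auto intro!: exI[of _ "\<lambda>l. if l = k then 1 else 0"] simp: if_distrib[of "\<lambda>c. c * _"] cong: if_cong)

lemma L2_span_cong_AE:
  assumes "f \<in> L2_span D I u" "AE x in lebesgue_on D. g x = f x"
  shows "g \<in> L2_span D I u"
proof -
  obtain c where "AE x in lebesgue_on D. f x = (\<Sum>i\<in>I. c i * u i x)"
    using assms(1) unfolding L2_span_def by blast
  with assms(2) have "AE x in lebesgue_on D. g x = (\<Sum>i\<in>I. c i * u i x)"
    by eventually_elim simp
  then show ?thesis unfolding L2_span_def by (intro CollectI exI)
qed

lemma L2_span_mono:
  assumes "finite J" "I \<subseteq> J"
  shows "L2_span D I u \<subseteq> L2_span D J u"
proof
  fix f assume "f \<in> L2_span D I u"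
  then obtain c where c: "AE x in lebesgue_on D. f x = (\<Sum>i\<in>I. c i * u i x)"
    unfolding L2_span_def by blast
  have "(\<Sum>i\<in>I. c i * u i x) = (\<Sum>i\<in>J. (if i \<in> I then c i else 0) * u i x)" for x
    using assms by (intro sum.mono_neutral_cong_left) auto
  then show "f \<in> L2_span D J u"
    using c unfolding L2_span_def by (intro CollectI exI[of _ "\<lambda>i. if i \<in> I then c i else 0"]) simp
qed

lemma L2_span_add:
  assumes "f \<in> L2_span D I u" "g \<in> L2_span D I u"
  shows "(\<lambda>x. f x + g x) \<in> L2_span D I u"
proof -
  obtain c d where "AE x in lebesgue_on D. f x = (\<Sum>i\<in>I. c i * u i x)"
    "AE x in lebesgue_on D. g x = (\<Sum>i\<in>I. d i * u i x)"
    using assms unfolding L2_span_def by blast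
  then have "AE x in lebesgue_on D. f x + g x = (\<Sum>i\<in>I. (c i + d i) * u i x)"
    by eventually_elim (simp add: distrib_right sum.distrib)
  then show ?thesis unfolding L2_span_def by (intro CollectI exI)
qed

lemma L2_span_cmult:
  assumes "f \<in> L2_span D I u"
  shows "(\<lambda>x. c * f x) \<in> L2_span D I u"
proof -
  obtain d where "AE x in lebesgue_on D. f x = (\<Sum>i\<in>I. d i * u i x)"
    using assms unfolding L2_span_def by blast
  then have "AE x in lebesgue_on D. c * f x = (\<Sum>i\<in>I. (c * d i) * u i x)"
    by eventually_elim (simp add: sum_distrib_left mult.assoc)
  then show ?thesis unfolding L2_span_def by (intro CollectI exI)
qed

lemma L2_span_sum:
  assumes "finite L" "\<And>l. l \<in> L \<Longrightarrow> f l \<in> L2_span D I u"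
  shows "(\<lambda>x. \<Sum>l\<in>L. c l * f l x) \<in> L2_span D I u"
  using assms
proof (induction L rule: finite_induct)
  case empty
  show ?case unfolding L2_span_def by (intro CollectI exI[of _ "\<lambda>_. 0"]) simp
next
  case (insert l L)
  then have "(\<lambda>x. c l * f l x + (\<Sum>l\<in>L. c l * f l x)) \<in> L2_span D I u"
    by (intro L2_span_add L2_span_cmult) auto
  with insert.hyps show ?case by simp
qed

section \<open>Wavelet indices and the transform as a matrix\<close>

lemma finite_wav_indices: "finite (wav_indices j0 h)"
proof -
  have "wav_indices j0 h \<subseteq> Scaling ` {1..2 ^ j0} \<union> (\<Union>j<h. Detail j ` {1..2 ^ j})"
    unfolding wav_indices_def by auto
  then show ?thesis by (rule finite_subset) auto
qed

lemma wav_indices_Suc: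
  "j0 \<le> h \<Longrightarrow> wav_indices j0 (Suc h) = wav_indices j0 h \<union> Detail h ` {1..2 ^ h}"
  unfolding wav_indices_def by (auto simp: less_Suc_eq)

lemma wav_indices_self: "wav_indices j0 j0 = Scaling ` {1..2 ^ j0}"
  unfolding wav_indices_def by auto

lemma wav_fun_Scaling: "wav_fun j0 \<Phi> \<Psi> (Scaling k) = \<Phi> j0 k"
  and wav_fun_Detail: "wav_fun j0 \<Phi> \<Psi> (Detail j k) = \<Psi> j k"
  by (auto simp: wav_fun_def)

text \<open>The matrix of \<open>dwt\<close>, by \<open>dwt_eq\<close>. Both bases being
  orthonormal, its entries are inner products, which avoids iterating scaling identities.\<close>

definition dwt_matrix ::
  "nat \<Rightarrow> (nat \<Rightarrow> nat \<Rightarrow> real \<Rightarrow> real) \<Rightarrow> (nat \<Rightarrow> nat \<Rightarrow> real \<Rightarrow> real) \<Rightarrow> nat \<Rightarrow> wav_index \<Rightarrow> nat \<Rightarrow> real" where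
  "dwt_matrix j0 \<Phi> \<Psi> h i k = L2_inner {0..1} (wav_fun j0 \<Phi> \<Psi> i) (\<Phi> h k)"

context
  fixes \<phi> \<psi> j0 \<Phi> \<Psi>
  assumes basis: "interval_wavelet_basis \<phi> \<psi> j0 \<Phi> \<Psi>"
begin

lemma
  shows scaling_orthonormal: "j0 \<le> j \<Longrightarrow> L2_orthonormal {0..1} {1..2 ^ j} (\<Phi> j)"
    and detail_orthonormal: "j0 \<le> j \<Longrightarrow> L2_orthonormal {0..1} {1..2 ^ j} (\<Psi> j)"
    and mr_space_Suc: "j0 \<le> j \<Longrightarrow> mr_space \<Phi> j \<subseteq> mr_space \<Phi> (Suc j)"
    and detail_space: "j0 \<le> j \<Longrightarrow> L2_span {0..1} {1..2 ^ j} (\<Psi> j) =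
        {f \<in> mr_space \<Phi> (Suc j). \<forall>g\<in>mr_space \<Phi> j. L2_inner {0..1} f g = 0}"
    and wav_orthonormal: "L2_orthonormal {0..1} (\<Union>h. wav_indices j0 h) (wav_fun j0 \<Phi> \<Psi>)"
  using basis unfolding interval_wavelet_basis_def L2_orthonormal_basis_def by auto

lemma mr_space_mono:
  assumes "j0 \<le> j" "j \<le> h"
  shows "mr_space \<Phi> j \<subseteq> mr_space \<Phi> h"
  using assms(2)
proof (induction h rule: dec_induct)
  case (step h)
  then show ?case using mr_space_Suc[of h] assms(1) by auto
qed simp

lemma scaling_L2: "j0 \<le> j \<Longrightarrow> k \<in> {1..2 ^ j} \<Longrightarrow> L2_on {0..1} (\<Phi> j k)"
  using scaling_orthonormal[of j] by (auto simp: L2_orthonormal_def)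

text \<open>What remains of a fine scaling function after projection onto the coarse space is
  orthogonal to that space, hence lies in the detail space.\<close>

lemma scaling_split:
  assumes j: "j0 \<le> j" and k: "k \<in> {1..2 ^ Suc j}"
  shows "\<exists>c d. AE x in lebesgue_on {0..1}. \<Phi> (Suc j) k x =
    (\<Sum>l\<in>{1..2 ^ j}. c l * \<Phi> j l x) + (\<Sum>l\<in>{1..2 ^ j}. d l * \<Psi> j l x)"
proof -
  define c where "c l = L2_inner {0..1} (\<Phi> (Suc j) k) (\<Phi> j l)" for l
  define f where "f x = \<Phi> (Suc j) k x - (\<Sum>l\<in>{1..2 ^ j}. c l * \<Phi> j l x)" for x
  have "\<Phi> j l \<in> mr_space \<Phi> (Suc j)" if "l \<in> {1..2 ^ j}" for l
    using mr_space_Suc[OF j] L2_span_base[of "{1..2 ^ j}" l "\<Phi> j" "{0..1}"] that unfolding mr_space_def by auto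
  then have "(\<lambda>x. \<Phi> (Suc j) k x + (\<Sum>l\<in>{1..2 ^ j}. (- c l) * \<Phi> j l x)) \<in> mr_space \<Phi> (Suc j)"
    using k unfolding mr_space_def by (intro L2_span_add L2_span_sum L2_span_base) auto
  then have fV: "f \<in> mr_space \<Phi> (Suc j)"
    by (simp add: f_def[abs_def] sum_negf)
  have fL: "L2_on {0..1} f"
    unfolding f_def[abs_def] using j k by (intro L2_on_diff L2_on_sum scaling_L2) auto
  have "L2_inner {0..1} f g = 0" if "g \<in> mr_space \<Phi> j" for g
  proof -
    obtain a where a: "AE x in lebesgue_on {0..1}. g x = (\<Sum>l\<in>{1..2 ^ j}. a l * \<Phi> j l x)"
      using \<open>g \<in> mr_space \<Phi> j\<close> unfolding mr_space_def L2_span_def by blast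
    have fl: "L2_inner {0..1} (\<Phi> j l) f = 0" if l: "l \<in> {1..2 ^ j}" for l
    proof -
      have "L2_inner {0..1} f (\<Phi> j l)
          = c l - L2_inner {0..1} (\<lambda>x. \<Sum>l\<in>{1..2 ^ j}. c l * \<Phi> j l x) (\<Phi> j l)"
        unfolding f_def[abs_def] c_def
        using j k l by (intro L2_inner_diff L2_on_sum scaling_L2) auto
      also have "L2_inner {0..1} (\<lambda>x. \<Sum>l\<in>{1..2 ^ j}. c l * \<Phi> j l x) (\<Phi> j l)
          = (\<Sum>r\<in>{1..2 ^ j}. c r * L2_inner {0..1} (\<Phi> j r) (\<Phi> j l))"
        using j l by (intro L2_inner_sum scaling_L2) auto
      also have "\<dots> = (\<Sum>r\<in>{1..2 ^ j}. if r = l then c r else 0)"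
        using scaling_orthonormal[OF j] l by (intro sum.cong) (auto simp: L2_orthonormal_def)
      also have "\<dots> = c l" using l by simp
      finally show ?thesis by (simp add: L2_inner_commute)
    qed
    have sL: "L2_on {0..1} (\<lambda>x. \<Sum>l\<in>{1..2 ^ j}. a l * \<Phi> j l x)"
      using j by (intro L2_on_sum scaling_L2) auto
    have "L2_inner {0..1} f g = L2_inner {0..1} f (\<lambda>x. \<Sum>l\<in>{1..2 ^ j}. a l * \<Phi> j l x)"
      by (rule L2_inner_cong_AE[OF _ fL sL, symmetric]) (use a in \<open>auto elim: eventually_mono\<close>)
    also have "\<dots> = (\<Sum>l\<in>{1..2 ^ j}. a l * L2_inner {0..1} (\<Phi> j l) f)"
      by (subst L2_inner_commute, rule L2_inner_sum) (use j fL in \<open>auto intro: scaling_L2\<close>)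
    also have "\<dots> = 0" using fl by simp
    finally show ?thesis .
  qed
  then have "f \<in> L2_span {0..1} {1..2 ^ j} (\<Psi> j)"
    using fV detail_space[OF j] by blast
  then obtain d where d: "AE x in lebesgue_on {0..1}. f x = (\<Sum>l\<in>{1..2 ^ j}. d l * \<Psi> j l x)"
    unfolding L2_span_def by blast
  show ?thesis
  proof (intro exI)
    show "AE x in lebesgue_on {0..1}. \<Phi> (Suc j) k x =
      (\<Sum>l\<in>{1..2 ^ j}. c l * \<Phi> j l x) + (\<Sum>l\<in>{1..2 ^ j}. d l * \<Psi> j l x)"
      using d by eventually_elim (simp add: f_def)
  qed
qed

text \<open>Iterates \<open>scaling_split\<close> down to the coarsest level. This is the existence
  half of the definite description in \<open>dwt\<close>.\<close>

lemma scaling_expansion: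
  assumes "j0 \<le> h" "k \<in> {1..2 ^ h}"
  shows "\<Phi> h k \<in> L2_span {0..1} (wav_indices j0 h) (wav_fun j0 \<Phi> \<Psi>)"
  using assms
proof (induction h arbitrary: k rule: dec_induct)
  case base
  then show ?case
    using L2_span_base[OF finite_wav_indices, of "Scaling k" j0 j0 "wav_fun j0 \<Phi> \<Psi>" "{0..1}"]
    by (simp add: wav_indices_self wav_fun_Scaling)
next
  case (step h)
  let ?V = "L2_span {0..1} (wav_indices j0 (Suc h)) (wav_fun j0 \<Phi> \<Psi>)"
  obtain c d where cd: "AE x in lebesgue_on {0..1}. \<Phi> (Suc h) k x =
    (\<Sum>l\<in>{1..2 ^ h}. c l * \<Phi> h l x) + (\<Sum>l\<in>{1..2 ^ h}. d l * \<Psi> h l x)"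
    using scaling_split[OF step.hyps(1) step.prems] by blast
  have "\<Phi> h l \<in> ?V" if "l \<in> {1..2 ^ h}" for l
    using step.IH[OF that] L2_span_mono[OF finite_wav_indices, of "wav_indices j0 h" j0 "Suc h"]
      wav_indices_Suc[OF step.hyps(1)] by blast
  moreover have "\<Psi> h l \<in> ?V" if "l \<in> {1..2 ^ h}" for l
    using L2_span_base[OF finite_wav_indices, of "Detail h l" j0 "Suc h" "wav_fun j0 \<Phi> \<Psi>"] that
      wav_indices_Suc[OF step.hyps(1)] by (simp add: wav_fun_Detail)
  ultimately show ?case
    by (intro L2_span_cong_AE[OF _ cd] L2_span_add L2_span_sum) auto
qed

lemma wav_fun_in_mr_space:
  assumes "j0 \<le> h" "i \<in> wav_indices j0 h"
  shows "wav_fun j0 \<Phi> \<Psi> i \<in> mr_space \<Phi> h"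
proof (cases i)
  case (Scaling k)
  then have "k \<in> {1..2 ^ j0}" using assms(2) by (auto simp: wav_indices_def)
  then have "\<Phi> j0 k \<in> mr_space \<Phi> j0" unfolding mr_space_def by (intro L2_span_base) auto
  then show ?thesis using mr_space_mono[of j0 h] assms(1) Scaling by (auto simp: wav_fun_def)
next
  case (Detail j k)
  then have *: "k \<in> {1..2 ^ j}" "j0 \<le> j" "j < h" using assms(2) by (auto simp: wav_indices_def)
  then have "\<Psi> j k \<in> L2_span {0..1} {1..2 ^ j} (\<Psi> j)" by (intro L2_span_base) auto
  then have "\<Psi> j k \<in> mr_space \<Phi> (Suc j)" using detail_space[OF *(2)] by blast
  then show ?thesis using mr_space_mono[of "Suc j" h] * Detail by (auto simp: wav_fun_def)
qed

text \<open>Parseval's identity: the wavelet lies in the space spanned by the finest scaling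
  functions and has norm 1, and its coefficients there are the row. It gives each noise coefficient
  unit variance after rescaling.\<close>

lemma dwt_matrix_row_norm:
  assumes "j0 \<le> h" "i \<in> wav_indices j0 h"
  shows "(\<Sum>k\<in>{1..2 ^ h}. (dwt_matrix j0 \<Phi> \<Psi> h i k)\<^sup>2) = 1"
proof -
  let ?w = "wav_fun j0 \<Phi> \<Psi> i"
  obtain b where b: "AE x in lebesgue_on {0..1}. ?w x = (\<Sum>k\<in>{1..2 ^ h}. b k * \<Phi> h k x)"
    using wav_fun_in_mr_space[OF assms] unfolding mr_space_def L2_span_def by blast
  have bk: "b k = dwt_matrix j0 \<Phi> \<Psi> h i k" if "k \<in> {1..2 ^ h}" for k
    unfolding dwt_matrix_def L2_inner_commute[of _ ?w]
    by (rule orthonormal_coefficients[OF _ scaling_orthonormal[OF assms(1)] _ _ that b]) auto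
  have wL: "L2_on {0..1} ?w" "L2_inner {0..1} ?w ?w = 1"
    using wav_orthonormal assms(2) unfolding L2_orthonormal_def by auto
  have sL: "L2_on {0..1} (\<lambda>x. \<Sum>k\<in>{1..2 ^ h}. b k * \<Phi> h k x)"
    using assms by (intro L2_on_sum scaling_L2) auto
  have "L2_inner {0..1} ?w ?w = L2_inner {0..1} ?w (\<lambda>x. \<Sum>k\<in>{1..2 ^ h}. b k * \<Phi> h k x)"
    by (rule L2_inner_cong_AE[OF _ wL(1) wL(1) b]) auto
  also have "\<dots> = (\<Sum>k\<in>{1..2 ^ h}. b k * L2_inner {0..1} (\<Phi> h k) ?w)"
    by (subst L2_inner_commute, rule L2_inner_sum) (use assms wL in \<open>auto intro: scaling_L2\<close>)
  also have "\<dots> = (\<Sum>k\<in>{1..2 ^ h}. (dwt_matrix j0 \<Phi> \<Psi> h i k)\<^sup>2)"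
    by (intro sum.cong) (auto simp: bk power2_eq_square dwt_matrix_def L2_inner_commute[of _ "\<Phi> h _"])
  finally show ?thesis by (simp only: wL(2))
qed

text \<open>Resolves the definite description: existence is \<open>scaling_expansion\<close>, and
  uniqueness holds because coefficients in an orthonormal family are inner products. Values outside
  \<open>wav_indices\<close> are fixed by extensionality.\<close>

lemma dwt_eq:
  assumes h: "j0 \<le> h" and i: "i \<in> wav_indices j0 h"
  shows "dwt j0 \<Phi> \<Psi> h x i = (\<Sum>k\<in>{1..2 ^ h}. dwt_matrix j0 \<Phi> \<Psi> h i k * x k)"
proof -
  let ?I = "wav_indices j0 h" and ?w = "wav_fun j0 \<Phi> \<Psi>" and ?A = "dwt_matrix j0 \<Phi> \<Psi> h"
  let ?f = "\<lambda>t. \<Sum>k\<in>{1..2 ^ h}. x k * \<Phi> h k t"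
  define \<theta> where "\<theta> = restrict (\<lambda>i. \<Sum>k\<in>{1..2 ^ h}. ?A i k * x k) ?I"
  have sub: "?I \<subseteq> (\<Union>h. wav_indices j0 h)" by auto
  note coeff = orthonormal_coefficients[OF _ wav_orthonormal finite_wav_indices sub]
  have "?f \<in> L2_span {0..1} ?I ?w"
    by (intro L2_span_sum scaling_expansion h) auto
  then obtain c where c: "AE t in lebesgue_on {0..1}. ?f t = (\<Sum>i\<in>?I. c i * ?w i t)"
    unfolding L2_span_def by blast
  have "c i = \<theta> i" if i: "i \<in> ?I" for i
  proof -
    have "c i = L2_inner {0..1} (?w i) ?f" by (rule coeff[OF _ i c]) auto
    also have "\<dots> = (\<Sum>k\<in>{1..2 ^ h}. x k * L2_inner {0..1} (\<Phi> h k) (?w i))"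
      using i h wav_orthonormal
      by (subst L2_inner_commute, intro L2_inner_sum scaling_L2) (auto simp: L2_orthonormal_def)
    also have "\<dots> = \<theta> i"
      using i by (simp add: \<theta>_def dwt_matrix_def L2_inner_commute[of _ "\<Phi> h _"] mult.commute)
    finally show ?thesis .
  qed
  then have "(\<Sum>i\<in>?I. c i * ?w i t) = (\<Sum>i\<in>?I. \<theta> i * ?w i t)" for t by (intro sum.cong) auto
  with c have \<theta>: "AE t in lebesgue_on {0..1}. ?f t = (\<Sum>i\<in>?I. \<theta> i * ?w i t)" by simp
  have uniq: "\<theta>' = \<theta>" if "\<theta>' \<in> ?I \<rightarrow>\<^sub>E UNIV"
    "AE t in lebesgue_on {0..1}. ?f t = (\<Sum>i\<in>?I. \<theta>' i * ?w i t)" for \<theta>'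
  proof (rule PiE_ext[OF that(1)])
    show "\<theta> \<in> ?I \<rightarrow>\<^sub>E UNIV" by (auto simp: \<theta>_def)
    fix i assume i: "i \<in> ?I"
    show "\<theta>' i = \<theta> i"
      using coeff[OF _ i that(2)] coeff[OF _ i \<theta>] by simp
  qed
  have "dwt j0 \<Phi> \<Psi> h x = \<theta>"
    unfolding dwt_def by (rule the_equality) (use \<theta> uniq in \<open>auto simp: \<theta>_def\<close>)
  with i show ?thesis by (simp add: \<theta>_def)
qed

section \<open>Size of the matrix entries\<close>

lemma wavelet_bounded: obtains B where "0 < B" "\<And>x. \<bar>\<psi> x\<bar> \<le> B"
proof -
  obtain \<beta> C where h: "0 < \<beta>" "\<And>x y. \<bar>\<psi> x - \<psi> y\<bar> \<le> C * \<bar>x - y\<bar> powr \<beta>"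
    using basis unfolding interval_wavelet_basis_def hoelder_continuous_def by blast
  obtain K where K: "\<And>x. \<bar>x\<bar> > K \<Longrightarrow> \<psi> x = 0"
    using basis unfolding interval_wavelet_basis_def compactly_supported_def by blast
  have C: "0 \<le> C" using h(2)[of 1 0] by auto
  have b: "\<bar>\<psi> x\<bar> \<le> C * (2 * \<bar>K\<bar> + 1) powr \<beta>" for x
  proof (cases "\<bar>x\<bar> > K")
    case True
    then show ?thesis using K C by simp
  next
    case False
    have "\<bar>\<psi> x\<bar> = \<bar>\<psi> x - \<psi> (\<bar>K\<bar> + 1)\<bar>" using K[of "\<bar>K\<bar> + 1"] by simp
    also have "\<dots> \<le> C * \<bar>x - (\<bar>K\<bar> + 1)\<bar> powr \<beta>" by (rule h(2))
    also have "\<dots> \<le> C * (2 * \<bar>K\<bar> + 1) powr \<beta>"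
      using False h(1) C by (intro mult_left_mono powr_mono2) auto
    finally show ?thesis .
  qed
  show thesis
    by (rule that[of "C * (2 * \<bar>K\<bar> + 1) powr \<beta> + 1"]) (use b C in \<open>auto intro: add_nonneg_pos add_increasing2\<close>)
qed

text \<open>Every scaling function combines a bounded number of dilated translates of \<phi>, each
  living on an interval of length of order 2^(-h). A union of intervals is needed because an edge
  function may have parts at both endpoints.\<close>

lemma scaling_support:
  obtains D0 where "0 < D0" "\<And>h k. j0 \<le> h \<Longrightarrow> k \<in> {1..2 ^ h} \<Longrightarrow>
    \<exists>E. E \<in> lmeasurable \<and> measure lebesgue E \<le> D0 / 2 ^ h \<and> (\<forall>x\<in>{0..1} - E. \<Phi> h k x = 0)"
proof -
  obtain K where K: "\<And>x. \<bar>x\<bar> > K \<Longrightarrow> \<phi> x = 0"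
    using basis unfolding interval_wavelet_basis_def compactly_supported_def by blast
  have "interval_adapted \<phi> \<phi> 0 j0 \<Phi>"
    using basis unfolding interval_wavelet_basis_def by simp
  then obtain N s S a b where S: "finite S" and \<Phi>0: "\<forall>j\<ge>j0. \<forall>k\<in>{1..2 ^ j}. \<forall>x\<in>{0..1}.
    \<Phi> j k x = (if N < k \<and> k \<le> 2 ^ j - N then dilate \<phi> (int j) (int k + s) x
              else let r = (if k \<le> N then int k else int k - 2 ^ j) in
                \<Sum>l\<in>S. a r l * dilate \<phi> (int (j + 0)) l x
                     + b r l * dilate \<phi> (int (j + 0)) (2 ^ (j + 0) + l) x)"
    unfolding interval_adapted_def by (elim exE conjE) (rule that)
  note \<Phi> = \<Phi>0[rule_format]
  define J where "J h c = {(of_int c - \<bar>K\<bar>) / 2 ^ h..(of_int c + \<bar>K\<bar>) / 2 ^ h}" for h :: nat and c :: int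
  have J: "J h c \<in> lmeasurable" "measure lebesgue (J h c) \<le> 2 * \<bar>K\<bar> / 2 ^ h" for h c
    unfolding J_def by (auto simp: divide_right_mono diff_divide_distrib[symmetric])
  have out: "dilate \<phi> (int h) c x = 0" if "x \<notin> J h c" for h c x
  proof -
    have "\<bar>2 ^ h * x - of_int c\<bar> > K"
      using that by (auto simp: J_def field_simps)
    then show ?thesis using K by (simp add: dilate_def)
  qed
  define D0 where "D0 = (1 + 2 * real (card S)) * (2 * \<bar>K\<bar>) + 1"
  show thesis
  proof (rule that[of D0])
    show "0 < D0" unfolding D0_def by (intro add_nonneg_pos mult_nonneg_nonneg) auto
    fix h k :: nat assume hk: "j0 \<le> h" "k \<in> {1..2 ^ h}"
    \<comment> \<open>Serves both branches at once: the interior translate and every translate that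
      an edge function may use at either endpoint.\<close>
    define C where "C = insert (int k + s) (S \<union> (\<lambda>l. 2 ^ h + l) ` S)"
    have C: "finite C" "card C \<le> 1 + 2 * card S"
    proof -
      have "card C \<le> Suc (card (S \<union> (\<lambda>l. 2 ^ h + l) ` S))"
        unfolding C_def by (rule card_insert_le_m1) auto
      also have "card (S \<union> (\<lambda>l. 2 ^ h + l) ` S) \<le> card S + card ((\<lambda>l. 2 ^ h + l) ` S)"
        by (rule card_Un_le)
      also have "card ((\<lambda>l. 2 ^ h + l) ` S) \<le> card S" using S by (rule card_image_le)
      finally show "card C \<le> 1 + 2 * card S" by simp
    qed (use S in \<open>auto simp: C_def\<close>)
    define E where "E = (\<Union>c\<in>C. J h c)"
    have "E \<in> lmeasurable" unfolding E_def using C J by (intro fmeasurable.finite_UN) auto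
    moreover have "measure lebesgue E \<le> D0 / 2 ^ h"
    proof -
      have "measure lebesgue E \<le> (\<Sum>c\<in>C. measure lebesgue (J h c))"
        unfolding E_def using C J by (intro measure_UNION_le) auto
      also have "\<dots> \<le> real (card C) * (2 * \<bar>K\<bar> / 2 ^ h)"
        by (rule sum_bounded_above) (rule J)
      also have "\<dots> \<le> (1 + 2 * real (card S)) * (2 * \<bar>K\<bar> / 2 ^ h)"
        using C(2) by (intro mult_right_mono) auto
      also have "\<dots> \<le> D0 / 2 ^ h"
        unfolding D0_def by (simp add: divide_right_mono add_divide_distrib)
      finally show ?thesis .
    qed
    moreover have "\<Phi> h k x = 0" if "x \<in> {0..1} - E" for x
    proof -
      have "dilate \<phi> (int h) c x = 0" if "c \<in> C" for c
        using out[of x h c] that \<open>x \<in> {0..1} - E\<close> unfolding E_def by blast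
      then have "dilate \<phi> (int h) (int k + s) x = 0" "\<And>l. l \<in> S \<Longrightarrow> dilate \<phi> (int h) l x = 0"
        "\<And>l. l \<in> S \<Longrightarrow> dilate \<phi> (int h) (2 ^ h + l) x = 0"
        unfolding C_def by auto
      then show ?thesis using \<Phi>[of h k x] hk that by (simp add: Let_def)
    qed
    ultimately show "\<exists>E. E \<in> lmeasurable \<and> measure lebesgue E \<le> D0 / 2 ^ h \<and> (\<forall>x\<in>{0..1} - E. \<Phi> h k x = 0)"
      by blast
  qed
qed

text \<open>Only finitely many wavelets per level are edge functions. The others are bounded by
  \<open>2\<^sup>j\<^sup>/\<^sup>2\<close> up to a constant; the scaling function need not be bounded.\<close>

lemma dwt_matrix_bound:
  obtains N C where "0 < C" "\<And>h j k l. j0 \<le> j \<Longrightarrow> j < h \<Longrightarrow> N < k \<Longrightarrow> k \<le> 2 ^ j - N \<Longrightarrow> l \<in> {1..2 ^ h} \<Longrightarrow>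
    (dwt_matrix j0 \<Phi> \<Psi> h (Detail j k) l)\<^sup>2 \<le> C * 2 ^ j / 2 ^ h"
proof -
  obtain B where B: "0 < B" "\<And>x. \<bar>\<psi> x\<bar> \<le> B" using wavelet_bounded by blast
  obtain D0 where D0: "0 < D0" and supp: "\<And>h k. j0 \<le> h \<Longrightarrow> k \<in> {1..2 ^ h} \<Longrightarrow>
    \<exists>E. E \<in> lmeasurable \<and> measure lebesgue E \<le> D0 / 2 ^ h \<and> (\<forall>x\<in>{0..1} - E. \<Phi> h k x = 0)"
    using scaling_support by blast
  have "interval_adapted \<phi> \<psi> 1 j0 \<Psi>"
    using basis unfolding interval_wavelet_basis_def by simp
  then obtain N s S a b where S: "finite S" and \<Psi>0: "\<forall>j\<ge>j0. \<forall>k\<in>{1..2 ^ j}. \<forall>x\<in>{0..1}.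
    \<Psi> j k x = (if N < k \<and> k \<le> 2 ^ j - N then dilate \<psi> (int j) (int k + s) x
              else let r = (if k \<le> N then int k else int k - 2 ^ j) in
                \<Sum>l\<in>S. a r l * dilate \<phi> (int (j + 1)) l x
                     + b r l * dilate \<phi> (int (j + 1)) (2 ^ (j + 1) + l) x)"
    unfolding interval_adapted_def by (elim exE conjE) (rule that)
  note \<Psi> = \<Psi>0[rule_format]
  show thesis
  proof (rule that[of "B\<^sup>2 * D0" N])
    show "0 < B\<^sup>2 * D0" using B D0 by simp
    fix h j k l :: nat
    assume *: "j0 \<le> j" "j < h" "N < k" "k \<le> 2 ^ j - N" and l: "l \<in> {1..2 ^ h}"
    have h: "j0 \<le> h" using * by simp
    obtain E where E: "E \<in> lmeasurable" "measure lebesgue E \<le> D0 / 2 ^ h"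
      "\<And>x. x \<in> {0..1} \<Longrightarrow> x \<notin> E \<Longrightarrow> \<Phi> h l x = 0"
      using supp[OF h l] by blast
    have \<Psi>b: "(\<Psi> j k x)\<^sup>2 \<le> B\<^sup>2 * 2 ^ j" if "x \<in> {0..1}" for x
    proof -
      have "(\<Psi> j k x)\<^sup>2 = 2 ^ j * (\<psi> (2 ^ j * x - of_int (int k + s)))\<^sup>2"
        using \<Psi>[of j k x] * that by (simp add: dilate_def power_mult_distrib)
      also have "(\<psi> (2 ^ j * x - of_int (int k + s)))\<^sup>2 \<le> B\<^sup>2"
        using B by (metis abs_le_square_iff abs_of_pos)
      finally show ?thesis by (simp add: mult.commute)
    qed
    \<comment> \<open>Cauchy-Schwarz: the wavelet squared is at most
      \<open>B\<^sup>2 * 2 ^ j\<close> on a set of measure at most \<open>D0 / 2 ^ h\<close>, and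
      the scaling function has norm 1, so \<open>Q\<close> bounds the squared inner product. It is
      carried out as AM-GM with weight \<open>t = sqrt Q\<close>, for which both halves are at most
      \<open>t / 2\<close>.\<close>
    define Q where "Q = B\<^sup>2 * 2 ^ j * (D0 / 2 ^ h)"
    have Q: "0 < Q" using B D0 by (simp add: Q_def)
    define t where "t = sqrt Q"
    have t: "0 < t" "t\<^sup>2 = Q" using Q by (auto simp: t_def)
    let ?D = "{0..1} :: real set"
    have LL: "L2_on ?D (\<Psi> j k)" "L2_on ?D (\<Phi> h l)" "L2_inner ?D (\<Phi> h l) (\<Phi> h l) = 1"
      using detail_orthonormal[of j] scaling_orthonormal[of h] * h l by (auto simp: L2_orthonormal_def)
    have E': "integrable (lebesgue_on ?D) (indicator E :: real \<Rightarrow> real)"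
      "(\<integral>x. indicator E x \<partial>lebesgue_on ?D) \<le> D0 / 2 ^ h"
    proof -
      have fin: "finite_measure (lebesgue_on ?D)"
        by (rule finite_measure_lebesgue_on) simp
      have m: "E \<inter> ?D \<in> sets (lebesgue_on ?D)"
        using E(1) by (auto simp: sets_restrict_space fmeasurableD)
      have e: "(\<integral>x. indicator E x \<partial>lebesgue_on ?D) = (\<integral>x. indicator (E \<inter> ?D) x \<partial>lebesgue_on ?D)"
        by (rule Bochner_Integration.integral_cong) (auto simp: indicator_def)
      have "integrable (lebesgue_on ?D) (indicator (E \<inter> ?D) :: real \<Rightarrow> real)"
        using m finite_measure.emeasure_finite[OF fin] by (simp add: less_top)
      then show "integrable (lebesgue_on ?D) (indicator E :: real \<Rightarrow> real)"
        by (rule Bochner_Integration.integrable_cong[THEN iffD1, rotated 2]) (auto simp: indicator_def)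
      have "(\<integral>x. indicator (E \<inter> ?D) x \<partial>lebesgue_on ?D) = measure (lebesgue_on ?D) (E \<inter> ?D)"
        using m by simp
      also have "\<dots> = measure lebesgue (E \<inter> ?D)"
        by (rule measure_restrict_space) auto
      also have "\<dots> \<le> measure lebesgue E"
        using E(1) by (intro measure_mono_fmeasurable) (auto simp: fmeasurableD)
      finally show "(\<integral>x. indicator E x \<partial>lebesgue_on ?D) \<le> D0 / 2 ^ h" using E(2) e by simp
    qed
    have "\<bar>dwt_matrix j0 \<Phi> \<Psi> h (Detail j k) l\<bar> = \<bar>\<integral>x. \<Psi> j k x * \<Phi> h l x \<partial>lebesgue_on ?D\<bar>"
      by (simp add: dwt_matrix_def wav_fun_def L2_inner_def)
    also have "\<dots> \<le> (\<integral>x. \<bar>\<Psi> j k x * \<Phi> h l x\<bar> \<partial>lebesgue_on ?D)"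
      by (rule integral_abs_bound)
    also have "\<dots> \<le> (\<integral>x. B\<^sup>2 * 2 ^ j / (2 * t) * indicator E x + t / 2 * (\<Phi> h l x * \<Phi> h l x) \<partial>lebesgue_on ?D)"
    proof (rule integral_mono)
      show "integrable (lebesgue_on ?D) (\<lambda>x. \<bar>\<Psi> j k x * \<Phi> h l x\<bar>)"
        by (intro integrable_abs L2_on_mult_integrable LL)
      show "integrable (lebesgue_on ?D) (\<lambda>x. B\<^sup>2 * 2 ^ j / (2 * t) * indicator E x + t / 2 * (\<Phi> h l x * \<Phi> h l x))"
        by (intro Bochner_Integration.integrable_add integrable_mult_right E'(1) L2_on_mult_integrable LL)
      fix x assume "x \<in> space (lebesgue_on ?D)"
      then have x: "x \<in> ?D" by simp
      show "\<bar>\<Psi> j k x * \<Phi> h l x\<bar> \<le> B\<^sup>2 * 2 ^ j / (2 * t) * indicator E x + t / 2 * (\<Phi> h l x * \<Phi> h l x)"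
      proof (cases "x \<in> E")
        case True
        define p where "p = \<bar>\<Psi> j k x\<bar>"
        define q where "q = \<bar>\<Phi> h l x\<bar>"
        have "0 \<le> (p - t * q)\<^sup>2 / (2 * t)" using t by simp
        also have "\<dots> = p\<^sup>2 / (2 * t) - p * q + t / 2 * (q * q)"
          using t by (simp add: power2_diff field_simps power2_eq_square)
        finally have "p * q \<le> p\<^sup>2 / (2 * t) + t / 2 * (q * q)" by simp
        also have "p\<^sup>2 / (2 * t) \<le> B\<^sup>2 * 2 ^ j / (2 * t)"
          using \<Psi>b[OF x] t by (intro divide_right_mono) (auto simp: p_def)
        finally show ?thesis using True by (simp add: p_def q_def abs_mult)
      next
        case False
        then show ?thesis using E(3)[OF x] by simp
      qed
    qed
    also have "\<dots> = B\<^sup>2 * 2 ^ j / (2 * t) * (\<integral>x. indicator E x \<partial>lebesgue_on ?D) + t / 2 * 1"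
      using E'(1) L2_on_mult_integrable[OF LL(2,2)] LL(3) by (simp add: L2_inner_def)
    also have "\<dots> \<le> B\<^sup>2 * 2 ^ j / (2 * t) * (D0 / 2 ^ h) + t / 2 * 1"
      using t by (intro add_right_mono mult_left_mono E'(2)) auto
    also have "\<dots> = Q / (2 * t) + t / 2" by (simp add: Q_def)
    also have "\<dots> = t" unfolding t(2)[symmetric] using t(1) by (simp add: power2_eq_square)
    finally have "\<bar>dwt_matrix j0 \<Phi> \<Psi> h (Detail j k) l\<bar>\<^sup>2 \<le> t\<^sup>2"
      by (intro power_mono) auto
    then show "(dwt_matrix j0 \<Phi> \<Psi> h (Detail j k) l)\<^sup>2 \<le> B\<^sup>2 * D0 * 2 ^ j / 2 ^ h"
      using t by (simp add: Q_def mult_ac)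
  qed
qed

end

section \<open>Risk in the wavelet domain\<close>

abbreviation coeff_noise ::
  "nat \<Rightarrow> (nat \<Rightarrow> nat \<Rightarrow> real \<Rightarrow> real) \<Rightarrow> (nat \<Rightarrow> nat \<Rightarrow> real \<Rightarrow> real) \<Rightarrow> nat \<Rightarrow>
    (nat \<Rightarrow> 'a \<Rightarrow> real) \<Rightarrow> wav_index \<Rightarrow> 'a \<Rightarrow> real" where
  "coeff_noise j0 \<Phi> \<Psi> h e i \<equiv> (\<lambda>\<omega>. \<Sum>k\<in>{1..2 ^ h}. dwt_matrix j0 \<Phi> \<Psi> h i k * e k \<omega>)"

text \<open>Noise of size 1 / \<surd>n is brought to unit variance: threshold and signal are
  multiplied by \<surd>n, the squared error is divided by n.\<close>

abbreviation scaled_risk :: "'a measure \<Rightarrow> ('a \<Rightarrow> real) \<Rightarrow> nat \<Rightarrow> real \<Rightarrow> real \<Rightarrow> real" where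
  "scaled_risk M S h l t \<equiv> thr_risk M S (sqrt (2 ^ h) * l) (sqrt (2 ^ h) * t) / 2 ^ h"

abbreviation scaled_normal_risk :: "nat \<Rightarrow> real \<Rightarrow> real \<Rightarrow> real" where
  "scaled_normal_risk \<equiv> scaled_risk std_normal_distribution (\<lambda>x. x)"

text \<open>The loss is a sum over coefficients, so each noise coefficient contributes through its
  own law alone, however dependent the coefficients are.\<close>

lemma soft_risk_eq:
  assumes M: "prob_space M" and basis: "interval_wavelet_basis \<phi> \<psi> j0 \<Phi> \<Psi>" and h: "j0 \<le> h"
    and e: "\<And>k. k \<in> {1..2 ^ h} \<Longrightarrow> e k \<in> borel_measurable M"
      "\<And>k. k \<in> {1..2 ^ h} \<Longrightarrow> integrable M (\<lambda>\<omega>. (e k \<omega>)\<^sup>2)"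
    and l: "\<And>i. i \<in> wav_indices j0 h \<Longrightarrow> 0 < l i"
  shows "soft_risk M e j0 \<Phi> \<Psi> h l \<theta> = ennreal (\<Sum>i\<in>wav_indices j0 h.
    scaled_risk M (coeff_noise j0 \<Phi> \<Psi> h e i) h (l i) (\<theta> i))"
proof -
  interpret prob_space M by fact
  let ?I = "wav_indices j0 h" and ?c = "sqrt (2 ^ h) :: real"
  define S where "S i \<omega> = (\<Sum>k\<in>{1..2 ^ h}. dwt_matrix j0 \<Phi> \<Psi> h i k * e k \<omega>)" for i \<omega>
  have S: "S i \<in> borel_measurable M" "integrable M (\<lambda>\<omega>. (S i \<omega>)\<^sup>2)" for i
    unfolding S_def using e by (auto intro!: borel_measurable_sum square_integrable_sum)
  have c: "0 < ?c" "?c\<^sup>2 = 2 ^ h" by auto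
  have sq: "(soft_threshold (l i) (\<theta> i + dwt j0 \<Phi> \<Psi> h (\<lambda>k. e k \<omega> / ?c) i) - \<theta> i)\<^sup>2
      = (soft_threshold (?c * l i) (?c * \<theta> i + S i \<omega>) - ?c * \<theta> i)\<^sup>2 / 2 ^ h"
    if i: "i \<in> ?I" for i \<omega>
  proof -
    have "dwt j0 \<Phi> \<Psi> h (\<lambda>k. e k \<omega> / ?c) i = S i \<omega> / ?c"
      by (simp add: dwt_eq[OF basis h i] S_def sum_divide_distrib)
    moreover have "soft_threshold (?c * l i) (?c * \<theta> i + S i \<omega>)
        = ?c * soft_threshold (l i) (\<theta> i + S i \<omega> / ?c)"
      using soft_threshold_scale[OF c(1), of "l i" "\<theta> i + S i \<omega> / ?c"] c(1)
      by (simp add: distrib_left)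
    moreover have "(?c * x - ?c * y)\<^sup>2 / 2 ^ h = (x - y)\<^sup>2" for x y :: real
      by (simp add: right_diff_distrib[symmetric] power_mult_distrib)
    ultimately show ?thesis by simp
  qed
  have int: "integrable M (\<lambda>\<omega>. (soft_threshold (?c * l i) (?c * \<theta> i + S i \<omega>) - ?c * \<theta> i)\<^sup>2 / 2 ^ h)"
    if "i \<in> ?I" for i
    using thr_risk_integrable[OF S, of "?c * l i"] l[OF that] by auto
  have "soft_risk M e j0 \<Phi> \<Psi> h l \<theta> = (\<integral>\<^sup>+\<omega>. ennreal (\<Sum>i\<in>?I.
      (soft_threshold (?c * l i) (?c * \<theta> i + S i \<omega>) - ?c * \<theta> i)\<^sup>2 / 2 ^ h) \<partial>M)"
    unfolding soft_risk_def Let_def by (intro nn_integral_cong arg_cong[of _ _ ennreal] sum.cong refl sq)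
  also have "\<dots> = ennreal (\<integral>\<omega>. (\<Sum>i\<in>?I.
      (soft_threshold (?c * l i) (?c * \<theta> i + S i \<omega>) - ?c * \<theta> i)\<^sup>2 / 2 ^ h) \<partial>M)"
    by (intro nn_integral_eq_integral Bochner_Integration.integrable_sum int) (auto intro!: sum_nonneg)
  also have "(\<integral>\<omega>. (\<Sum>i\<in>?I. (soft_threshold (?c * l i) (?c * \<theta> i + S i \<omega>) - ?c * \<theta> i)\<^sup>2 / 2 ^ h) \<partial>M)
      = (\<Sum>i\<in>?I. thr_risk M (S i) (?c * l i) (?c * \<theta> i) / 2 ^ h)"
    by (subst Bochner_Integration.integral_sum) (auto intro: int simp: thr_risk_def)
  finally show ?thesis by (simp add: S_def[abs_def])
qed

lemma thr_risk_gaussian_sum: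
  fixes g :: "nat \<Rightarrow> 'b \<Rightarrow> real"
  assumes "prob_space N" and I: "finite I"
    and indep: "prob_space.indep_vars N (\<lambda>_. borel) g I"
    and g: "\<And>i. i \<in> I \<Longrightarrow> distributed N lborel (g i) std_normal_density"
    and norm: "(\<Sum>i\<in>I. (a i)\<^sup>2) = 1"
  shows "thr_risk N (\<lambda>\<omega>. \<Sum>i\<in>I. a i * g i \<omega>) l t = normal_risk l t"
proof -
  interpret prob_space N by fact
  \<comment> \<open>Zero weights are dropped first, as a degenerate normal variable has no
    density.\<close>
  define I' where "I' = {i\<in>I. a i \<noteq> 0}"
  have I': "finite I'" "I' \<subseteq> I" using I by (auto simp: I'_def)
  have n': "(\<Sum>i\<in>I'. \<bar>a i\<bar>\<^sup>2) = 1"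
    unfolding norm[symmetric] power2_abs using I by (intro sum.mono_neutral_left) (auto simp: I'_def)
  have s: "(\<Sum>i\<in>I. a i * g i \<omega>) = (\<Sum>i\<in>I'. a i * g i \<omega>)" for \<omega>
    using I by (intro sum.mono_neutral_right) (auto simp: I'_def)
  have "distributed N lborel (\<lambda>\<omega>. \<Sum>i\<in>I'. a i * g i \<omega>)
      (normal_density (\<Sum>i\<in>I'. 0) (sqrt (\<Sum>i\<in>I'. \<bar>a i\<bar>\<^sup>2)))"
  proof (rule sum_indep_normal[OF I'(1)])
    show "I' \<noteq> {}" using n' by auto
    show "indep_vars (\<lambda>_. borel) (\<lambda>i \<omega>. a i * g i \<omega>) I'"
      by (rule indep_vars_compose2[OF indep_vars_subset[OF indep I'(2)]]) auto
    show "0 < \<bar>a i\<bar>" if "i \<in> I'" for i using that by (auto simp: I'_def)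
    show "distributed N lborel (\<lambda>\<omega>. a i * g i \<omega>) (normal_density 0 \<bar>a i\<bar>)" if "i \<in> I'" for i
      using normal_density_affine[OF g[of i], of "a i" 0] that by (auto simp: I'_def)
  qed
  then have d: "distributed N lborel (\<lambda>\<omega>. \<Sum>i\<in>I. a i * g i \<omega>) std_normal_density"
    unfolding s using n' by simp
  have "normal_risk l t = (\<integral>x. (soft_threshold l (t + x) - t)\<^sup>2 \<partial>distr N lborel (\<lambda>\<omega>. \<Sum>i\<in>I. a i * g i \<omega>))"
    unfolding thr_risk_def distributed_distr_eq_density[OF d] ..
  also have "\<dots> = thr_risk N (\<lambda>\<omega>. \<Sum>i\<in>I. a i * g i \<omega>) l t"
    unfolding thr_risk_def using distributed_measurable[OF d] by (subst integral_distr) auto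
  finally show ?thesis ..
qed

lemma std_normal_distributed_square_integrable:
  assumes "prob_space N" "distributed N lborel X std_normal_density"
  shows "X \<in> borel_measurable N" "integrable N (\<lambda>\<omega>. (X \<omega>)\<^sup>2)"
  using distributed_measurable[OF assms(2)] integrable_std_normal_moment[of 2]
    distributed_integrable[OF assms(2), of "\<lambda>x. x\<^sup>2"]
  by (auto simp: normal_density_nonneg)

text \<open>The form in which the noise enters Stein's method. Vanishing third moments encode its
  symmetry, and \<open>\<mu>\<close> bounds all fourth moments at once.\<close>

locale noise = prob_space M for M :: "'a measure" +
  fixes e :: "nat \<Rightarrow> 'a \<Rightarrow> real" and \<mu> :: real
  assumes indep: "indep_vars (\<lambda>_. borel) e {1..}"
    and fourth: "\<And>i. 1 \<le> i \<Longrightarrow> integrable M (\<lambda>\<omega>. e i \<omega> ^ 4)"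
    and moments: "\<And>i. 1 \<le> i \<Longrightarrow> expectation (e i) = 0"
      "\<And>i. 1 \<le> i \<Longrightarrow> expectation (\<lambda>\<omega>. (e i \<omega>)\<^sup>2) = 1"
      "\<And>i. 1 \<le> i \<Longrightarrow> expectation (\<lambda>\<omega>. e i \<omega> ^ 3) = 0"
      "\<And>i. 1 \<le> i \<Longrightarrow> expectation (\<lambda>\<omega>. e i \<omega> ^ 4) \<le> \<mu>"
begin

lemma noise_measurable: "1 \<le> i \<Longrightarrow> e i \<in> borel_measurable M"
  using indep by (auto simp: indep_vars_def)

lemma noise_square_integrable: "1 \<le> i \<Longrightarrow> integrable M (\<lambda>\<omega>. (e i \<omega>)\<^sup>2)"
  using integrable_power_le_4[OF noise_measurable fourth, of i 2] by simp

lemma fourth_moment_nonneg: "0 \<le> \<mu>"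
proof -
  have "0 \<le> expectation (\<lambda>\<omega>. e 1 \<omega> ^ 4)"
    by (rule Bochner_Integration.integral_nonneg) simp
  then show ?thesis using moments(4)[OF order_refl] by (rule order_trans)
qed

lemma row_square_integrable:
  fixes a :: "nat \<Rightarrow> real"
  shows "(\<lambda>\<omega>. \<Sum>k\<in>{1..n}. a k * e k \<omega>) \<in> borel_measurable M"
    and "integrable M (\<lambda>\<omega>. (\<Sum>k\<in>{1..n}. a k * e k \<omega>)\<^sup>2)"
proof -
  show "(\<lambda>\<omega>. \<Sum>k\<in>{1..n}. a k * e k \<omega>) \<in> borel_measurable M"
    by (intro borel_measurable_sum borel_measurable_times noise_measurable) auto
  show "integrable M (\<lambda>\<omega>. (\<Sum>k\<in>{1..n}. a k * e k \<omega>)\<^sup>2)"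
    by (rule square_integrable_sum) (auto intro: noise_measurable noise_square_integrable)
qed

text \<open>In a row of unit norm the fourth powers sum to at most the largest squared entry, so
  \<open>d\<close> controls the Stein error. The approximation for the negated noise comes from
  negating the weights.\<close>

lemma thr_risk_row_le:
  assumes norm: "(\<Sum>k\<in>{1..n}. (a k)\<^sup>2) = 1" and d: "\<And>k. k \<in> {1..n} \<Longrightarrow> (a k)\<^sup>2 \<le> d"
    and "0 < \<tau>" "\<tau> \<le> 1" "0 < l"
  shows "thr_risk M (\<lambda>\<omega>. \<Sum>k\<in>{1..n}. a k * e k \<omega>) l t
    \<le> (1 + risk_const * \<tau>) * normal_risk l t + risk_const * (2 * (1 + \<mu>) * d) / \<tau>\<^sup>2"
proof (rule thr_risk_normal_approx)
  have "d > 0"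
  proof (rule ccontr)
    assume "\<not> 0 < d"
    then have "(\<Sum>k\<in>{1..n}. (a k)\<^sup>2) \<le> (\<Sum>k\<in>{1..n}. 0)"
      using d by (intro sum_mono) (metis linorder_not_less order_trans)
    then show False using norm by simp
  qed
  then show "0 < 2 * (1 + \<mu>) * d" using fourth_moment_nonneg by simp
  have "(\<Sum>k\<in>{1..n}. a k ^ 4) \<le> (\<Sum>k\<in>{1..n}. d * (a k)\<^sup>2)"
  proof (rule sum_mono)
    fix k assume "k \<in> {1..n}"
    then have "(a k)\<^sup>2 * (a k)\<^sup>2 \<le> d * (a k)\<^sup>2" by (intro mult_right_mono d) auto
    then show "a k ^ 4 \<le> d * (a k)\<^sup>2" by (simp add: power_add[symmetric])
  qed
  also have "\<dots> = d" by (simp only: sum_distrib_left[symmetric] norm mult_1_right)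
  finally have "2 * (1 + \<mu>) * (\<Sum>k\<in>{1..n}. a k ^ 4) \<le> 2 * (1 + \<mu>) * d"
    using fourth_moment_nonneg by (intro mult_left_mono) auto
  note b4 = order_trans[OF _ this]
  have ind: "indep_vars (\<lambda>_. borel) e {1..n}"
    by (rule indep_vars_subset[OF indep]) auto
  show "\<bar>hinge2 M (\<lambda>\<omega>. \<Sum>k\<in>{1..n}. a k * e k \<omega>) u - normal_hinge u\<bar> \<le> 2 * (1 + \<mu>) * d" for u
    by (rule b4, rule hinge_normal_approx[OF _ ind]) (use norm fourth moments in auto)
  have "\<bar>hinge2 M (\<lambda>\<omega>. \<Sum>k\<in>{1..n}. (- a k) * e k \<omega>) u - normal_hinge u\<bar>
      \<le> 2 * (1 + \<mu>) * (\<Sum>k\<in>{1..n}. (- a k) ^ 4)" for u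
    by (rule hinge_normal_approx[OF _ ind]) (use norm fourth moments in auto)
  then show "\<bar>hinge2 M (\<lambda>\<omega>. - (\<Sum>k\<in>{1..n}. a k * e k \<omega>)) u - normal_hinge u\<bar> \<le> 2 * (1 + \<mu>) * d" for u
    by (intro b4) (simp add: sum_negf)
  have "integrable M (e k)" if "k \<in> {1..n}" for k
    using that square_integrable_imp_integrable[OF noise_measurable noise_square_integrable] by simp
  then show "(\<integral>\<omega>. (\<Sum>k\<in>{1..n}. a k * e k \<omega>) \<partial>M) = 0"
    using moments(1) by (subst Bochner_Integration.integral_sum) auto
qed (use assms row_square_integrable prob_space_axioms in auto)

end

section \<open>Besov balls\<close>

lemma lp_norm_nonneg: "finite I \<Longrightarrow> 0 \<le> lp_norm p I x"
  by (auto simp: lp_norm_def)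

lemma lp_norm_zero:
  assumes "\<And>i. i \<in> I \<Longrightarrow> x i = 0"
  shows "lp_norm p I x = 0"
proof -
  have "(\<lambda>i. \<bar>x i\<bar>) ` I \<subseteq> {0}" using assms by auto
  then have e: "insert 0 ((\<lambda>i. \<bar>x i\<bar>) ` I) = {0}" by auto
  show ?thesis unfolding lp_norm_def e using assms by simp
qed

lemma lp_norm_cong:
  assumes "\<And>i. i \<in> I \<Longrightarrow> x i = y i"
  shows "lp_norm p I x = lp_norm p I y"
proof -
  have "(\<lambda>i. \<bar>x i\<bar>) ` I = (\<lambda>i. \<bar>y i\<bar>) ` I" using assms by (intro image_cong) auto
  moreover have "(\<Sum>i\<in>I. \<bar>x i\<bar> powr r) = (\<Sum>i\<in>I. \<bar>y i\<bar> powr r)" for r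
    using assms by (intro sum.cong) auto
  ultimately show ?thesis by (simp only: lp_norm_def)
qed

lemma abs_le_lp_norm:
  assumes "finite I" "i \<in> I" "1 \<le> p"
  shows "\<bar>x i\<bar> \<le> lp_norm p I x"
proof (cases p)
  case (real r)
  then have r: "1 \<le> r" using assms by simp
  have "\<bar>x i\<bar> = (\<bar>x i\<bar> powr r) powr (1 / r)" using r by (simp add: powr_powr)
  also have "\<dots> \<le> (\<Sum>i\<in>I. \<bar>x i\<bar> powr r) powr (1 / r)"
    using r assms by (intro powr_mono2 member_le_sum) auto
  finally show ?thesis using real by (simp add: lp_norm_def)
next
  case PInf
  then show ?thesis using assms by (simp add: lp_norm_def)
qed (use assms in auto)

lemma lp_norm_single:
  assumes "finite I" "i \<in> I" "1 \<le> p" "\<And>j. j \<in> I \<Longrightarrow> j \<noteq> i \<Longrightarrow> x j = 0"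
  shows "lp_norm p I x = \<bar>x i\<bar>"
proof (cases p)
  case (real r)
  then have r: "1 \<le> r" using assms by simp
  have "(\<Sum>j\<in>I. \<bar>x j\<bar> powr r) = (\<Sum>j\<in>I. if j = i then \<bar>x i\<bar> powr r else 0)"
    using assms by (intro sum.cong) auto
  also have "\<dots> = \<bar>x i\<bar> powr r" using assms by simp
  finally show ?thesis using real r by (simp add: lp_norm_def powr_powr)
next
  case PInf
  have "Max (insert 0 ((\<lambda>i. \<bar>x i\<bar>) ` I)) = \<bar>x i\<bar>"
  proof (rule Max_eqI)
    fix y assume "y \<in> insert 0 ((\<lambda>i. \<bar>x i\<bar>) ` I)"
    then show "y \<le> \<bar>x i\<bar>" using assms(4) by fastforce
  qed (use assms in auto)
  then show ?thesis using PInf by (simp add: lp_norm_def)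
qed (use assms in auto)

lemma lp_norm_const:
  assumes "finite I" "I \<noteq> {}" "1 \<le> p"
  shows "lp_norm p I (\<lambda>_. v) = real (card I) powr real_of_ereal (1 / p) * \<bar>v\<bar>"
proof (cases p)
  case (real r)
  then have r: "1 \<le> r" using assms by simp
  have "real_of_ereal (1 / p) = 1 / r" using real r by (simp add: one_ereal_def)
  then show ?thesis using real r by (simp add: lp_norm_def powr_mult powr_powr)
next
  case PInf
  have "insert 0 ((\<lambda>i. \<bar>v\<bar>) ` I) = {0, \<bar>v\<bar>}" using assms by auto
  then show ?thesis using PInf assms by (simp add: lp_norm_def)
qed (use assms in auto)

text \<open>Hoelder's inequality, from Young's inequality with exponent r / 2 applied to each term
  after normalisation.\<close>

lemma sum_squares_le_lp_norm_2_le: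
  fixes x :: "'i \<Rightarrow> real"
  assumes I: "finite I" and r: "2 \<le> r"
  shows "(\<Sum>i\<in>I. (x i)\<^sup>2) \<le> real (card I) powr (1 - 2 / r) * ((\<Sum>i\<in>I. \<bar>x i\<bar> powr r) powr (1 / r))\<^sup>2"
proof -
  define T where "T = (\<Sum>i\<in>I. \<bar>x i\<bar> powr r)"
  define n where "n = real (card I)"
  have T0: "0 \<le> T" by (auto simp: T_def intro: sum_nonneg)
  show ?thesis
  proof (cases "T = 0")
    case True
    then have "\<forall>i\<in>I. \<bar>x i\<bar> powr r = 0"
      unfolding T_def using I by (subst (asm) sum_nonneg_eq_0_iff) auto
    then have "(\<Sum>i\<in>I. (x i)\<^sup>2) = 0" by simp
    then show ?thesis by simp
  next
    case False
    then have T: "0 < T" using T0 by simp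
    have n: "0 < n"
      using T I unfolding T_def n_def by (cases "I = {}") (auto simp: card_gt_0_iff)
    \<comment> \<open>Square of the r-th power mean. Dividing by it makes the mean of the r-th
      powers equal to 1, so that the terms in Young's inequality add up to exactly n.\<close>
    define c where "c = (T / n) powr (2 / r)"
    have c: "0 < c" using T n by (simp add: c_def)
    \<comment> \<open>For r = 2 the conjugate exponent of r / 2 would be infinite, hence the
      separate case.\<close>
    have young: "t \<le> t powr (r / 2) / (r / 2) + (1 - 1 / (r / 2))" if "0 \<le> t" for t :: real
    proof (cases "r = 2")
      case True
      then show ?thesis using that by simp
    next
      case False
      define q where "q = 1 / (1 - 1 / (r / 2))"
      have q: "1 < q" "1 / (r / 2) + 1 / q = 1" "1 / q = 1 - 1 / (r / 2)"
        using r False by (auto simp: q_def field_simps)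
      have "t * 1 \<le> t powr (r / 2) / (r / 2) + 1 powr q / q"
        using r False q that by (intro Youngs_inequality) auto
      then show ?thesis using q(3) by simp
    qed
    have "(\<Sum>i\<in>I. (x i)\<^sup>2 / c) \<le> (\<Sum>i\<in>I. \<bar>x i\<bar> powr r / (T / n) / (r / 2) + (1 - 1 / (r / 2)))"
    proof (rule sum_mono)
      fix i assume "i \<in> I"
      have "((x i)\<^sup>2) powr (r / 2) = \<bar>x i\<bar> powr r"
      proof (cases "x i = 0")
        case False
        then have e: "(x i)\<^sup>2 = \<bar>x i\<bar> powr 2" by (simp add: powr_numeral)
        show ?thesis unfolding e powr_powr by simp
      qed simp
      moreover have "c powr (r / 2) = T / n" using r T n by (simp add: c_def powr_powr)
      ultimately have "((x i)\<^sup>2 / c) powr (r / 2) = \<bar>x i\<bar> powr r / (T / n)"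
        using c by (simp add: powr_divide)
      then show "(x i)\<^sup>2 / c \<le> \<bar>x i\<bar> powr r / (T / n) / (r / 2) + (1 - 1 / (r / 2))"
        using young[of "(x i)\<^sup>2 / c"] c by simp
    qed
    also have "\<dots> = T / (T / n) / (r / 2) + n * (1 - 1 / (r / 2))"
      unfolding sum.distrib sum_divide_distrib[symmetric] T_def n_def by simp
    also have "\<dots> = n" using T n r by (simp add: field_simps)
    finally have "(\<Sum>i\<in>I. (x i)\<^sup>2) \<le> n * c"
      using c by (simp add: sum_divide_distrib[symmetric] field_simps)
    also have "n * c = n powr (1 - 2 / r) * (T powr (1 / r))\<^sup>2"
    proof -
      have "(T powr (1 / r))\<^sup>2 = T powr (2 / r)"
        using T by (simp add: powr_power)
      moreover have "n powr (1 - 2 / r) = n / n powr (2 / r)" using n by (simp add: powr_diff)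
      ultimately show ?thesis using T n by (simp add: c_def powr_divide)
    qed
    finally show ?thesis by (simp add: T_def n_def)
  qed
qed

text \<open>The l^r norm N dominates every entry, so |x|^2 = |x|^r |x|^(2 - r) is at most |x|^r N^(2
  - r).\<close>

lemma sum_squares_le_lp_norm_le_2:
  fixes x :: "'i \<Rightarrow> real"
  assumes I: "finite I" and r: "1 \<le> r" "r \<le> 2"
  shows "(\<Sum>i\<in>I. (x i)\<^sup>2) \<le> ((\<Sum>i\<in>I. \<bar>x i\<bar> powr r) powr (1 / r))\<^sup>2"
proof -
  define N where "N = (\<Sum>i\<in>I. \<bar>x i\<bar> powr r) powr (1 / r)"
  have N0: "0 \<le> N" by (simp add: N_def)
  have Nr: "N powr r = (\<Sum>i\<in>I. \<bar>x i\<bar> powr r)"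
    using r by (simp add: N_def powr_powr sum_nonneg)
  have le: "\<bar>x i\<bar> \<le> N" if "i \<in> I" for i
    using abs_le_lp_norm[OF I that, of "ereal r" x] r by (simp add: lp_norm_def N_def)
  have split: "y\<^sup>2 = y powr r * y powr (2 - r)" if "0 \<le> y" for y :: real
    using that by (cases "y = 0") (simp_all add: powr_add[symmetric] powr_numeral)
  have "(\<Sum>i\<in>I. (x i)\<^sup>2) \<le> (\<Sum>i\<in>I. \<bar>x i\<bar> powr r * N powr (2 - r))"
  proof (rule sum_mono)
    fix i assume "i \<in> I"
    have "(x i)\<^sup>2 = \<bar>x i\<bar> powr r * \<bar>x i\<bar> powr (2 - r)"
      using split[of "\<bar>x i\<bar>"] by simp
    also have "\<dots> \<le> \<bar>x i\<bar> powr r * N powr (2 - r)"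
      using le[OF \<open>i \<in> I\<close>] r by (intro mult_left_mono powr_mono2) auto
    finally show "(x i)\<^sup>2 \<le> \<bar>x i\<bar> powr r * N powr (2 - r)" .
  qed
  also have "\<dots> = N\<^sup>2"
    unfolding sum_distrib_right[symmetric] Nr[symmetric] using split[OF N0] by simp
  finally show ?thesis by (simp add: N_def)
qed

lemma sum_squares_le_lp_norm:
  fixes x :: "'i \<Rightarrow> real"
  assumes I: "finite I" "I \<noteq> {}" and p: "1 \<le> p"
  shows "(\<Sum>i\<in>I. (x i)\<^sup>2) \<le> real (card I) powr max 0 (1 - 2 * real_of_ereal (1 / p)) * (lp_norm p I x)\<^sup>2"
proof (cases p)
  case (real r)
  then have r: "1 \<le> r" using p by simp
  have c: "real_of_ereal (1 / p) = 1 / r" using real r by (simp add: one_ereal_def)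
  have n: "1 \<le> real (card I)" using I by (simp add: Suc_le_eq card_gt_0_iff)
  show ?thesis
  proof (cases "2 \<le> r")
    case True
    then have "max 0 (1 - 2 * (1 / r)) = 1 - 2 / r" by (simp add: field_simps)
    then show ?thesis
      unfolding c using sum_squares_le_lp_norm_2_le[OF I(1) True, of x] real by (simp add: lp_norm_def)
  next
    case False
    then have "max 0 (1 - 2 * (1 / r)) = 0" using r by (simp add: field_simps)
    then show ?thesis
      unfolding c using sum_squares_le_lp_norm_le_2[OF I(1) r, of x] False real n by (simp add: lp_norm_def)
  qed
next
  case PInf
  have "(\<Sum>i\<in>I. (x i)\<^sup>2) \<le> real (card I) * (lp_norm p I x)\<^sup>2"
  proof (rule sum_bounded_above)
    fix i assume "i \<in> I"
    then have "\<bar>x i\<bar>\<^sup>2 \<le> (lp_norm p I x)\<^sup>2" using abs_le_lp_norm[OF I(1) _ p] by (intro power_mono) auto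
    then show "(x i)\<^sup>2 \<le> (lp_norm p I x)\<^sup>2" by simp
  qed
  then show ?thesis using PInf I by (simp add: card_gt_0_iff)
qed (use p in auto)

text \<open>On level j the l^p norm is at most A 2^(- j s). Passing to l^2 is free for p \<le> 2,
  whereas for p \<ge> 2 it costs a power of the 2^j coefficients that turns the exponent s into m;
  hence the minimum.\<close>

lemma besov_level_sum_squares_le:
  assumes p: "1 \<le> p" and q: "1 \<le> q" and b: "besov_norm m p q j0 h \<theta> \<le> A" and j: "j0 \<le> j" "j < h"
  shows "(\<Sum>k\<in>{1..2 ^ j}. (\<theta> (Detail j k))\<^sup>2)
    \<le> A\<^sup>2 * 2 powr (- 2 * real j * min m (m + 1 / 2 - real_of_ereal (1 / p)))"
proof -
  define c where "c = real_of_ereal (1 / p)"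
  define s where "s = m + 1 / 2 - c"
  define \<nu> where "\<nu> = lp_norm p {1..2 ^ j} (\<lambda>k. \<theta> (Detail j k))"
  let ?y = "\<lambda>j. 2 powr (real j * s) * lp_norm p {1..2 ^ j} (\<lambda>k. \<theta> (Detail j k))"
  have \<nu>0: "0 \<le> \<nu>" unfolding \<nu>_def by (rule lp_norm_nonneg) simp
  have "2 powr (real j * s) * \<nu> \<le> \<bar>?y j\<bar>" by (simp add: \<nu>_def)
  also have "\<dots> \<le> lp_norm q {j0..<h} ?y"
    using j by (intro abs_le_lp_norm q) auto
  also have "\<dots> \<le> A"
    using b lp_norm_nonneg[of "{1..2 ^ j0}" p "\<lambda>k. \<theta> (Scaling k)"]
    unfolding besov_norm_def Let_def s_def c_def by simp
  finally have "2 powr (real j * s) * \<nu> \<le> A" .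
  then have "\<nu> \<le> A * 2 powr (- real j * s)"
    by (simp add: powr_minus field_simps)
  then have "\<nu>\<^sup>2 \<le> (A * 2 powr (- real j * s))\<^sup>2" using \<nu>0 by (intro power_mono) auto
  also have "\<dots> = A\<^sup>2 * 2 powr (- 2 * real j * s)"
    by (simp add: power_mult_distrib powr_power mult_ac)
  finally have \<nu>2: "\<nu>\<^sup>2 \<le> A\<^sup>2 * 2 powr (- 2 * real j * s)" .
  have "(\<Sum>k\<in>{1..2 ^ j}. (\<theta> (Detail j k))\<^sup>2) \<le> real (card {1..2 ^ j :: nat}) powr max 0 (1 - 2 * c) * \<nu>\<^sup>2"
    unfolding c_def \<nu>_def by (rule sum_squares_le_lp_norm[OF _ _ p]) auto
  also have "real (card {1..2 ^ j :: nat}) = 2 powr real j" by (simp add: powr_realpow)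
  also have "(2 powr real j) powr max 0 (1 - 2 * c) * \<nu>\<^sup>2
      \<le> (2 powr real j) powr max 0 (1 - 2 * c) * (A\<^sup>2 * 2 powr (- 2 * real j * s))"
    by (intro mult_left_mono \<nu>2) auto
  also have "\<dots> = A\<^sup>2 * 2 powr (real j * max 0 (1 - 2 * c) + - 2 * real j * s)"
    unfolding powr_powr powr_add by simp
  also have "real j * max 0 (1 - 2 * c) + - 2 * real j * s = - 2 * real j * min m s"
    unfolding s_def by (auto simp: max_def min_def algebra_simps)
  finally show ?thesis by (simp add: s_def c_def)
qed

text \<open>A constant vector of length 2^J has l^p norm 2^(J / p) |v|, which cancels the -1 / p in
  the weight. The norm of the least favourable signal is therefore the same for all p and q.\<close>

lemma besov_norm_level:
  assumes p: "1 \<le> p" and q: "1 \<le> q" and j: "j0 \<le> J" "J < h"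
    and \<theta>: "\<And>k. k \<in> {1..2 ^ j0} \<Longrightarrow> \<theta> (Scaling k) = 0"
      "\<And>k. k \<in> {1..2 ^ J} \<Longrightarrow> \<theta> (Detail J k) = v"
      "\<And>j k. j0 \<le> j \<Longrightarrow> j < h \<Longrightarrow> j \<noteq> J \<Longrightarrow> k \<in> {1..2 ^ j} \<Longrightarrow> \<theta> (Detail j k) = 0"
  shows "besov_norm m p q j0 h \<theta> = 2 powr (real J * (m + 1 / 2)) * \<bar>v\<bar>"
proof -
  define c where "c = real_of_ereal (1 / p)"
  define s where "s = m + 1 / 2 - c"
  let ?y = "\<lambda>j. 2 powr (real j * s) * lp_norm p {1..2 ^ j} (\<lambda>k. \<theta> (Detail j k))"
  have "lp_norm p {1..2 ^ J} (\<lambda>k. \<theta> (Detail J k)) = lp_norm p {1..2 ^ J :: nat} (\<lambda>_. v)"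
    using \<theta>(2) by (rule lp_norm_cong)
  also have "\<dots> = real (card {1..2 ^ J :: nat}) powr c * \<bar>v\<bar>"
    unfolding c_def by (rule lp_norm_const[OF _ _ p]) auto
  also have "real (card {1..2 ^ J :: nat}) = 2 powr real J" by (simp add: powr_realpow)
  finally have l: "lp_norm p {1..2 ^ J} (\<lambda>k. \<theta> (Detail J k)) = 2 powr (real J * c) * \<bar>v\<bar>"
    by (simp only: powr_powr)
  have "lp_norm q {j0..<h} ?y = \<bar>?y J\<bar>"
    by (rule lp_norm_single[OF _ _ q]) (use j \<theta>(3) in \<open>auto intro!: lp_norm_zero\<close>)
  also have "\<dots> = 2 powr (real J * s + real J * c) * \<bar>v\<bar>"
    unfolding l powr_add by (simp add: abs_mult)
  also have "real J * s + real J * c = real J * (m + 1 / 2)" by (simp add: s_def algebra_simps)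
  finally have "lp_norm q {j0..<h} ?y = 2 powr (real J * (m + 1 / 2)) * \<bar>v\<bar>" .
  moreover have "lp_norm p {1..2 ^ j0} (\<lambda>k. \<theta> (Scaling k)) = 0"
    by (rule lp_norm_zero) (use \<theta>(1) in auto)
  ultimately show ?thesis unfolding besov_norm_def Let_def s_def c_def by simp
qed

lemma sum_wav_indices:
  fixes F :: "wav_index \<Rightarrow> 'c::comm_monoid_add"
  shows "(\<Sum>i\<in>wav_indices j0 h. F i)
    = (\<Sum>k\<in>{1..2 ^ j0}. F (Scaling k)) + (\<Sum>j\<in>{j0..<h}. \<Sum>k\<in>{1..2 ^ j}. F (Detail j k))"
proof -
  let ?D = "(\<lambda>(j, k). Detail j k) ` (SIGMA j:{j0..<h}. {1..2 ^ j})"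
  have e: "wav_indices j0 h = Scaling ` {1..2 ^ j0} \<union> ?D"
    unfolding wav_indices_def by (auto simp: image_iff)
  have "(\<Sum>i\<in>wav_indices j0 h. F i) = (\<Sum>i\<in>Scaling ` {1..2 ^ j0}. F i) + (\<Sum>i\<in>?D. F i)"
    unfolding e by (rule sum.union_disjoint) auto
  also have "(\<Sum>i\<in>Scaling ` {1..2 ^ j0}. F i) = (\<Sum>k\<in>{1..2 ^ j0}. F (Scaling k))"
    by (subst sum.reindex) (auto simp: inj_on_def)
  also have "(\<Sum>i\<in>?D. F i) = (\<Sum>(j, k)\<in>(SIGMA j:{j0..<h}. {1..2 ^ j}). F (Detail j k))"
    by (subst sum.reindex) (auto simp: inj_on_def case_prod_beta)
  also have "\<dots> = (\<Sum>j\<in>{j0..<h}. \<Sum>k\<in>{1..2 ^ j}. F (Detail j k))"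
    by (subst sum.Sigma) auto
  finally show ?thesis .
qed

section \<open>Comparison of the minimax risks\<close>

lemma normal_soft_risk_eq:
  fixes g :: "nat \<Rightarrow> 'b \<Rightarrow> real"
  assumes N: "prob_space N" "prob_space.indep_vars N (\<lambda>_. borel) g {1..}"
      "\<And>i. 1 \<le> i \<Longrightarrow> distributed N lborel (g i) std_normal_density"
    and basis: "interval_wavelet_basis \<phi> \<psi> j0 \<Phi> \<Psi>" and h: "j0 \<le> h"
    and l: "\<And>i. i \<in> wav_indices j0 h \<Longrightarrow> 0 < l i"
  shows "soft_risk N g j0 \<Phi> \<Psi> h l \<theta> = ennreal (\<Sum>i\<in>wav_indices j0 h.
    scaled_normal_risk h (l i) (\<theta> i))"
proof -
  have i: "prob_space.indep_vars N (\<lambda>_. borel) g {1..2 ^ h}"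
    by (rule prob_space.indep_vars_subset[OF N(1,2)]) auto
  have "thr_risk N (coeff_noise j0 \<Phi> \<Psi> h g i) \<kappa> t = normal_risk \<kappa> t"
    if "i \<in> wav_indices j0 h" for i \<kappa> t
    by (rule thr_risk_gaussian_sum[OF N(1) _ i N(3) dwt_matrix_row_norm[OF basis h that]]) auto
  then show ?thesis
    by (subst soft_risk_eq[OF N(1) basis h])
      (auto intro!: std_normal_distributed_square_integrable[OF N(1) N(3)] l sum.cong)
qed

text \<open>The least favourable signal is constant on the level \<open>J\<close> with \<open>2\<^sup>J \<approx> n\<^bsup>1 / (2 m + 1)\<^esup>\<close>, where its
  coefficients have the order of the noise; whatever the threshold, they are estimated by a number
  \<open>\<le> 0\<close> with probability bounded from below.\<close>

lemma minimax_normal_risk_lower_bound: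
  fixes g :: "nat \<Rightarrow> 'b \<Rightarrow> real"
  assumes N: "prob_space N" "prob_space.indep_vars N (\<lambda>_. borel) g {1..}"
      "\<And>i. 1 \<le> i \<Longrightarrow> distributed N lborel (g i) std_normal_density"
    and basis: "interval_wavelet_basis \<phi> \<psi> j0 \<Phi> \<Psi>"
    and pq: "1 \<le> p" "1 \<le> q" and m: "0 < m" and A: "0 < A"
  obtains c where "0 < c" "\<forall>\<^sub>F h in sequentially.
    ennreal (c * 2 powr (real h / (2 * m + 1)) / 2 ^ h) \<le> minimax_soft_risk N g j0 \<Phi> \<Psi> m p q A h"
proof -
  \<comment> \<open>Upper bound for the rescaled coefficient \<open>t\<close>: rounding the level
    down to an integer enlarges \<open>t\<close> by at most the factor
    \<open>2 powr (m + 1 / 2)\<close>.\<close>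
  define A' where "A' = A * 2 powr (m + 1 / 2)"
  define P where "P = measure std_normal_distribution {..- A'}"
  have P: "0 < P" unfolding P_def by (rule std_normal_atMost_pos)
  \<comment> \<open>The 1/2 pays for the same rounding, since \<open>2 ^ J\<close> exceeds only half
    of \<open>2 powr x\<close>.\<close>
  show thesis
  proof (rule that[of "P * A\<^sup>2 / 2"])
    show "0 < P * A\<^sup>2 / 2" using P A by simp
    have "\<forall>\<^sub>F h in sequentially. real j0 \<le> real h / (2 * m + 1)"
      using m by real_asymp
    then have "\<forall>\<^sub>F h in sequentially. real j0 \<le> real h / (2 * m + 1) \<and> 0 < h"
      using eventually_gt_at_top[of 0] by eventually_elim auto
    then show "\<forall>\<^sub>F h in sequentially. ennreal (P * A\<^sup>2 / 2 * 2 powr (real h / (2 * m + 1)) / 2 ^ h)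
        \<le> minimax_soft_risk N g j0 \<Phi> \<Psi> m p q A h"
    proof eventually_elim
      case (elim h)
      define x where "x = real h / (2 * m + 1)"
      define J where "J = nat \<lfloor>x\<rfloor>"
      have x: "real j0 \<le> x" "0 \<le> x" "x < real h"
        using elim m by (auto simp: x_def divide_simps)
      have J: "real J \<le> x" "x < real J + 1"
        unfolding J_def using x(2) by (auto simp: floor_less_iff)
      have J': "j0 \<le> J" "J < h"
      proof -
        have "real j0 < real J + 1" using J x by linarith
        then show "j0 \<le> J" by linarith
        show "J < h" using J x by linarith
      qed
      have h: "j0 \<le> h" using J' by simp
      define v where "v = A * 2 powr (- (real J * (m + 1 / 2)))"
      define t where "t = sqrt (2 ^ h) * v"
      define \<theta> where "\<theta> = restrict (\<lambda>i. case i of Detail j k \<Rightarrow> if j = J then v else 0 | Scaling k \<Rightarrow> 0)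
        (wav_indices j0 h)"
      have iJ: "Detail J k \<in> wav_indices j0 h" if "k \<in> {1..2 ^ J}" for k
        using that J' by (auto simp: wav_indices_def)
      have "besov_norm m p q j0 h \<theta> = 2 powr (real J * (m + 1 / 2)) * \<bar>v\<bar>"
        by (rule besov_norm_level[OF pq J']) (use iJ in \<open>auto simp: \<theta>_def wav_indices_def\<close>)
      also have "\<dots> = A"
        unfolding v_def using A by (simp add: abs_mult powr_minus)
      finally have \<theta>: "\<theta> \<in> {\<theta> \<in> wav_indices j0 h \<rightarrow>\<^sub>E UNIV. besov_norm m p q j0 h \<theta> \<le> A}"
        by (auto simp: \<theta>_def)
      define y where "y = real h / 2 - real J * (m + 1 / 2)"
      have y: "0 \<le> y" "y \<le> m + 1 / 2"
      proof -
        have e: "real h / 2 = x * (m + 1 / 2)" using m by (simp add: x_def field_simps)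
        have "real J * (m + 1 / 2) \<le> x * (m + 1 / 2)" "x * (m + 1 / 2) \<le> (real J + 1) * (m + 1 / 2)"
          using J m by (auto intro!: mult_right_mono)
        moreover have "(real J + 1) * (m + 1 / 2) = real J * (m + 1 / 2) + (m + 1 / 2)"
          by (simp only: distrib_right mult_1_left)
        ultimately show "0 \<le> y" "y \<le> m + 1 / 2" unfolding y_def e by linarith+
      qed
      have "sqrt (2 ^ h) = 2 powr (real h / 2)"
        by (simp add: powr_half_sqrt[symmetric] powr_realpow[symmetric] powr_powr)
      then have "t = A * 2 powr y"
        unfolding t_def v_def y_def diff_conv_add_uminus powr_add by simp
      then have t: "A \<le> t" "t \<le> A'"
        using y A ge_one_powr_ge_zero[of 2 y] unfolding A'_def by auto
      have t0: "0 \<le> t" using t A by simp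
      have risk: "P * A\<^sup>2 \<le> normal_risk \<kappa> t" if \<kappa>: "0 < \<kappa>" for \<kappa>
      proof -
        have "P * A\<^sup>2 \<le> measure std_normal_distribution {..- t} * (min t (\<kappa> + t))\<^sup>2"
          unfolding P_def using t \<kappa> A
          by (intro mult_mono std_normal.finite_measure_mono power_mono) auto
        also have "\<dots> \<le> normal_risk \<kappa> t"
          by (rule normal_risk_ge[OF \<kappa> t0 t0])
        finally show ?thesis .
      qed
      have "ennreal (P * A\<^sup>2 / 2 * 2 powr x / 2 ^ h) \<le> soft_risk N g j0 \<Phi> \<Psi> h l \<theta>"
        if l: "l \<in> wav_indices j0 h \<rightarrow>\<^sub>E {0<..}" for l
      proof -
        have lp: "0 < l i" if "i \<in> wav_indices j0 h" for i using l that by auto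
        have "P * A\<^sup>2 / 2 * 2 powr x / 2 ^ h \<le> 2 ^ J * (P * A\<^sup>2 / 2 ^ h)"
        proof -
          have "2 powr x \<le> 2 powr (real J + 1)" using J by simp
          also have "\<dots> = 2 * 2 ^ J" by (simp add: powr_add powr_realpow)
          finally have "P * A\<^sup>2 / 2 / 2 ^ h * 2 powr x \<le> P * A\<^sup>2 / 2 / 2 ^ h * (2 * 2 ^ J)"
            using P by (intro mult_left_mono) auto
          then show ?thesis by (simp add: mult_ac)
        qed
        also have "\<dots> = (\<Sum>k\<in>{1..2 ^ J :: nat}. P * A\<^sup>2 / 2 ^ h)" by simp
        also have "\<dots> \<le> (\<Sum>k\<in>{1..2 ^ J}. scaled_normal_risk h (l (Detail J k)) (\<theta> (Detail J k)))"
        proof (rule sum_mono)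
          fix k :: nat assume k: "k \<in> {1..2 ^ J}"
          have "sqrt (2 ^ h) * \<theta> (Detail J k) = t" using iJ[OF k] by (simp add: \<theta>_def t_def)
          then show "P * A\<^sup>2 / 2 ^ h \<le> scaled_normal_risk h (l (Detail J k)) (\<theta> (Detail J k))"
            using risk lp[OF iJ[OF k]] by (auto intro!: divide_right_mono)
        qed
        also have "\<dots> = (\<Sum>i\<in>Detail J ` {1..2 ^ J}. scaled_normal_risk h (l i) (\<theta> i))"
          by (subst sum.reindex) (auto simp: inj_on_def)
        also have "\<dots> \<le> (\<Sum>i\<in>wav_indices j0 h. scaled_normal_risk h (l i) (\<theta> i))"
          using iJ by (intro sum_mono2 finite_wav_indices divide_nonneg_nonneg normal_risk_nonneg) auto
        finally show ?thesis
          unfolding normal_soft_risk_eq[where l = l, OF N basis h lp, simplified] by (rule ennreal_leI)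
      qed
      then have "ennreal (P * A\<^sup>2 / 2 * 2 powr x / 2 ^ h) \<le> minimax_soft_risk N g j0 \<Phi> \<Psi> m p q A h"
        unfolding minimax_soft_risk_def by (intro INF_greatest SUP_upper2[OF \<theta>])
      then show ?case by (simp add: x_def)
    qed
  qed
qed

text \<open>For a fixed threshold \<kappa> the loss is at most (|x| + \<kappa>)^2 whatever the
  signal. Finiteness rules out a quotient of two infinities in the ratio of risks.\<close>

lemma minimax_normal_risk_finite:
  fixes g :: "nat \<Rightarrow> 'b \<Rightarrow> real"
  assumes N: "prob_space N" "prob_space.indep_vars N (\<lambda>_. borel) g {1..}"
      "\<And>i. 1 \<le> i \<Longrightarrow> distributed N lborel (g i) std_normal_density"
    and basis: "interval_wavelet_basis \<phi> \<psi> j0 \<Phi> \<Psi>" and h: "j0 \<le> h"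
  shows "minimax_soft_risk N g j0 \<Phi> \<Psi> m p q A h < \<top>"
proof -
  let ?I = "wav_indices j0 h"
  define l where "l = restrict (\<lambda>_. 1 :: real) ?I"
  define \<kappa> where "\<kappa> = (sqrt (2 ^ h) :: real)"
  define R where "R = (\<integral>x. (\<bar>x\<bar> + \<kappa>)\<^sup>2 \<partial>std_normal_distribution)"
  have \<kappa>: "0 < \<kappa>" by (simp add: \<kappa>_def)
  have R: "normal_risk \<kappa> t \<le> R" for t
    unfolding thr_risk_def R_def
  proof (rule integral_mono)
    show "integrable std_normal_distribution (\<lambda>x. (soft_threshold \<kappa> (t + x) - t)\<^sup>2)"
      by (rule std_normal.thr_risk_integrable) (auto simp: std_normal_square_integrable \<kappa>)
    show "integrable std_normal_distribution (\<lambda>x. (\<bar>x\<bar> + \<kappa>)\<^sup>2)"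
      by (rule square_integrable_add) (auto simp: std_normal_square_integrable)
    fix x
    have "\<bar>soft_threshold \<kappa> (t + x) - t\<bar>\<^sup>2 \<le> (\<bar>x\<bar> + \<kappa>)\<^sup>2"
      by (intro power_mono soft_threshold_error_le \<kappa>) auto
    then show "(soft_threshold \<kappa> (t + x) - t)\<^sup>2 \<le> (\<bar>x\<bar> + \<kappa>)\<^sup>2" by simp
  qed
  have "minimax_soft_risk N g j0 \<Phi> \<Psi> m p q A h \<le> ennreal (\<Sum>i\<in>?I. R / 2 ^ h)"
    unfolding minimax_soft_risk_def
  proof (rule INF_lower2[of l])
    show "l \<in> ?I \<rightarrow>\<^sub>E {0<..}" by (auto simp: l_def)
    have "soft_risk N g j0 \<Phi> \<Psi> h l \<theta> \<le> ennreal (\<Sum>i\<in>?I. R / 2 ^ h)" for \<theta>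
    proof -
      have "soft_risk N g j0 \<Phi> \<Psi> h l \<theta> = ennreal (\<Sum>i\<in>?I. scaled_normal_risk h (l i) (\<theta> i))"
        by (rule normal_soft_risk_eq[OF N basis h]) (auto simp: l_def)
      also have "\<dots> \<le> ennreal (\<Sum>i\<in>?I. R / 2 ^ h)"
        using R by (intro ennreal_leI sum_mono divide_right_mono) (auto simp: l_def \<kappa>_def)
      finally show ?thesis .
    qed
    then show "(SUP \<theta> \<in> {\<theta> \<in> ?I \<rightarrow>\<^sub>E UNIV. besov_norm m p q j0 h \<theta> \<le> A}. soft_risk N g j0 \<Phi> \<Psi> h l \<theta>)
        \<le> ennreal (\<Sum>i\<in>?I. R / 2 ^ h)"
      by (intro SUP_least)
  qed
  then show ?thesis by (rule le_less_trans) simp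
qed

text \<open>Below level \<open>J\<close> the thresholds are kept, from level \<open>J\<close> on they are replaced by thresholds so large
  that the coefficients are essentially estimated by zero.\<close>

lemma (in noise) modified_thresholds:
  fixes \<tau> C A m :: real and N0 J h :: nat and l :: "wav_index \<Rightarrow> real"
  assumes basis: "interval_wavelet_basis \<phi> \<psi> j0 \<Phi> \<Psi>" and h: "j0 \<le> h"
    and C: "0 < C" "\<And>j k i. j0 \<le> j \<Longrightarrow> j < h \<Longrightarrow> N0 < k \<Longrightarrow> k \<le> 2 ^ j - N0 \<Longrightarrow> i \<in> {1..2 ^ h} \<Longrightarrow>
        (dwt_matrix j0 \<Phi> \<Psi> h (Detail j k) i)\<^sup>2 \<le> C * 2 ^ j / 2 ^ h"
    and pq: "1 \<le> p" "1 \<le> q" and A: "0 < A"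
    and \<sigma>: "\<sigma> = min m (m + 1 / 2 - real_of_ereal (1 / p))" "0 < \<sigma>"
    and \<tau>: "0 < \<tau>" "\<tau> \<le> 1"
    and l: "l \<in> wav_indices j0 h \<rightarrow>\<^sub>E {0<..}"
  defines "W \<equiv> risk_const * (2 * (1 + \<mu>)) / \<tau>\<^sup>2 / 2 ^ h"
  obtains l' where "l' \<in> wav_indices j0 h \<rightarrow>\<^sub>E {0<..}"
    "\<And>\<theta>. besov_norm m p q j0 h \<theta> \<le> A \<Longrightarrow>
      (\<Sum>i\<in>wav_indices j0 h. scaled_risk M (coeff_noise j0 \<Phi> \<Psi> h e i) h (l' i) (\<theta> i))
      \<le> (1 + risk_const * \<tau>) * (\<Sum>i\<in>wav_indices j0 h.
            scaled_normal_risk h (l i) (\<theta> i))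
        + (2 ^ j0 * W + real h * (2 * real N0 * W + W * C * 4 ^ J / 2 ^ h
            + A\<^sup>2 * 2 powr (- 2 * real J * \<sigma>) + 1 / 2 ^ h))"
proof -
  let ?I = "wav_indices j0 h" and ?c = "sqrt (2 ^ h) :: real"
  define S where "S i \<omega> = (\<Sum>k\<in>{1..2 ^ h}. dwt_matrix j0 \<Phi> \<Psi> h i k * e k \<omega>)" for i \<omega>
  have S: "S i \<in> borel_measurable M" "integrable M (\<lambda>\<omega>. (S i \<omega>)\<^sup>2)" for i
    unfolding S_def using row_square_integrable[of "dwt_matrix j0 \<Phi> \<Psi> h i" "2 ^ h"] by auto
  have c: "0 < ?c" "?c\<^sup>2 = 2 ^ h" by auto
  have W: "0 \<le> W" unfolding W_def using risk_const_ge fourth_moment_nonneg by simp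
  \<comment> \<open>The accuracy \<open>1 / 2 ^ h\<close> is divided by \<open>2 ^ h\<close> once
    more in \<open>scaled_risk\<close>, so that a whole level of discarded coefficients adds at most
    \<open>1 / 2 ^ h\<close>.\<close>
  have "\<exists>\<kappa>>0. \<forall>t. \<bar>t\<bar> \<le> ?c * A \<longrightarrow> thr_risk M (S i) \<kappa> t \<le> t\<^sup>2 + 1 / 2 ^ h" for i
  proof -
    have "0 < 1 / (2 ^ h :: real)" by simp
    then obtain \<kappa> where "0 < \<kappa>" "\<And>t. \<bar>t\<bar> \<le> ?c * A \<Longrightarrow> thr_risk M (S i) \<kappa> t \<le> t\<^sup>2 + 1 / 2 ^ h"
      using thr_risk_large_threshold[OF S, of _ "?c * A"] by blast
    then show ?thesis by blast
  qed
  then obtain \<Lambda> where \<Lambda>: "\<And>i. 0 < \<Lambda> i" "\<And>i t. \<bar>t\<bar> \<le> ?c * A \<Longrightarrow> thr_risk M (S i) (\<Lambda> i) t \<le> t\<^sup>2 + 1 / 2 ^ h"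
    by metis
  define kill where "kill i = (case i of Scaling k \<Rightarrow> False | Detail j k \<Rightarrow> J \<le> j)" for i
  define l' where "l' = restrict (\<lambda>i. if kill i then \<Lambda> i / ?c else l i) ?I"
  define d where "d i = (case i of Scaling k \<Rightarrow> 1 | Detail j k \<Rightarrow>
    if N0 < k \<and> k \<le> 2 ^ j - N0 then C * 2 ^ j / 2 ^ h else 1)" for i
  have row: "(\<Sum>k\<in>{1..2 ^ h}. (dwt_matrix j0 \<Phi> \<Psi> h i k)\<^sup>2) = 1" if "i \<in> ?I" for i
    by (rule dwt_matrix_row_norm[OF basis h that])
  have dle: "(dwt_matrix j0 \<Phi> \<Psi> h i k)\<^sup>2 \<le> d i" if i: "i \<in> ?I" and k: "k \<in> {1..2 ^ h}" for i k
  proof -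
    have "(dwt_matrix j0 \<Phi> \<Psi> h i k)\<^sup>2 \<le> (\<Sum>k\<in>{1..2 ^ h}. (dwt_matrix j0 \<Phi> \<Psi> h i k)\<^sup>2)"
      using k by (intro member_le_sum) auto
    then have "(dwt_matrix j0 \<Phi> \<Psi> h i k)\<^sup>2 \<le> 1" by (simp only: row[OF i])
    then show ?thesis
      using C(2)[OF _ _ _ _ k] i by (auto simp: d_def wav_indices_def)
  qed
  show thesis
  proof (rule that[of l'])
    show "l' \<in> ?I \<rightarrow>\<^sub>E {0<..}"
      using l \<Lambda>(1) by (auto simp: l'_def)
    fix \<theta> assume \<theta>: "besov_norm m p q j0 h \<theta> \<le> A"
    define err where "err i = (if kill i then (\<theta> i)\<^sup>2 + 1 / 2 ^ h / 2 ^ h else W * d i)" for i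
    have level: "(\<Sum>k\<in>{1..2 ^ j}. (\<theta> (Detail j k))\<^sup>2) \<le> A\<^sup>2 * 2 powr (- 2 * real j * \<sigma>)"
      if "j0 \<le> j" "j < h" for j
      unfolding \<sigma>(1) by (rule besov_level_sum_squares_le[OF pq \<theta> that])
    have each: "scaled_risk M (S i) h (l' i) (\<theta> i)
        \<le> (1 + risk_const * \<tau>) * (scaled_normal_risk h (l i) (\<theta> i)) + err i" if i: "i \<in> ?I" for i
    proof (cases "kill i")
      case True
      then obtain j k where jk: "i = Detail j k" "J \<le> j" by (auto simp: kill_def split: wav_index.splits)
      then have j: "j0 \<le> j" "j < h" "k \<in> {1..2 ^ j}" using i by (auto simp: wav_indices_def)
      \<comment> \<open>The threshold \<Lambda> serves only signals up to \<open>?c * A\<close>; the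
        level bound confines each discarded coefficient to that range.\<close>
      have "(\<theta> i)\<^sup>2 \<le> (\<Sum>k\<in>{1..2 ^ j}. (\<theta> (Detail j k))\<^sup>2)"
        unfolding jk using j(3) by (intro member_le_sum[of k _ "\<lambda>k. (\<theta> (Detail j k))\<^sup>2"]) auto
      also have "\<dots> \<le> A\<^sup>2 * 2 powr (- 2 * real j * \<sigma>)" by (rule level[OF j(1,2)])
      also have "\<dots> \<le> A\<^sup>2 * 2 powr 0"
        using \<sigma>(2) by (intro mult_left_mono powr_mono) auto
      finally have "\<bar>\<theta> i\<bar> \<le> A" using A by (simp add: abs_le_square_iff[symmetric])
      then have "\<bar>?c * \<theta> i\<bar> \<le> ?c * A" using c(1) by (simp add: abs_mult)
      then have "thr_risk M (S i) (\<Lambda> i) (?c * \<theta> i) \<le> (?c * \<theta> i)\<^sup>2 + 1 / 2 ^ h" by (rule \<Lambda>(2))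
      moreover have "?c * l' i = \<Lambda> i" using i True c(1) by (simp add: l'_def)
      moreover have "(?c * \<theta> i)\<^sup>2 = 2 ^ h * (\<theta> i)\<^sup>2" by (simp add: power_mult_distrib)
      ultimately have "scaled_risk M (S i) h (l' i) (\<theta> i) \<le> (2 ^ h * (\<theta> i)\<^sup>2 + 1 / 2 ^ h) / 2 ^ h"
        by (intro divide_right_mono) auto
      also have "\<dots> = err i" using True by (simp add: err_def add_divide_distrib)
      finally have "scaled_risk M (S i) h (l' i) (\<theta> i) \<le> err i" .
      moreover have "0 \<le> (1 + risk_const * \<tau>) * (scaled_normal_risk h (l i) (\<theta> i))"
        using risk_const_ge \<tau> by (intro mult_nonneg_nonneg divide_nonneg_nonneg normal_risk_nonneg) auto
      ultimately show ?thesis by linarith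
    next
      case False
      have "0 < ?c * l i" using PiE_mem[OF l i] c(1) by (intro mult_pos_pos) auto
      from thr_risk_row_le[OF row[OF i] dle[OF i] \<tau> this, of "?c * \<theta> i"]
      have "thr_risk M (S i) (?c * l i) (?c * \<theta> i) \<le> (1 + risk_const * \<tau>) * normal_risk (?c * l i) (?c * \<theta> i)
          + risk_const * (2 * (1 + \<mu>) * d i) / \<tau>\<^sup>2"
        by (simp add: S_def[abs_def])
      then have "scaled_risk M (S i) h (l i) (\<theta> i) \<le> ((1 + risk_const * \<tau>) * normal_risk (?c * l i) (?c * \<theta> i)
          + risk_const * (2 * (1 + \<mu>) * d i) / \<tau>\<^sup>2) / 2 ^ h"
        by (rule divide_right_mono) simp
      also have "\<dots> = (1 + risk_const * \<tau>) * (scaled_normal_risk h (l i) (\<theta> i)) + err i"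
        using False by (simp add: err_def W_def add_divide_distrib mult_ac)
      finally show ?thesis using i False by (simp add: l'_def)
    qed
    have "(\<Sum>i\<in>?I. err i) \<le> 2 ^ j0 * W + real h * (2 * real N0 * W + W * C * 4 ^ J / 2 ^ h
            + A\<^sup>2 * 2 powr (- 2 * real J * \<sigma>) + 1 / 2 ^ h)"
    proof -
      let ?B = "2 * real N0 * W + W * C * 4 ^ J / 2 ^ h + A\<^sup>2 * 2 powr (- 2 * real J * \<sigma>) + 1 / 2 ^ h"
      have B: "(\<Sum>k\<in>{1..2 ^ j}. err (Detail j k)) \<le> ?B" if j: "j0 \<le> j" "j < h" for j
      proof (cases "J \<le> j")
        case True
        have "(\<Sum>k\<in>{1..2 ^ j}. err (Detail j k))
            = (\<Sum>k\<in>{1..2 ^ j}. (\<theta> (Detail j k))\<^sup>2) + 2 ^ j * (1 / 2 ^ h / 2 ^ h)"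
          using True by (simp add: err_def kill_def sum.distrib)
        also have "\<dots> \<le> A\<^sup>2 * 2 powr (- 2 * real J * \<sigma>) + 1 / 2 ^ h"
        proof (rule add_mono)
          have "A\<^sup>2 * 2 powr (- 2 * real j * \<sigma>) \<le> A\<^sup>2 * 2 powr (- 2 * real J * \<sigma>)"
            using True \<sigma>(2) by (intro mult_left_mono powr_mono) auto
          then show "(\<Sum>k\<in>{1..2 ^ j}. (\<theta> (Detail j k))\<^sup>2) \<le> A\<^sup>2 * 2 powr (- 2 * real J * \<sigma>)"
            using level[OF j] by linarith
          have "(2::real) ^ j \<le> 2 ^ h" using j by (intro power_increasing) auto
          then show "2 ^ j * (1 / 2 ^ h / 2 ^ h) \<le> 1 / (2 ^ h :: real)"
            by (simp add: field_simps)
        qed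
        also have "\<dots> \<le> ?B" using W C(1) by simp
        finally show ?thesis .
      next
        case False
        let ?K = "{k \<in> {1..2 ^ j}. \<not> (N0 < k \<and> k \<le> 2 ^ j - N0)}"
        have "(\<Sum>k\<in>{1..2 ^ j}. err (Detail j k)) = (\<Sum>k\<in>{1..2 ^ j}. W * d (Detail j k))"
          using False by (simp add: err_def kill_def)
        also have "\<dots> \<le> (\<Sum>k\<in>{1..2 ^ j}. W * ((if k \<in> ?K then 1 else 0) + C * 2 ^ j / 2 ^ h))"
          using W C(1) by (intro sum_mono mult_left_mono) (auto simp: d_def)
        also have "\<dots> = W * (real (card ?K) + 2 ^ j * (C * 2 ^ j / 2 ^ h))"
        proof -
          have "(\<Sum>k\<in>{1..2 ^ j}. if k \<in> ?K then 1 else 0 :: real) = real (card ?K)"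
            by (subst sum.inter_filter[symmetric]) (auto intro!: arg_cong[of _ _ card])
          then show ?thesis unfolding sum_distrib_left[symmetric] sum.distrib by simp
        qed
        also have "\<dots> \<le> W * (2 * real N0 + C * 4 ^ J / 2 ^ h)"
        proof (intro mult_left_mono add_mono W)
          \<comment> \<open>Truncated subtraction is harmless: if \<open>N0\<close> exceeds
            \<open>2 ^ j\<close>, the second set is the whole level and still has at most
            \<open>N0\<close> elements.\<close>
          have "?K \<subseteq> {1..N0} \<union> {2 ^ j - N0<..2 ^ j}" by auto
          then have "card ?K \<le> card ({1..N0} \<union> {2 ^ j - N0<..2 ^ j})" by (intro card_mono) auto
          also have "\<dots> \<le> card {1..N0} + card {2 ^ j - N0<..2 ^ j}" by (rule card_Un_le)
          also have "\<dots> \<le> 2 * N0" by simp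
          finally show "real (card ?K) \<le> 2 * real N0" by linarith
          have "(2::real) ^ j * 2 ^ j = 4 ^ j" by (simp add: power_mult_distrib[symmetric])
          also have "\<dots> \<le> 4 ^ J" using False by (intro power_increasing) auto
          finally have "C / 2 ^ h * (2 ^ j * 2 ^ j) \<le> C / 2 ^ h * 4 ^ J"
            using C(1) by (intro mult_left_mono) auto
          then show "2 ^ j * (C * 2 ^ j / 2 ^ h) \<le> C * 4 ^ J / 2 ^ h" by (simp add: mult_ac)
        qed
        also have "\<dots> = 2 * real N0 * W + W * C * 4 ^ J / 2 ^ h" by (simp add: algebra_simps)
        also have "\<dots> \<le> ?B" by simp
        finally show ?thesis .
      qed
      have B0: "0 \<le> ?B" using W C(1) by simp
      have "(\<Sum>i\<in>?I. err i) = (\<Sum>k\<in>{1..2 ^ j0 :: nat}. W) + (\<Sum>j\<in>{j0..<h}. \<Sum>k\<in>{1..2 ^ j}. err (Detail j k))"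
        unfolding sum_wav_indices by (simp add: err_def kill_def d_def)
      also have "\<dots> \<le> 2 ^ j0 * W + (\<Sum>j\<in>{j0..<h}. ?B)"
        using B by (intro add_mono sum_mono) auto
      also have "(\<Sum>j\<in>{j0..<h}. ?B) = real (h - j0) * ?B" by simp
      also have "\<dots> \<le> real h * ?B" using B0 by (intro mult_right_mono) auto
      finally show ?thesis by simp
    qed
    moreover have "(\<Sum>i\<in>?I. scaled_risk M (S i) h (l' i) (\<theta> i))
        \<le> (\<Sum>i\<in>?I. (1 + risk_const * \<tau>) * (scaled_normal_risk h (l i) (\<theta> i)) + err i)"
      by (rule sum_mono) (rule each)
    ultimately show "(\<Sum>i\<in>?I. scaled_risk M (coeff_noise j0 \<Phi> \<Psi> h e i) h (l' i) (\<theta> i))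
      \<le> (1 + risk_const * \<tau>) * (\<Sum>i\<in>?I. scaled_normal_risk h (l i) (\<theta> i))
        + (2 ^ j0 * W + real h * (2 * real N0 * W + W * C * 4 ^ J / 2 ^ h
            + A\<^sup>2 * 2 powr (- 2 * real J * \<sigma>) + 1 / 2 ^ h))"
      unfolding S_def[abs_def] sum.distrib sum_distrib_left by linarith
  qed
qed

text \<open>All moments are those of the common law. The cube integrates to zero because that law is
  invariant under negation, and x^4 is at most 1 + |x|^L.\<close>

lemma noise_of_symmetric_iid:
  assumes M: "prob_space M"
    and indep: "prob_space.indep_vars M (\<lambda>_. borel) e {1..}"
    and identical: "\<And>i. 1 \<le> i \<Longrightarrow> distr M borel (e i) = distr M borel (e 1)"
    and symmetric: "distr M borel (\<lambda>\<omega>. - e 1 \<omega>) = distr M borel (e 1)"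
    and mean: "prob_space.expectation M (e 1) = 0"
    and variance: "prob_space.variance M (e 1) = 1"
    and moment: "integrable M (\<lambda>\<omega>. \<bar>e 1 \<omega>\<bar> powr L)" and L: "4 \<le> L"
  shows "noise M e (\<integral>\<omega>. e 1 \<omega> ^ 4 \<partial>M)"
proof -
  interpret prob_space M by fact
  have meas: "e i \<in> borel_measurable M" if "1 \<le> i" for i
    using indep that by (auto simp: indep_vars_def)
  note [measurable] = meas[OF order_refl] meas[OF order_refl, simplified]
  have same: "(\<integral>\<omega>. f (e i \<omega>) \<partial>M) = (\<integral>\<omega>. f (e 1 \<omega>) \<partial>M)"
    if "1 \<le> i" and f: "f \<in> borel_measurable borel" for i and f :: "real \<Rightarrow> real"
    using integral_distr[OF meas[OF that(1)] f] integral_distr[OF meas[OF order_refl] f]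
      identical[OF that(1)] by simp
  have fourth: "integrable M (\<lambda>\<omega>. e 1 \<omega> ^ 4)"
  proof (rule Bochner_Integration.integrable_bound)
    show "integrable M (\<lambda>\<omega>. 1 + \<bar>e 1 \<omega>\<bar> powr L)" using moment by auto
    have "x ^ 4 \<le> 1 + \<bar>x\<bar> powr L" for x :: real
    proof (cases "\<bar>x\<bar> \<le> 1")
      case True
      then have "\<bar>x\<bar> ^ 4 \<le> 1" by (intro power_le_one) auto
      moreover have "\<bar>x\<bar> ^ 4 = x ^ 4" by simp
      moreover have "0 \<le> \<bar>x\<bar> powr L" by simp
      ultimately show ?thesis by linarith
    next
      case False
      then have "\<bar>x\<bar> powr 4 \<le> \<bar>x\<bar> powr L" using L by (intro powr_mono) auto
      moreover have "\<bar>x\<bar> powr 4 = \<bar>x\<bar> ^ 4" using False by (simp add: powr_numeral)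
      moreover have "\<bar>x\<bar> ^ 4 = x ^ 4" by simp
      ultimately show ?thesis by linarith
    qed
    moreover have "\<bar>x ^ 4\<bar> = x ^ 4" for x :: real
      by simp
    ultimately have "\<bar>x ^ 4\<bar> \<le> \<bar>1 + \<bar>x\<bar> powr L\<bar>" for x :: real
      by (metis abs_ge_self order_trans)
    then show "AE \<omega> in M. norm (e 1 \<omega> ^ 4) \<le> norm (1 + \<bar>e 1 \<omega>\<bar> powr L)"
      unfolding real_norm_def by (intro AE_I2)
  qed simp
  have "integrable (distr M borel (e 1)) (\<lambda>x. x ^ 4)"
    using fourth by (subst integrable_distr_eq) auto
  then have fourth': "integrable M (\<lambda>\<omega>. e i \<omega> ^ 4)" if "1 \<le> i" for i
    using identical[OF that] integrable_distr_eq[OF meas[OF that], of "\<lambda>x. x ^ 4"] by simp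
  have third: "(\<integral>\<omega>. e 1 \<omega> ^ 3 \<partial>M) = 0"
  proof -
    have "(\<integral>\<omega>. e 1 \<omega> ^ 3 \<partial>M) = (\<integral>x. x ^ 3 \<partial>distr M borel (e 1))"
      by (subst integral_distr) auto
    also have "\<dots> = (\<integral>x. x ^ 3 \<partial>distr M borel (\<lambda>\<omega>. - e 1 \<omega>))"
      by (simp only: symmetric)
    also have "\<dots> = (\<integral>\<omega>. (- e 1 \<omega>) ^ 3 \<partial>M)"
      by (subst integral_distr) auto
    also have "\<dots> = - (\<integral>\<omega>. e 1 \<omega> ^ 3 \<partial>M)"
      by simp
    finally show ?thesis by simp
  qed
  show ?thesis
  proof (unfold_locales)
    show "indep_vars (\<lambda>_. borel) e {1..}" by (rule indep)
    fix i :: nat assume i: "1 \<le> i"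
    show "integrable M (\<lambda>\<omega>. e i \<omega> ^ 4)" by (rule fourth'[OF i])
    show "expectation (e i) = 0" using same[OF i, of "\<lambda>x. x"] mean by simp
    show "expectation (\<lambda>\<omega>. (e i \<omega>)\<^sup>2) = 1" using same[OF i, of "\<lambda>x. x\<^sup>2"] variance mean by simp
    show "expectation (\<lambda>\<omega>. e i \<omega> ^ 3) = 0" using same[OF i, of "\<lambda>x. x ^ 3"] third by simp
    show "expectation (\<lambda>\<omega>. e i \<omega> ^ 4) \<le> expectation (\<lambda>\<omega>. e 1 \<omega> ^ 4)"
      using same[OF i, of "\<lambda>x. x ^ 4"] by simp
  qed
qed

text \<open>The number of coefficients below level \<open>J\<close> is of order \<open>2\<^sup>J\<close> and each of them contributes an error of
  order \<open>2\<^sup>J / n\<^sup>2\<close>, while discarding the levels above \<open>J\<close> costs \<open>2\<^bsup>- 2 J \<sigma>\<^esup>\<close>. For \<open>2\<^sup>J \<approx> n\<^sup>b\<close> both are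
  negligible with respect to the minimax rate \<open>n\<^bsup>\<alpha> - 1\<^esup>\<close> if \<open>2 b < 1 + \<alpha>\<close> and \<open>1 - \<alpha> < 2 b \<sigma>\<close>.\<close>

lemma remainder_negligible:
  fixes b \<alpha> \<sigma> K N0 C A c :: real and j0 :: nat
  assumes "0 < b" "0 < \<alpha>" "0 < \<sigma>" "2 * b < 1 + \<alpha>" "1 - \<alpha> < 2 * b * \<sigma>" "0 \<le> K" "0 < C" "0 < c"
  shows "((\<lambda>h. (2 ^ j0 * (K / (1 / real h)\<^sup>2 / 2 ^ h) + real h * (2 * N0 * (K / (1 / real h)\<^sup>2 / 2 ^ h)
      + (K / (1 / real h)\<^sup>2 / 2 ^ h) * C * 4 ^ nat \<lfloor>b * real h\<rfloor> / 2 ^ h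
      + A\<^sup>2 * 2 powr (- 2 * real (nat \<lfloor>b * real h\<rfloor>) * \<sigma>) + 1 / 2 ^ h))
      / (c * 2 powr (\<alpha> * real h) / 2 ^ h)) \<longlonglongrightarrow> 0)" (is "?R \<longlonglongrightarrow> 0")
proof -
  \<comment> \<open>The sequence is the cube of h r^h with r = 2^(x / 3) < 1.\<close>
  have lim: "(\<lambda>h. real h ^ 3 * 2 powr (x * real h)) \<longlonglongrightarrow> 0" if "x < 0" for x
  proof -
    have "(\<lambda>h. real h * (2 powr (x / 3)) ^ h) \<longlonglongrightarrow> 0"
      using that by (intro powser_times_n_limit_0) (simp add: powr_less_one)
    then have "(\<lambda>h. (real h * (2 powr (x / 3)) ^ h) ^ 3) \<longlonglongrightarrow> 0 ^ 3"
      by (rule tendsto_power)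
    moreover have "(real h * (2 powr (x / 3)) ^ h) ^ 3 = real h ^ 3 * 2 powr (x * real h)" for h
      by (simp add: power_mult_distrib powr_power mult.commute)
    ultimately show ?thesis by simp
  qed
  \<comment> \<open>Majorant in which every power of h is raised to h^3: one factor h counts levels,
    h^2 comes from \<tau> = 1 / h. The three remaining exponents are negative by assumption, and
    \<open>2 powr (2 * \<sigma>)\<close> pays for rounding b h down.\<close>
  define U where "U h = (2 ^ j0 * K + 2 * \<bar>N0\<bar> * K + 1) / c * (real h ^ 3 * 2 powr (- \<alpha> * real h))
    + K * C / c * (real h ^ 3 * 2 powr ((2 * b - 1 - \<alpha>) * real h))
    + A\<^sup>2 * 2 powr (2 * \<sigma>) / c * (real h ^ 3 * 2 powr ((1 - \<alpha> - 2 * b * \<sigma>) * real h))" for h :: nat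
  have "U \<longlonglongrightarrow> (2 ^ j0 * K + 2 * \<bar>N0\<bar> * K + 1) / c * 0 + K * C / c * 0 + A\<^sup>2 * 2 powr (2 * \<sigma>) / c * 0"
    unfolding U_def[abs_def] by (intro tendsto_add tendsto_mult_left lim) (use assms in auto)
  then have "U \<longlonglongrightarrow> 0" by simp
  moreover have "\<forall>\<^sub>F h in sequentially. \<bar>?R h\<bar> \<le> U h"
    using eventually_ge_at_top[of 1]
  proof eventually_elim
    case (elim h)
    define J where "J = nat \<lfloor>b * real h\<rfloor>"
    define n where "n = (2::real) ^ h"
    define H where "H = real h"
    define E where "E = 2 powr (- \<alpha> * H)"
    have H: "1 \<le> H" "H \<le> H ^ 3" "H\<^sup>2 \<le> H ^ 3"
      using elim power_increasing[of 1 3 H] power_increasing[of 2 3 H] by (auto simp: H_def)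
    have n: "0 < n" "n = 2 powr H" by (auto simp: n_def H_def powr_realpow)
    have E: "0 < E" "1 / (c * 2 powr (\<alpha> * H)) = E / c" by (auto simp: E_def powr_minus field_simps)
    have J: "real J \<le> b * H" "b * H - 1 \<le> real J"
      unfolding J_def H_def using assms(1) by (auto simp: le_nat_iff)
    have four: "4 ^ J \<le> 2 powr (2 * b * H)"
    proof -
      have "(4::real) ^ J = 2 powr (2 * real J)"
        by (simp add: powr_realpow[symmetric] powr_powr[symmetric])
      also have "\<dots> \<le> 2 powr (2 * b * H)" using J by (intro powr_mono) auto
      finally show ?thesis .
    qed
    have sig: "2 powr (- 2 * real J * \<sigma>) \<le> 2 powr (2 * \<sigma>) * 2 powr (- (2 * b * \<sigma>) * H)"
    proof -
      have "(b * H - 1) * \<sigma> \<le> real J * \<sigma>" using J assms(3) by (intro mult_right_mono) auto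
      then have "- 2 * real J * \<sigma> \<le> 2 * \<sigma> + - (2 * b * \<sigma>) * H" by (simp add: algebra_simps)
      then show ?thesis unfolding powr_add[symmetric] by (intro powr_mono) auto
    qed
    have "?R h = (2 ^ j0 * (K * H\<^sup>2 / n) + H * (2 * N0 * (K * H\<^sup>2 / n) + (K * H\<^sup>2 / n) * C * 4 ^ J / n
        + A\<^sup>2 * 2 powr (- 2 * real J * \<sigma>) + 1 / n)) * n * (1 / (c * 2 powr (\<alpha> * H)))"
      unfolding J_def n_def[symmetric] H_def[symmetric]
      by (simp add: power_divide)
    also have "\<dots> = (2 ^ j0 * K * H\<^sup>2 + 2 * N0 * K * (H * H\<^sup>2) + K * C * (H * H\<^sup>2) * (4 ^ J / n)
        + A\<^sup>2 * H * (2 powr (- 2 * real J * \<sigma>) * n) + H) * (E / c)"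
    proof -
      have key: "(a * (k * x) + H * (2 * N0 * (k * x) + k * x * C * F * x + B + x)) * n
          = a * k + 2 * N0 * (H * k) + C * (H * k) * (F * x) + H * (B * n) + H"
        if "x * n = 1" for a k x F B :: real
        using that by algebra
      have "1 / n * n = 1" using n(1) by simp
      from key[OF this, of "2 ^ j0" "K * H\<^sup>2" "4 ^ J" "A\<^sup>2 * 2 powr (- 2 * real J * \<sigma>)"]
      show ?thesis unfolding E(2) by (simp add: mult_ac)
    qed
    finally have e: "?R h = (2 ^ j0 * K * H\<^sup>2 + 2 * N0 * K * H ^ 3 + K * C * H ^ 3 * (4 ^ J / n)
        + A\<^sup>2 * H * (2 powr (- 2 * real J * \<sigma>) * n) + H) * (E / c)"
      by (simp add: power3_eq_cube power2_eq_square)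
    have "\<bar>?R h\<bar> \<le> (2 ^ j0 * K * H ^ 3 + 2 * \<bar>N0\<bar> * K * H ^ 3 + K * C * H ^ 3 * (2 powr (2 * b * H) / n)
        + A\<^sup>2 * H ^ 3 * (2 powr (2 * \<sigma>) * 2 powr (- (2 * b * \<sigma>) * H) * n) + H ^ 3) * (E / c)"
      unfolding e abs_mult[of _ "E / c"]
    proof (rule mult_mono)
      have "\<bar>2 ^ j0 * K * H\<^sup>2 + 2 * N0 * K * H ^ 3 + K * C * H ^ 3 * (4 ^ J / n)
          + A\<^sup>2 * H * (2 powr (- 2 * real J * \<sigma>) * n) + H\<bar>
        \<le> 2 ^ j0 * K * H\<^sup>2 + \<bar>2 * N0 * K * H ^ 3\<bar> + K * C * H ^ 3 * (4 ^ J / n)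
          + A\<^sup>2 * H * (2 powr (- 2 * real J * \<sigma>) * n) + H"
      proof -
        have "0 \<le> 2 ^ j0 * K * H\<^sup>2" "0 \<le> K * C * H ^ 3 * (4 ^ J / n)"
          "0 \<le> A\<^sup>2 * H * (2 powr (- 2 * real J * \<sigma>) * n)" "0 \<le> H"
          using assms H n by auto
        then show ?thesis by linarith
      qed
      also have "\<bar>2 * N0 * K * H ^ 3\<bar> = 2 * \<bar>N0\<bar> * K * H ^ 3"
        using assms H by (simp add: abs_mult)
      also have "2 ^ j0 * K * H\<^sup>2 \<le> 2 ^ j0 * K * H ^ 3" using assms H by (intro mult_left_mono) auto
      also have "K * C * H ^ 3 * (4 ^ J / n) \<le> K * C * H ^ 3 * (2 powr (2 * b * H) / n)"
        using assms H n four by (intro mult_left_mono divide_right_mono) auto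
      also have "A\<^sup>2 * H * (2 powr (- 2 * real J * \<sigma>) * n)
          \<le> A\<^sup>2 * H ^ 3 * (2 powr (2 * \<sigma>) * 2 powr (- (2 * b * \<sigma>) * H) * n)"
        using H n sig by (intro mult_mono mult_left_mono mult_right_mono) auto
      finally show "\<bar>2 ^ j0 * K * H\<^sup>2 + 2 * N0 * K * H ^ 3 + K * C * H ^ 3 * (4 ^ J / n)
          + A\<^sup>2 * H * (2 powr (- 2 * real J * \<sigma>) * n) + H\<bar>
        \<le> 2 ^ j0 * K * H ^ 3 + 2 * \<bar>N0\<bar> * K * H ^ 3 + K * C * H ^ 3 * (2 powr (2 * b * H) / n)
          + A\<^sup>2 * H ^ 3 * (2 powr (2 * \<sigma>) * 2 powr (- (2 * b * \<sigma>) * H) * n) + H ^ 3"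
        using H by linarith
    qed (use assms E H n in auto)
    also have "\<dots> = (2 ^ j0 * K + 2 * \<bar>N0\<bar> * K + 1) / c * (H ^ 3 * E)
        + K * C / c * (H ^ 3 * (2 powr (2 * b * H) / n * E))
        + A\<^sup>2 * 2 powr (2 * \<sigma>) / c * (H ^ 3 * (2 powr (- (2 * b * \<sigma>) * H) * n * E))"
      using assms(8) n by (simp add: field_simps)
    also have "2 powr (2 * b * H) / n * E = 2 powr ((2 * b - 1 - \<alpha>) * H)"
      unfolding n(2) E_def powr_diff[symmetric] powr_add[symmetric] by (simp add: algebra_simps)
    also have "2 powr (- (2 * b * \<sigma>) * H) * n * E = 2 powr ((1 - \<alpha> - 2 * b * \<sigma>) * H)"
      unfolding n(2) E_def powr_add[symmetric] by (simp add: algebra_simps)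
    finally show ?case by (simp add: U_def E_def H_def)
  qed
  ultimately show ?thesis
    by (intro tendsto_rabs_zero_cancel[of ?R] tendsto_sandwich[of "\<lambda>_. 0" "\<lambda>h. \<bar>?R h\<bar>" _ U])
      auto
qed

text \<open>In the extended reals 0 / 0 and \<top> / \<top> are both 0, which is why
  \<open>x\<close> must be positive and finite; for \<open>y = 0\<close> the quotient is
  \<top>.\<close>

lemma ennreal_ratio_ge:
  fixes x y :: ennreal
  assumes "y \<le> ennreal C * x" "0 < C" "0 < x" "x < \<top>"
  shows "ennreal (1 / C) \<le> x / y"
proof -
  obtain a where a: "x = ennreal a" "0 < a"
    using assms(3,4) by (cases x) auto
  have "y \<le> ennreal (C * a)"
    using assms(1,2) a by (simp add: ennreal_mult)
  then obtain b where b: "y = ennreal b" "0 \<le> b" "b \<le> C * a"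
    using assms(2) a by (cases y) (auto simp: top_unique)
  show ?thesis
  proof (cases "b = 0")
    case True
    then show ?thesis using a b by (simp add: ennreal_divide_zero)
  next
    case False
    then have "ennreal a / ennreal b = ennreal (a / b)" using a b by (intro divide_ennreal) auto
    moreover have "1 / C \<le> a / b" using False a b assms(2) by (simp add: field_simps)
    ultimately show ?thesis unfolding a(1) b(1) by (simp add: ennreal_leI)
  qed
qed

theorem theorem2p1:
  fixes p q :: ereal and m A L :: real
    and \<phi> \<psi> :: "real \<Rightarrow> real" and j0 :: nat
    and \<Phi> \<Psi> :: "nat \<Rightarrow> nat \<Rightarrow> real \<Rightarrow> real"
    and M :: "'a measure" and e :: "nat \<Rightarrow> 'a \<Rightarrow> real"
    and N :: "'b measure" and g :: "nat \<Rightarrow> 'b \<Rightarrow> real"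
  assumes "1 \<le> p" and "1 \<le> q" and "1 / p < ereal m" and "0 < A"
    and wavelets: "interval_wavelet_basis \<phi> \<psi> j0 \<Phi> \<Psi>"
    and M: "prob_space M"
    and indep: "prob_space.indep_vars M (\<lambda>_. borel) e {1..}"
    and identical: "\<And>i. 1 \<le> i \<Longrightarrow> distr M borel (e i) = distr M borel (e 1)"
    and symmetric: "distr M borel (\<lambda>\<omega>. - e 1 \<omega>) = distr M borel (e 1)"
    and mean: "integrable M (e 1)" "prob_space.expectation M (e 1) = 0"
    and variance: "integrable M (\<lambda>\<omega>. (e 1 \<omega>)\<^sup>2)" "prob_space.variance M (e 1) = 1"
    and moment: "integrable M (\<lambda>\<omega>. \<bar>e 1 \<omega>\<bar> powr L)"
    and L_ge_2: "2 \<le> p \<Longrightarrow> L > 6 / (2 * m / (2 * m + 1))"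
    and L_le_2: "p \<le> 2 \<Longrightarrow>
      L > 6 * (m + 1 / 2 - real_of_ereal (1 / p)) * (2 * m + 1) /
            ((m + 1 / 2 - real_of_ereal (1 / p)) * (2 * m + 1) - m)"
    and N: "prob_space N"
    and gauss_indep: "prob_space.indep_vars N (\<lambda>_. borel) g {1..}"
    and gauss: "\<And>i. 1 \<le> i \<Longrightarrow> distributed N lborel (g i) std_normal_density"
  shows "liminf (\<lambda>h. minimax_soft_risk N g j0 \<Phi> \<Psi> m p q A h /
                     minimax_soft_risk M e j0 \<Phi> \<Psi> m p q A h) \<ge> 1"
proof -
  define c where "c = real_of_ereal (1 / p)"
  have c: "0 \<le> c" "c \<le> 1" "c < m" "p \<le> 2 \<or> 2 \<le> p"
  proof -
    have "0 \<le> 1 / p \<and> 1 / p \<le> 1 \<and> 1 / p = ereal c"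
      using \<open>1 \<le> p\<close> by (cases p) (auto simp: c_def one_ereal_def)
    then show "0 \<le> c" "c \<le> 1" "c < m" using \<open>1 / p < ereal m\<close>
      by (auto simp: one_ereal_def zero_ereal_def)
  qed auto
  have m: "0 < m" using c by linarith
  define s where "s = m + 1 / 2 - c"
  have s: "1 / 2 < s" using c by (simp add: s_def)
  \<comment> \<open>Both moment conditions ask for more than 6 times a quotient that is at least 1;
    for p < 2 its denominator is positive because s > 1/2.\<close>
  have "6 < L"
  proof (cases "2 \<le> p")
    case True
    have "6 \<le> 6 / (2 * m / (2 * m + 1))" using m by (simp add: field_simps)
    then show ?thesis using L_ge_2[OF True] by linarith
  next
    case False
    have "1 / 2 * (2 * m + 1) < s * (2 * m + 1)" using s m by (intro mult_strict_right_mono) auto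
    then have "0 < s * (2 * m + 1) - m" by (simp add: algebra_simps)
    then have "6 \<le> 6 * s * (2 * m + 1) / (s * (2 * m + 1) - m)" using m by (simp add: field_simps)
    moreover have "6 * s * (2 * m + 1) / (s * (2 * m + 1) - m) < L"
      using L_le_2 False unfolding s_def c_def by auto
    ultimately show ?thesis by linarith
  qed
  define \<mu> where "\<mu> = (\<integral>\<omega>. e 1 \<omega> ^ 4 \<partial>M)"
  interpret noise M e \<mu>
    unfolding \<mu>_def
    by (rule noise_of_symmetric_iid[OF M indep identical symmetric mean(2) variance(2) moment])
      (use \<open>6 < L\<close> in auto)
  define \<sigma> where "\<sigma> = min m s"
  \<comment> \<open>The second inequality says that the interval from which \<open>b\<close> is
    chosen below is nonempty.\<close>
  have \<sigma>: "0 < \<sigma>" "m < \<sigma> * (m + 1)"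
  proof -
    show "0 < \<sigma>" using m s by (simp add: \<sigma>_def)
    have "m < m * (m + 1)" using m by (simp add: algebra_simps)
    \<comment> \<open>For m \<le> 1 the bound s > 1/2 suffices; for larger m, 1 / p \<le> 1 gives s
      \<ge> m - 1/2.\<close>
    moreover have "m < s * (m + 1)"
    proof (cases "m \<le> 1")
      case True
      have "1 / 2 * (m + 1) < s * (m + 1)" using s m by (intro mult_strict_right_mono) auto
      then show ?thesis using True by (simp add: algebra_simps)
    next
      case False
      have "0 < (m - 1) * (m + 1 / 2)" using False by simp
      moreover have "(m - 1 / 2) * (m + 1) = m + (m - 1) * (m + 1 / 2)" by (simp add: field_simps)
      ultimately have "m < (m - 1 / 2) * (m + 1)" by linarith
      also have "\<dots> \<le> s * (m + 1)" using c m by (intro mult_right_mono) (auto simp: s_def)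
      finally show ?thesis .
    qed
    ultimately show "m < \<sigma> * (m + 1)" by (simp add: \<sigma>_def min_def)
  qed
  define \<alpha> where "\<alpha> = 1 / (2 * m + 1)"
  have \<alpha>: "0 < \<alpha>" "1 - \<alpha> = 2 * m * \<alpha>" "1 + \<alpha> = 2 * (m + 1) * \<alpha>"
    using m by (auto simp: \<alpha>_def field_simps)
  \<comment> \<open>Midpoint of the admissible interval: the two conditions on \<open>b\<close> read
    m \<alpha> / \<sigma> < b < (m + 1) \<alpha>.\<close>
  define b where "b = (m * \<alpha> / \<sigma> + (m + 1) * \<alpha>) / 2"
  have b: "0 < b" "2 * b < 1 + \<alpha>" "1 - \<alpha> < 2 * b * \<sigma>"
  proof -
    have "m * \<alpha> < \<sigma> * (m + 1) * \<alpha>" using \<sigma> \<alpha> by (intro mult_strict_right_mono) auto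
    then have *: "m * \<alpha> / \<sigma> < (m + 1) * \<alpha>" using \<sigma> by (simp add: field_simps)
    show "0 < b" unfolding b_def using m \<alpha> \<sigma> by (intro divide_pos_pos add_pos_pos mult_pos_pos) auto
    have b2: "2 * b = m * \<alpha> / \<sigma> + (m + 1) * \<alpha>" by (simp add: b_def)
    have "2 * (m + 1) * \<alpha> = 2 * ((m + 1) * \<alpha>)" by simp
    then show "2 * b < 1 + \<alpha>" unfolding \<alpha>(3) using * b2 by linarith
    have "2 * (m * \<alpha> / \<sigma>) < 2 * b" using * b2 by linarith
    then have "2 * (m * \<alpha> / \<sigma>) * \<sigma> < 2 * b * \<sigma>" using \<sigma>(1) by (rule mult_strict_right_mono)
    then show "1 - \<alpha> < 2 * b * \<sigma>" unfolding \<alpha>(2) using \<sigma>(1) by simp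
  qed
  obtain N0 C where C: "0 < C" "\<And>h j k l. j0 \<le> j \<Longrightarrow> j < h \<Longrightarrow> N0 < k \<Longrightarrow> k \<le> 2 ^ j - N0 \<Longrightarrow> l \<in> {1..2 ^ h} \<Longrightarrow>
    (dwt_matrix j0 \<Phi> \<Psi> h (Detail j k) l)\<^sup>2 \<le> C * 2 ^ j / 2 ^ h"
    by (rule dwt_matrix_bound[OF wavelets]) (rule that)
  obtain c0 where c0: "0 < c0" and lower: "\<forall>\<^sub>F h in sequentially.
    ennreal (c0 * 2 powr (real h / (2 * m + 1)) / 2 ^ h) \<le> minimax_soft_risk N g j0 \<Phi> \<Psi> m p q A h"
    using minimax_normal_risk_lower_bound[OF N gauss_indep gauss wavelets \<open>1 \<le> p\<close> \<open>1 \<le> q\<close> m \<open>0 < A\<close>] by blast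
  define K where "K = risk_const * (2 * (1 + \<mu>))"
  have K: "0 \<le> K" unfolding K_def using risk_const_ge fourth_moment_nonneg by simp
  define \<rho> where "\<rho> h = 2 ^ j0 * (K / (1 / real h)\<^sup>2 / 2 ^ h) + real h * (2 * real N0 * (K / (1 / real h)\<^sup>2 / 2 ^ h)
      + (K / (1 / real h)\<^sup>2 / 2 ^ h) * C * 4 ^ nat \<lfloor>b * real h\<rfloor> / 2 ^ h
      + A\<^sup>2 * 2 powr (- 2 * real (nat \<lfloor>b * real h\<rfloor>) * \<sigma>) + 1 / 2 ^ h)" for h
  define r where "r h = c0 * 2 powr (\<alpha> * real h) / 2 ^ h" for h
  \<comment> \<open>With \<tau> = 1 / h the multiplicative loss tends to 1. The additive remainder
    \<open>\<rho> h\<close> is charged to the Gaussian risk, of which \<open>r h\<close> is a lower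
    bound.\<close>
  define B where "B h = 1 + risk_const * (1 / real h) + \<rho> h / r h" for h
  have \<rho>0: "0 \<le> \<rho> h" for h unfolding \<rho>_def using K C(1) by simp
  have r0: "0 < r h" for h unfolding r_def using c0 by simp
  have B1: "1 \<le> B h" for h
  proof -
    have "0 \<le> risk_const * (1 / real h)" "0 \<le> \<rho> h / r h"
      using risk_const_ge \<rho>0[of h] r0[of h] by auto
    then show ?thesis unfolding B_def by linarith
  qed
  have "(\<lambda>h. \<rho> h / r h) \<longlonglongrightarrow> 0"
    unfolding \<rho>_def[abs_def] r_def[abs_def]
    by (rule remainder_negligible[OF b(1) \<alpha>(1) \<sigma>(1) b(2,3) K C(1) c0])
  moreover have "(\<lambda>h. risk_const * (1 / real h)) \<longlonglongrightarrow> 0"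
    by real_asymp
  ultimately have "B \<longlonglongrightarrow> 1 + 0 + 0"
    unfolding B_def[abs_def] by (intro tendsto_add tendsto_const)
  then have "(\<lambda>h. 1 / B h) \<longlonglongrightarrow> 1 / 1"
    by (intro tendsto_divide tendsto_const) auto
  then have lim: "(\<lambda>h. ennreal (1 / B h)) \<longlonglongrightarrow> 1"
    using tendsto_ennrealI by fastforce
  have "\<forall>\<^sub>F h in sequentially. ennreal (1 / B h) \<le> minimax_soft_risk N g j0 \<Phi> \<Psi> m p q A h /
      minimax_soft_risk M e j0 \<Phi> \<Psi> m p q A h"
    using lower eventually_ge_at_top[of "max 1 j0"]
  proof eventually_elim
    case (elim h)
    let ?I = "wav_indices j0 h" and ?x = "minimax_soft_risk N g j0 \<Phi> \<Psi> m p q A h"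
    let ?T = "{\<theta> \<in> ?I \<rightarrow>\<^sub>E UNIV. besov_norm m p q j0 h \<theta> \<le> A}"
    have h: "j0 \<le> h" "1 \<le> h" using elim by auto
    have rx: "ennreal (r h) \<le> ?x" using elim(1) by (simp add: r_def \<alpha>_def)
    have x: "0 < ?x" "?x < \<top>"
      using less_le_trans[OF _ rx, of 0] r0[of h] minimax_normal_risk_finite[OF N gauss_indep gauss wavelets h(1)]
      by auto
    \<comment> \<open>Dividing by \<open>B h\<close> leaves a bound whose right side alone depends
      on \<open>l\<close>, so the infimum over the Gaussian thresholds can be taken at once.\<close>
    have "minimax_soft_risk M e j0 \<Phi> \<Psi> m p q A h / ennreal (B h)
        \<le> (SUP \<theta> \<in> ?T. soft_risk N g j0 \<Phi> \<Psi> h l \<theta>)" (is "_ \<le> ?F")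
      if l: "l \<in> ?I \<rightarrow>\<^sub>E {0<..}" for l
    proof (rule divide_le_posI_ennreal)
      show "0 < ennreal (B h)" using B1[of h] by simp
      have \<tau>: "0 < 1 / real h" "1 / real h \<le> 1" using h by auto
      obtain l' where l': "l' \<in> ?I \<rightarrow>\<^sub>E {0<..}" and le: "\<And>\<theta>. besov_norm m p q j0 h \<theta> \<le> A \<Longrightarrow>
        (\<Sum>i\<in>?I. scaled_risk M (coeff_noise j0 \<Phi> \<Psi> h e i) h (l' i) (\<theta> i))
        \<le> (1 + risk_const * (1 / real h)) * (\<Sum>i\<in>?I. scaled_normal_risk h (l i) (\<theta> i))
          + \<rho> h"
        using modified_thresholds[where J = "nat \<lfloor>b * real h\<rfloor>" and \<tau> = "1 / real h" and \<sigma> = \<sigma>,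
            OF wavelets h(1) C \<open>1 \<le> p\<close> \<open>1 \<le> q\<close> \<open>0 < A\<close> _ \<sigma>(1) \<tau> l]
        unfolding \<rho>_def K_def \<sigma>_def s_def c_def by blast
      have xF: "?x \<le> ?F"
        unfolding minimax_soft_risk_def by (rule INF_lower[OF l])
      have "minimax_soft_risk M e j0 \<Phi> \<Psi> m p q A h \<le> (SUP \<theta> \<in> ?T. soft_risk M e j0 \<Phi> \<Psi> h l' \<theta>)"
        unfolding minimax_soft_risk_def by (rule INF_lower[OF l'])
      also have "\<dots> \<le> ennreal (1 + risk_const * (1 / real h)) * ?F + ennreal (\<rho> h)"
      proof (rule SUP_least)
        fix \<theta> assume \<theta>: "\<theta> \<in> ?T"
        define G where "G = (\<Sum>i\<in>?I. scaled_normal_risk h (l i) (\<theta> i))"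
        have G0: "0 \<le> G"
          unfolding G_def by (intro sum_nonneg divide_nonneg_nonneg normal_risk_nonneg) auto
        have "soft_risk M e j0 \<Phi> \<Psi> h l' \<theta> = ennreal (\<Sum>i\<in>?I.
            scaled_risk M (coeff_noise j0 \<Phi> \<Psi> h e i) h (l' i) (\<theta> i))"
          using PiE_mem[OF l'] by (intro soft_risk_eq[OF M wavelets h(1)])
            (auto intro: noise_measurable noise_square_integrable)
        also have "\<dots> \<le> ennreal ((1 + risk_const * (1 / real h)) * G + \<rho> h)"
          using le \<theta> unfolding G_def by (intro ennreal_leI) auto
        also have "\<dots> = ennreal (1 + risk_const * (1 / real h)) * ennreal G + ennreal (\<rho> h)"
          using G0 \<rho>0[of h] risk_const_ge by (simp add: ennreal_plus ennreal_mult')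
        also have "ennreal G = soft_risk N g j0 \<Phi> \<Psi> h l \<theta>"
          unfolding G_def using PiE_mem[OF l]
          by (intro normal_soft_risk_eq[OF N gauss_indep gauss wavelets h(1), symmetric]) auto
        also have "soft_risk N g j0 \<Phi> \<Psi> h l \<theta> \<le> ?F" by (rule SUP_upper[OF \<theta>])
        finally show "soft_risk M e j0 \<Phi> \<Psi> h l' \<theta>
            \<le> ennreal (1 + risk_const * (1 / real h)) * ?F + ennreal (\<rho> h)"
          by (simp add: add_right_mono mult_left_mono)
      qed
      also have "ennreal (\<rho> h) = ennreal (\<rho> h / r h) * ennreal (r h)"
        using r0[of h] \<rho>0[of h] by (simp add: ennreal_mult'[symmetric])
      also have "\<dots> \<le> ennreal (\<rho> h / r h) * ?F"
        using rx xF by (intro mult_left_mono) auto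
      also have "ennreal (1 + risk_const * (1 / real h)) * ?F + ennreal (\<rho> h / r h) * ?F = ennreal (B h) * ?F"
      proof -
        have "ennreal (B h) = ennreal (1 + risk_const * (1 / real h)) + ennreal (\<rho> h / r h)"
          unfolding B_def using risk_const_ge \<rho>0[of h] r0[of h] by (intro ennreal_plus) auto
        then show ?thesis by (simp add: distrib_right)
      qed
      finally show "minimax_soft_risk M e j0 \<Phi> \<Psi> m p q A h \<le> ennreal (B h) * ?F"
        by (simp add: add_left_mono)
    qed
    then have *: "minimax_soft_risk M e j0 \<Phi> \<Psi> m p q A h / ennreal (B h) \<le> ?x"
      unfolding minimax_soft_risk_def[of N] by (rule INF_greatest)
    have "minimax_soft_risk M e j0 \<Phi> \<Psi> m p q A h
        = minimax_soft_risk M e j0 \<Phi> \<Psi> m p q A h / ennreal (B h) * ennreal (B h)"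
      using B1[of h] by (subst ennreal_divide_times) (simp add: ennreal_divide_self)
    also have "\<dots> \<le> ?x * ennreal (B h)" using * by (rule mult_right_mono) simp
    finally show ?case
      using B1[of h] x by (intro ennreal_ratio_ge) (auto simp: mult.commute)
  qed
  then have "liminf (\<lambda>h. ennreal (1 / B h)) \<le> liminf (\<lambda>h. minimax_soft_risk N g j0 \<Phi> \<Psi> m p q A h /
      minimax_soft_risk M e j0 \<Phi> \<Psi> m p q A h)"
    by (rule Liminf_mono)
  also have "liminf (\<lambda>h. ennreal (1 / B h)) = 1"
    using lim by (intro lim_imp_Liminf) auto
  finally show ?thesis .
qed

end
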